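(* Let $X=\mathbb{R}/\mathbb{Z}$ be the unit circle (with its standard metric) and let $T:X\to X$ be a covering map with a fixed point $c\in X$. Assume that $T$ is Lipschitz, and that for every open neighborhood $V$ of $c$ there exists $C>1$ such that $|T'(x)|\ge C$ for Lebesgue almost every $x\in X\setminus V$. Then Lipschitz TPO holds for $(X,T)$.
   Context: Lipschitz TPO. For a compact metric space $X$, $Lip(X)$ is the Banach space of real-valued Lipschitz functions on $X$ with the Lipschitz norm (e.g. sup norm plus best Lipschitz constant). For continuous $T:X\to X$, let $\mathcal{M}_T$ be the set of $T$-invariant Borel probability measures and, for continuous $\phi:X\to\mathbb{R}$, let $\beta(\phi)=\max_{\mu\in\mathcal{M}_T}\int\phi\,d\mu$; $\mu\in\mathcal{M}_T$ is a maximizing measure of $\phi$ if $\int\phi\,d\mu=\beta(\phi)$. $\phi$ is maximized by a periodic orbit $\mathcal{O}$ if the invariant probability measure supported on $\mathcal{O}$ is a maximizing measure of $\phi$, and uniquely maximized by $\mathcal{O}$ if this is its only maximizing measure. Lipschitz TPO holds for $(X,T)$ if there is a dense and open subset $\mathcal{G}$ of $Lip(X)$ such that for every $\phi\in\mathcal{G}$ there are an open neighborhood $\mathcal{V}$ of $\phi$ in $Lip(X)$ and a periodic orbit $\mathcal{O}$ of $T$ such that every function in $\mathcal{V}$ is uniquely maximized by $\mathcal{O}$. *)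

theory Defs
  imports "HOL-Probability.Probability"
begin

section \<open>The circle as a metric space\<close>

quotient_type circle = real / "\<lambda>s t :: real. s - t \<in> \<int>"
  morphisms rep_circle to_circle
proof (rule equivpI)
  show "reflp (\<lambda>s t :: real. s - t \<in> \<int>)"
    by (simp add: reflp_def)
  show "symp (\<lambda>s t :: real. s - t \<in> \<int>)"
    by (metis (no_types, lifting) Ints_minus minus_diff_eq sympI)
  show "transp (\<lambda>s t :: real. s - t \<in> \<int>)"
    by (rule transpI) (metis Ints_add diff_add_cancel add_diff_eq)
qed

lemma infdist_Ints_shift:
  fixes x y :: real
  assumes "x - y \<in> \<int>"
  shows "infdist x \<int> = infdist y \<int>"
proof -
  have le: "infdist u \<int> \<le> infdist v \<int>" if "u - v \<in> \<int>" for u v :: real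
  proof -
    obtain a where a: "a \<in> \<int>" "infdist v \<int> = dist v a"
      using infdist_attains_inf[of "\<int> :: real set" v] Ints_0 closed_Ints by blast
    have "a + (u - v) \<in> \<int>" using a that by (rule_tac Ints_add)
    then have "infdist u \<int> \<le> dist u (a + (u - v))" by (rule infdist_le)
    also have "\<dots> = dist v a" by (simp add: dist_real_def)
    finally show ?thesis using a by simp
  qed
  have "y - x \<in> \<int>" using Ints_minus[OF assms] by simp
  with assms show ?thesis by (intro antisym le)
qed

lemma infdist_Ints_minus: "infdist (- x) \<int> = infdist (x :: real) \<int>"
proof -
  have le: "infdist (- u) \<int> \<le> infdist u \<int>" for u :: real
  proof -
    obtain a where a: "a \<in> \<int>" "infdist u \<int> = dist u a"
      using infdist_attains_inf[of "\<int> :: real set" u] Ints_0 closed_Ints by blast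
    have "infdist (- u) \<int> \<le> dist (- u) (- a)" using a by (intro infdist_le) simp
    with a show ?thesis by (simp add: dist_real_def)
  qed
  from le[of x] le[of "- x"] show ?thesis by simp
qed

lemma infdist_Ints_add: "infdist (x + y) \<int> \<le> infdist x \<int> + infdist (y :: real) \<int>"
proof -
  obtain a where a: "a \<in> \<int>" "infdist x \<int> = dist x a"
    using infdist_attains_inf[of "\<int> :: real set" x] Ints_0 closed_Ints by blast
  obtain b where b: "b \<in> \<int>" "infdist y \<int> = dist y b"
    using infdist_attains_inf[of "\<int> :: real set" y] Ints_0 closed_Ints by blast
  have "infdist (x + y) \<int> \<le> dist (x + y) (a + b)" using a b by (intro infdist_le) simp
  also have "\<dots> \<le> dist x a + dist y b" by (simp add: dist_real_def)
  finally show ?thesis using a b by simp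
qed

instantiation circle :: metric_space
begin

lift_definition dist_circle :: "circle \<Rightarrow> circle \<Rightarrow> real"
  is "\<lambda>s t. infdist (s - t) \<int>"
proof -
  fix s s' t t' :: real
  assume "s - s' \<in> \<int>" "t - t' \<in> \<int>"
  then have "(s - t) - (s' - t') \<in> \<int>"
    using Ints_diff[of "s - s'" "t - t'"] by (simp add: algebra_simps)
  then show "infdist (s - t) \<int> = infdist (s' - t') \<int>" by (rule infdist_Ints_shift)
qed

definition uniformity_circle :: "(circle \<times> circle) filter"
  where "uniformity_circle = (INF e\<in>{0 <..}. principal {(x, y). dist x y < e})"

definition open_circle :: "circle set \<Rightarrow> bool"
  where "open_circle S = (\<forall>x\<in>S. \<forall>\<^sub>F (x', y) in uniformity. x' = x \<longrightarrow> y \<in> S)"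

instance
proof
  fix x y z :: circle
  show "dist x y = 0 \<longleftrightarrow> x = y"
    by transfer (metis Ints_0 closed_Ints empty_iff in_closed_iff_infdist_zero)
  show "dist x y \<le> dist x z + dist y z"
  proof transfer
    fix s t u :: real
    have "infdist (s - t) \<int> \<le> infdist (s - u) \<int> + infdist (- (t - u)) \<int>"
      using infdist_Ints_add[of "s - u" "- (t - u)"] by simp
    then show "infdist (s - t) \<int> \<le> infdist (s - u) \<int> + infdist (t - u) \<int>"
      by (simp only: infdist_Ints_minus)
  qed
qed (rule open_circle_def uniformity_circle_def)+

end

lemma to_circle_eq_iff: "to_circle s = to_circle t \<longleftrightarrow> s - t \<in> \<int>"
  using circle.abs_eq_iff by blast

lemma dist_to_circle: "dist (to_circle s) (to_circle t) = infdist (s - t) \<int>"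
  by (rule dist_circle.abs_eq)

lemma dist_to_circle_le: "dist (to_circle s) (to_circle t) \<le> dist s t"
  using infdist_le[of "0 :: real" "\<int>" "s - t"] by (simp add: dist_to_circle dist_real_def)

lemma continuous_on_to_circle: "continuous_on S to_circle"
  unfolding continuous_on_iff using dist_to_circle_le by (meson order.strict_trans1)

lemma to_circle_image: "to_circle ` {0..1} = UNIV"
proof (intro equalityI subset_UNIV subsetI)
  fix x
  obtain t where t: "x = to_circle t" by (metis Quotient_abs_rep Quotient_circle)
  have "x = to_circle (frac t)" by (simp add: t to_circle_eq_iff frac_def)
  moreover have "frac t \<in> {0..1}" using frac_lt_1[of t] by (simp add: less_imp_le)
  ultimately show "x \<in> to_circle ` {0..1}" by blast
qed

lemma compact_circle: "compact (UNIV :: circle set)"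
  using compact_continuous_image[OF continuous_on_to_circle compact_Icc[of 0 1]]
  by (simp add: to_circle_image)

definition circle_lebesgue :: "circle measure"
  where "circle_lebesgue = distr (restrict_space lborel {0..<1}) borel to_circle"

text \<open>
  The derivative of a circle map at a point is the derivative of a continuous lift to the real
  line. Two lifts differ by an integer constant, and over two representatives of the
  same point they differ by integer translations, so the value does not depend on the choices.
\<close>

definition has_circle_derivative :: "(circle \<Rightarrow> circle) \<Rightarrow> real \<Rightarrow> circle \<Rightarrow> bool"
  where "has_circle_derivative T D x \<longleftrightarrow>
    (\<exists>F t. continuous_on UNIV F \<and> (\<forall>s. to_circle (F s) = T (to_circle s)) \<and>
      to_circle t = x \<and> (F has_real_derivative D) (at t))"


section \<open>The normed space of Lipschitz functions\<close>

text \<open>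
  On a compact space the boundedness condition is automatic; it makes the sup norm finite on an
  arbitrary metric space.
\<close>

typedef (overloaded) 'a lip =
  "{f :: 'a::metric_space \<Rightarrow> real. bounded (range f) \<and> (\<exists>L. L-lipschitz_on UNIV f)}"
  morphisms apply_lip Lip
  by (rule exI[of _ "\<lambda>_. 0"]) (auto intro!: exI[of _ 0] lipschitz_on_constant)

setup_lifting type_definition_lip

definition lip_const :: "('a::metric_space \<Rightarrow> real) \<Rightarrow> real"
  where "lip_const f = Inf {L. L-lipschitz_on UNIV f}"

definition sup_norm :: "('a \<Rightarrow> real) \<Rightarrow> real"
  where "sup_norm f = (SUP x. \<bar>f x\<bar>)"

lemma lip_const_le: "L-lipschitz_on UNIV f \<Longrightarrow> lip_const f \<le> L"
  unfolding lip_const_def by (rule cInf_lower) (auto intro!: bdd_belowI[of _ 0] simp: lipschitz_on_def)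

lemma lip_const_lipschitz:
  assumes "L-lipschitz_on UNIV f"
  shows "(lip_const f)-lipschitz_on UNIV f"
proof (rule lipschitz_onI)
  show nonneg: "0 \<le> lip_const f"
    unfolding lip_const_def using assms by (intro cInf_greatest) (auto simp: lipschitz_on_def)
  fix x y
  show "dist (f x) (f y) \<le> lip_const f * dist x y"
  proof (cases "x = y")
    case False
    have "dist (f x) (f y) / dist x y \<le> lip_const f"
      unfolding lip_const_def using assms False
      by (intro cInf_greatest) (auto simp: lipschitz_on_def divide_simps)
    with False show ?thesis by (simp add: divide_simps)
  qed simp
qed

lemma abs_le_sup_norm:
  assumes "bounded (range f)"
  shows "\<bar>f x\<bar> \<le> sup_norm f"
proof -
  obtain b where "\<And>x. \<bar>f x\<bar> \<le> b" using assms by (auto simp: bounded_iff)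
  then show ?thesis unfolding sup_norm_def by (intro cSUP_upper bdd_aboveI2) auto
qed

lemma sup_norm_le: "(\<And>x. \<bar>f x\<bar> \<le> b) \<Longrightarrow> sup_norm f \<le> b"
  unfolding sup_norm_def by (rule cSUP_least) auto

lemma sup_norm_add:
  "bounded (range f) \<Longrightarrow> bounded (range g) \<Longrightarrow>
    sup_norm (\<lambda>x. f x + g x) \<le> sup_norm f + sup_norm g"
  by (rule sup_norm_le) (meson abs_le_sup_norm abs_triangle_ineq add_mono order_trans)

lemma lip_const_add:
  "L-lipschitz_on UNIV f \<Longrightarrow> M-lipschitz_on UNIV g \<Longrightarrow>
    lip_const (\<lambda>x. f x + g x) \<le> lip_const f + lip_const g"
  by (intro lip_const_le lipschitz_on_add lip_const_lipschitz)

lemma sup_norm_scale_le: "bounded (range f) \<Longrightarrow> sup_norm (\<lambda>x. a * f x) \<le> \<bar>a\<bar> * sup_norm f"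
  by (rule sup_norm_le) (simp add: abs_mult mult_left_mono abs_le_sup_norm)

lemma lip_const_scale_le:
  "L-lipschitz_on UNIV f \<Longrightarrow> lip_const (\<lambda>x. a * f x) \<le> \<bar>a\<bar> * lip_const f"
  by (intro lip_const_le lipschitz_on_cmult_real lip_const_lipschitz)

instantiation lip :: (metric_space) real_normed_vector
begin

lift_definition zero_lip :: "'a lip" is "\<lambda>_. 0"
  by (auto intro!: exI[of _ 0] lipschitz_on_constant)

lift_definition plus_lip :: "'a lip \<Rightarrow> 'a lip \<Rightarrow> 'a lip" is "\<lambda>f g x. f x + g x"
  by (auto intro: bounded_plus_comp lipschitz_on_add)

lift_definition uminus_lip :: "'a lip \<Rightarrow> 'a lip" is "\<lambda>f x. - f x"
  by (auto simp: bounded_iff)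

lift_definition minus_lip :: "'a lip \<Rightarrow> 'a lip \<Rightarrow> 'a lip" is "\<lambda>f g x. f x - g x"
  by (auto intro: bounded_minus_comp lipschitz_on_diff)

lift_definition scaleR_lip :: "real \<Rightarrow> 'a lip \<Rightarrow> 'a lip" is "\<lambda>a f x. a * f x"
proof safe
  fix a L and f :: "'a \<Rightarrow> real"
  assume "bounded (range f)" "L-lipschitz_on UNIV f"
  show "bounded (range (\<lambda>x. a * f x))"
    using bounded_scaleR_comp[OF \<open>bounded (range f)\<close>, of a] by simp
  show "\<exists>L. L-lipschitz_on UNIV (\<lambda>x. a * f x)"
    using lipschitz_on_cmult_real[OF \<open>L-lipschitz_on UNIV f\<close>] by blast
qed

lift_definition norm_lip :: "'a lip \<Rightarrow> real" is "\<lambda>f. sup_norm f + lip_const f" .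

definition dist_lip :: "'a lip \<Rightarrow> 'a lip \<Rightarrow> real"
  where "dist_lip f g = norm (f - g)"

definition sgn_lip :: "'a lip \<Rightarrow> 'a lip"
  where "sgn_lip f = inverse (norm f) *\<^sub>R f"

definition uniformity_lip :: "('a lip \<times> 'a lip) filter"
  where "uniformity_lip = (INF e\<in>{0 <..}. principal {(f, g). dist f g < e})"

definition open_lip :: "'a lip set \<Rightarrow> bool"
  where "open_lip S = (\<forall>f\<in>S. \<forall>\<^sub>F (f', g) in uniformity. f' = f \<longrightarrow> g \<in> S)"

lemma norm_lip_scale_le: "norm (a *\<^sub>R f) \<le> \<bar>a\<bar> * norm (f :: 'a lip)"
  by transfer (auto simp: distrib_left intro!: add_mono sup_norm_scale_le lip_const_scale_le)

instance
proof
  fix f g h :: "'a lip" and a b :: real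
  show "f + g + h = f + (g + h)" by transfer (simp add: algebra_simps)
  show "f + g = g + f" by transfer (simp add: algebra_simps)
  show "0 + f = f" by transfer simp
  show "- f + f = 0" by transfer simp
  show "f - g = f + - g" by transfer simp
  show "a *\<^sub>R (f + g) = a *\<^sub>R f + a *\<^sub>R g" by transfer (simp add: algebra_simps)
  show "(a + b) *\<^sub>R f = a *\<^sub>R f + b *\<^sub>R f" by transfer (simp add: algebra_simps)
  show ab: "a *\<^sub>R b *\<^sub>R f = (a * b) *\<^sub>R f" for a b and f :: "'a lip" by transfer (simp add: algebra_simps)
  show one: "1 *\<^sub>R f = f" for f :: "'a lip" by transfer simp
  show "norm (f + g) \<le> norm f + norm g"
  proof transfer
    fix f g :: "'a \<Rightarrow> real"
    assume "bounded (range f) \<and> (\<exists>L. L-lipschitz_on UNIV f)"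
      "bounded (range g) \<and> (\<exists>L. L-lipschitz_on UNIV g)"
    then show "sup_norm (\<lambda>x. f x + g x) + lip_const (\<lambda>x. f x + g x) \<le>
      sup_norm f + lip_const f + (sup_norm g + lip_const g)"
      using sup_norm_add[of f g] lip_const_add[of _ f _ g] by fastforce
  qed
  have zero: "norm (0 :: 'a lip) = 0"
  proof transfer
    have "sup_norm (\<lambda>_::'a. 0) = 0" by (simp add: sup_norm_def)
    moreover have "lip_const (\<lambda>_::'a. 0) = 0"
      using lip_const_le[OF lipschitz_on_constant]
        lipschitz_on_nonneg[OF lip_const_lipschitz[OF lipschitz_on_constant]]
      by (metis antisym)
    ultimately show "sup_norm (\<lambda>_::'a. 0) + lip_const (\<lambda>_::'a. 0) = 0" by simp
  qed
  have "f = 0" if "norm f = 0"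
    using that
  proof transfer
    fix f :: "'a \<Rightarrow> real"
    assume *: "bounded (range f) \<and> (\<exists>L. L-lipschitz_on UNIV f)"
      and n: "sup_norm f + lip_const f = 0"
    have "0 \<le> lip_const f" using * lip_const_lipschitz lipschitz_on_nonneg by blast
    then have "\<bar>f x\<bar> \<le> 0" for x using abs_le_sup_norm[of f x] * n by auto
    then show "f = (\<lambda>_. 0)" by auto
  qed
  with zero show "norm f = 0 \<longleftrightarrow> f = 0" by blast
  show "norm (a *\<^sub>R f) = \<bar>a\<bar> * norm f"
  proof (cases "a = 0")
    case True
    have "0 *\<^sub>R f = 0" by transfer simp
    with True zero show ?thesis by simp
  next
    case False
    have "norm f \<le> \<bar>inverse a\<bar> * norm (a *\<^sub>R f)"
      using norm_lip_scale_le[of "inverse a" "a *\<^sub>R f"] False by (simp add: ab one)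
    then have "\<bar>a\<bar> * norm f \<le> norm (a *\<^sub>R f)"
      using False by (simp add: field_simps)
    with norm_lip_scale_le[of a f] show ?thesis by simp
  qed
qed (rule dist_lip_def sgn_lip_def open_lip_def uniformity_lip_def)+

end


section \<open>Ergodic optimization\<close>

definition invariant_measures :: "('a::topological_space \<Rightarrow> 'a) \<Rightarrow> 'a measure set"
  where "invariant_measures T =
    {\<mu>. prob_space \<mu> \<and> sets \<mu> = sets borel \<and> distr \<mu> borel T = \<mu>}"

text \<open>
  For continuous maps and functions on a nonempty compact space the supremum is attained.
\<close>

definition max_ergodic_average :: "('a::topological_space \<Rightarrow> 'a) \<Rightarrow> ('a \<Rightarrow> real) \<Rightarrow> real"
  where "max_ergodic_average T \<phi> = (SUP \<mu>\<in>invariant_measures T. integral\<^sup>L \<mu> \<phi>)"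

definition maximizing_measure ::
    "('a::topological_space \<Rightarrow> 'a) \<Rightarrow> ('a \<Rightarrow> real) \<Rightarrow> 'a measure \<Rightarrow> bool"
  where "maximizing_measure T \<phi> \<mu> \<longleftrightarrow>
    \<mu> \<in> invariant_measures T \<and> integral\<^sup>L \<mu> \<phi> = max_ergodic_average T \<phi>"

definition periodic_orbit :: "('a \<Rightarrow> 'a) \<Rightarrow> 'a set \<Rightarrow> bool"
  where "periodic_orbit T \<O> \<longleftrightarrow>
    (\<exists>x p. p > 0 \<and> (T ^^ p) x = x \<and> \<O> = (\<lambda>n. (T ^^ n) x) ` {..<p})"

definition orbit_measure :: "'a::topological_space set \<Rightarrow> 'a measure"
  where "orbit_measure \<O> = distr (uniform_count_measure \<O>) borel (\<lambda>x. x)"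

lemma emeasure_orbit_measure:
  assumes "finite \<O>" "A \<in> sets borel"
  shows "emeasure (orbit_measure \<O>) A = ennreal (card (A \<inter> \<O>) / card \<O>)"
proof -
  have "(\<lambda>x. x) \<in> uniform_count_measure \<O> \<rightarrow>\<^sub>M borel"
    by (auto simp: measurable_def sets_uniform_count_measure space_uniform_count_measure)
  then show ?thesis
    using assms unfolding orbit_measure_def
    by (subst emeasure_distr)
      (auto simp: space_uniform_count_measure emeasure_uniform_count_measure)
qed

lemma sets_orbit_measure [simp]: "sets (orbit_measure \<O>) = sets borel"
  by (simp add: orbit_measure_def)

lemma periodic_orbit_finite: "periodic_orbit T \<O> \<Longrightarrow> finite \<O>"
  and periodic_orbit_nonempty: "periodic_orbit T \<O> \<Longrightarrow> \<O> \<noteq> {}"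
  by (auto simp: periodic_orbit_def)

lemma periodic_orbit_image:
  assumes "periodic_orbit T \<O>"
  shows "T ` \<O> = \<O>"
proof -
  obtain x p where p: "p > 0" "(T ^^ p) x = x" and \<O>: "\<O> = (\<lambda>n. (T ^^ n) x) ` {..<p}"
    using assms unfolding periodic_orbit_def by blast
  have "T ` \<O> = (\<lambda>n. (T ^^ n) x) ` Suc ` {..<p}" by (auto simp: \<O> image_image)
  also have "Suc ` {..<p} = insert p ({..<p} - {0})"
    unfolding image_Suc_lessThan using p by auto
  also have "(\<lambda>n. (T ^^ n) x) ` \<dots> = (\<lambda>n. (T ^^ n) x) ` insert 0 ({..<p} - {0})"
    using p by (simp only: image_insert) simp
  also have "insert 0 ({..<p} - {0}) = {..<p}" using p by auto
  finally show ?thesis by (simp add: \<O>)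
qed

text \<open>
  The measure defined above is the invariant probability measure supported on the orbit.
\<close>

lemma orbit_measure_unique:
  fixes T :: "'a::metric_space \<Rightarrow> 'a"
  assumes T: "continuous_on UNIV T" and orb: "periodic_orbit T \<O>"
  shows "{\<mu> \<in> invariant_measures T. emeasure \<mu> \<O> = 1} = {orbit_measure \<O>}"
proof -
  note fin = periodic_orbit_finite[OF orb]
  have T_meas: "T \<in> borel \<rightarrow>\<^sub>M borel" using T by (rule borel_measurable_continuous_onI)
  have fin_borel: "A \<in> sets borel" if "finite A" for A :: "'a set"
    using that by (intro borel_closed finite_imp_closed)
  have card_pos: "card \<O> > 0" using fin periodic_orbit_nonempty[OF orb] by (simp add: card_gt_0_iff)
  have inj: "inj_on T \<O>" using fin periodic_orbit_image[OF orb] by (simp add: finite_surj_inj)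
  let ?\<nu> = "orbit_measure \<O>"
  have one: "emeasure ?\<nu> \<O> = 1" "emeasure ?\<nu> UNIV = 1"
    using card_pos fin periodic_orbit_nonempty[OF orb]
    by (simp_all add: emeasure_orbit_measure fin_borel)
  have "distr ?\<nu> borel T = ?\<nu>"
  proof (rule measure_eqI)
    fix A assume "A \<in> sets (distr ?\<nu> borel T)"
    then have A: "A \<in> sets borel" by simp
    have vA: "T -` A \<in> sets borel" using measurable_sets[OF T_meas A] by simp
    have "T ` (T -` A \<inter> \<O>) = A \<inter> T ` \<O>" by auto
    moreover have "card (T ` (T -` A \<inter> \<O>)) = card (T -` A \<inter> \<O>)"
      by (rule card_image[OF inj_on_subset[OF inj]]) simp
    ultimately have "card (A \<inter> \<O>) = card (T -` A \<inter> \<O>)"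
      by (simp only: periodic_orbit_image[OF orb])
    moreover have "T \<in> ?\<nu> \<rightarrow>\<^sub>M borel" using T_meas by (simp cong: measurable_cong_sets)
    moreover have "space ?\<nu> = UNIV" by (simp add: orbit_measure_def)
    ultimately show "emeasure (distr ?\<nu> borel T) A = emeasure ?\<nu> A"
      using A vA fin by (simp add: emeasure_distr emeasure_orbit_measure)
  qed simp
  moreover have "prob_space ?\<nu>"
    using one by (intro prob_spaceI) (simp add: orbit_measure_def)
  ultimately have \<nu>: "?\<nu> \<in> invariant_measures T" by (simp add: invariant_measures_def)
  have "\<mu> = ?\<nu>" if \<mu>: "\<mu> \<in> invariant_measures T" and \<mu>1: "emeasure \<mu> \<O> = 1" for \<mu>
  proof -
    interpret prob_space \<mu> using \<mu> by (simp add: invariant_measures_def)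
    have sets: "sets \<mu> = sets borel" and inv: "distr \<mu> borel T = \<mu>"
      using \<mu> by (auto simp: invariant_measures_def)
    have space: "space \<mu> = UNIV" using sets_eq_imp_space_eq[OF sets] by simp
    have T_\<mu>: "T \<in> \<mu> \<rightarrow>\<^sub>M borel" using T_meas measurable_cong_sets[OF sets refl] by blast
    have step: "prob {y} \<le> prob {T y}" for y
    proof -
      have "prob {T y} = measure (distr \<mu> borel T) {T y}" by (simp add: inv)
      also have "\<dots> = prob (T -` {T y})"
        using T_\<mu> by (subst measure_distr) (auto simp: fin_borel space)
      also have "\<dots> \<ge> prob {y}"
        using measurable_sets[OF T_\<mu>, of "{T y}"]
        by (intro finite_measure_mono) (auto simp: fin_borel space)
      finally show ?thesis .
    qed
    obtain x p where p: "p > 0" "(T ^^ p) x = x" and \<O>: "\<O> = (\<lambda>n. (T ^^ n) x) ` {..<p}"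
      using orb unfolding periodic_orbit_def by blast
    have mono: "prob {(T ^^ m) x} \<le> prob {(T ^^ n) x}" if "m \<le> n" for m n
      using that by (rule lift_Suc_mono_le[rotated]) (simp add: step)
    have const: "prob {y} = prob {x}" if y: "y \<in> \<O>" for y
    proof -
      obtain n where n: "n < p" "y = (T ^^ n) x" using y \<O> by auto
      then show ?thesis using mono[of 0 n] mono[of n p] p by simp
    qed
    have fin_sum: "prob B = card B * prob {x}" if "B \<subseteq> \<O>" for B
    proof -
      have "prob B = (\<Sum>y\<in>B. prob {y})"
        using that fin by (intro finite_measure_eq_sum_singleton) (auto simp: sets fin_borel finite_subset)
      also have "\<dots> = (\<Sum>y\<in>B. prob {x})" using that const by (intro sum.cong) auto
      finally show ?thesis by simp
    qed
    have "prob \<O> = 1" using \<mu>1 by (simp add: measure_def)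
    then have px: "prob {x} = 1 / card \<O>" using fin_sum[of \<O>] card_pos by (simp add: field_simps)
    show "\<mu> = ?\<nu>"
    proof (rule measure_eqI)
      fix A assume A: "A \<in> sets \<mu>"
      have "AE y in \<mu>. y \<in> \<O>"
        using \<open>prob \<O> = 1\<close> by (rule AE_prob_1)
      then have "prob A = prob (A \<inter> \<O>)"
        using A by (intro finite_measure_eq_AE) (auto simp: sets fin fin_borel)
      also have "\<dots> = card (A \<inter> \<O>) / card \<O>" by (simp add: fin_sum px)
      finally show "emeasure \<mu> A = emeasure ?\<nu> A"
        using A sets fin by (simp add: emeasure_eq_measure emeasure_orbit_measure)
    qed (simp add: sets)
  qed
  with \<nu> one show ?thesis by blast
qed

definition uniquely_maximized ::
    "('a::topological_space \<Rightarrow> 'a) \<Rightarrow> ('a \<Rightarrow> real) \<Rightarrow> 'a set \<Rightarrow> bool"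
  where "uniquely_maximized T \<phi> \<O> \<longleftrightarrow>
    {\<mu>. maximizing_measure T \<phi> \<mu>} = {orbit_measure \<O>}"

definition lipschitz_TPO :: "('a::metric_space \<Rightarrow> 'a) \<Rightarrow> bool"
  where "lipschitz_TPO T \<longleftrightarrow>
    (\<exists>\<G> :: 'a lip set. open \<G> \<and> closure \<G> = UNIV \<and>
      (\<forall>\<phi>\<in>\<G>. \<exists>\<V> \<O>. open \<V> \<and> \<phi> \<in> \<V> \<and> periodic_orbit T \<O> \<and>
        (\<forall>\<psi>\<in>\<V>. uniquely_maximized T (apply_lip \<psi>) \<O>)))"

end

theory Submission
  imports Defs
begin

text \<open>
  The hypotheses make \<open>T\<close> weakly expanding: preimages can be transported along the circle
  without increasing distances, and with uniform contraction away from \<open>c\<close>. Let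
  \<open>\<beta>\<close> be the optimal growth rate of the Birkhoff sums of \<open>\<phi>\<close>. If
  \<open>\<phi> c = \<beta>\<close>, then \<open>\<phi> - \<epsilon> dist(\<sqdot>, c)\<close> is
  stably maximized by the fixed point.

  Otherwise time spent near \<open>c\<close> is costly. Hence nearly optimal backward orbits leave the
  neighbourhood of \<open>c\<close> with positive frequency, which gives them exponential contraction and
  yields a Lipschitz sub-action. So one may assume \<open>\<phi> \<le> \<beta>\<close>, with equality on
  an invariant compact set \<open>Z\<close> that avoids \<open>c\<close>, near which \<open>T\<close> is uniformly expanding.

  By counting itineraries, \<open>Z\<close> carries periodic pseudo-orbits whose error is smaller than
  any given power of the inverse period. Cutting such a pseudo-orbit at two close points at least
  halves the period of one piece and multiplies its error by a bounded factor, so the process ends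
  with a periodic orbit \<open>O\<close> whose total distance to \<open>Z\<close> is negligible compared with
  the gaps between its points. For such an orbit, an orbit leaving a neighbourhood of \<open>O\<close>
  pays more through \<open>- \<epsilon> dist(\<sqdot>, O)\<close> than it can have gained
  while shadowing \<open>O\<close>; so the Birkhoff sums of the normalized perturbation are bounded above,
  which makes \<open>O\<close> uniquely maximizing, stably under small Lipschitz perturbations.
\<close>

section \<open>Birkhoff sums and periodic points\<close>

text \<open>The obstacle is \<open>c\<close>: inverse branches need not contract there, so a
  supremum over backward orbits has no evident Lipschitz bound. The remedy is to let
  \<open>f\<close> itself measure the contraction: with \<open>g = s * (f + \<delta>)\<close> the
  factor \<open>exp (- g)\<close> is a valid rate everywhere, it is at least 1 near
  \<open>c\<close>, where \<open>f \<le> - \<delta>\<close>, and a tail on which the sum of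
  \<open>f\<close> is not very negative contracts exponentially. A power of the period must be
  beaten because a cut may enlarge the error by the factor
  \<open>1 + 2 / (1 - \<theta>) + \<Lambda>\<close>; once \<open>2 ^ \<kappa>\<close> exceeds this,
  error times period to the power \<open>\<kappa>\<close> does not increase under halving.
  Pseudo-orbits of that quality exist because a jump between points with equal words of length
  \<open>n\<close> costs about \<open>\<theta> ^ n\<close>, whereas a graph of words without cycles
  of length up to \<open>s\<close> loses a factor \<open>fact s\<close> in the counting, and an
  \<open>s\<close> that is exponential in \<open>n\<close> with small rate already makes this loss
  unsustainable. The optimal rate is the infimum of the admissible linear rates of Birkhoff sums;
  invariant measures enter only when bounds on sums are integrated.\<close>

definition birkhoff :: "('a \<Rightarrow> 'a) \<Rightarrow> ('a \<Rightarrow> real) \<Rightarrow> nat \<Rightarrow> 'a \<Rightarrow> real"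
  where "birkhoff T f n x = (\<Sum>i<n. f ((T ^^ i) x))"

lemma birkhoff_0 [simp]: "birkhoff T f 0 x = 0"
  by (simp add: birkhoff_def)

lemma birkhoff_Suc: "birkhoff T f (Suc n) x = birkhoff T f n x + f ((T ^^ n) x)"
  by (simp add: birkhoff_def)

lemma birkhoff_add_time: "birkhoff T f (m + n) x = birkhoff T f m x + birkhoff T f n ((T ^^ m) x)"
  by (induction n) (simp_all add: birkhoff_Suc funpow_add add.commute[of m])

lemma birkhoff_add: "birkhoff T (\<lambda>x. f x + g x) n x = birkhoff T f n x + birkhoff T g n x"
  by (simp add: birkhoff_def sum.distrib)

lemma birkhoff_diff: "birkhoff T (\<lambda>x. f x - g x) n x = birkhoff T f n x - birkhoff T g n x"
  by (simp add: birkhoff_def sum_subtractf)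

lemma birkhoff_const [simp]: "birkhoff T (\<lambda>x. k) n x = n * k"
  by (simp add: birkhoff_def)

lemma birkhoff_mono: "(\<And>x. f x \<le> g x) \<Longrightarrow> birkhoff T f n x \<le> birkhoff T g n x"
  by (simp add: birkhoff_def sum_mono)

lemma birkhoff_coboundary: "birkhoff T (\<lambda>x. u x - u (T x)) n x = u x - u ((T ^^ n) x)"
  by (induction n) (simp_all add: birkhoff_Suc)

lemma sum_diff_birkhoff:
  assumes "i \<le> n"
  shows "(\<Sum>j=i..<n. f ((T ^^ j) x)) = birkhoff T f n x - birkhoff T f i x"
  using assms sum_diff_nat_ivl[of 0 i n "\<lambda>j. f ((T ^^ j) x)"]
  by (simp add: birkhoff_def atLeast0LessThan)

text \<open>A finitary substitute for the condition that every invariant measure gives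
  \<open>f\<close> a nonpositive integral; \<open>integral_nonpos_of_sublinear_growth\<close> draws
  that consequence.\<close>

definition sublinear_growth :: "('a \<Rightarrow> 'a) \<Rightarrow> ('a \<Rightarrow> real) \<Rightarrow> bool"
  where "sublinear_growth T f \<longleftrightarrow> (\<forall>\<eta>::real. \<eta> > 0 \<longrightarrow> (\<exists>K::real. \<forall>n x. birkhoff T f n x \<le> \<eta> * real n + K))"

lemma lipschitz_compact_bounded:
  fixes f :: "'a::metric_space \<Rightarrow> real"
  assumes "compact (UNIV :: 'a set)" "L-lipschitz_on UNIV f"
  obtains B where "B > 0" "\<And>x. \<bar>f x\<bar> \<le> B"
proof -
  have "compact (range f)"
    using assms by (intro compact_continuous_image lipschitz_on_continuous_on)
  then obtain B where "B > 0" "\<And>x. \<bar>f x\<bar> \<le> B"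
    using compact_imp_bounded[of "range f"] by (auto simp: bounded_pos)
  then show thesis by (rule that)
qed

lemma continuous_on_funpow:
  fixes T :: "'a::topological_space \<Rightarrow> 'a"
  assumes "continuous_on UNIV T"
  shows "continuous_on UNIV (T ^^ n)"
proof (induction n)
  case (Suc n)
  then show ?case
    using continuous_on_compose[of UNIV "T ^^ n" T] assms by (auto intro: continuous_on_subset)
qed (simp add: id_def)

lemma funpow_in_image_lessThan:
  assumes "p > 0" "(T ^^ p) w = w"
  shows "(T ^^ i) w \<in> (\<lambda>i. (T ^^ i) w) ` {..<p}"
proof -
  have "(T ^^ i) w = (T ^^ (i mod p)) w" using funpow_mod_eq[OF assms(2)] by metis
  then show ?thesis using assms(1) by simp
qed

lemma sum_periodic_shift:
  fixes e :: "nat \<Rightarrow> real"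
  assumes "\<And>n. e (n + p) = e n"
  shows "(\<Sum>i<p. e (m + i)) = (\<Sum>i<p. e i)"
proof (induction m)
  case (Suc m)
  have "(\<Sum>i<Suc p. e (m + i)) = e m + (\<Sum>i<p. e (Suc m + i))"
    by (subst sum.lessThan_Suc_shift) simp
  moreover have "(\<Sum>i<Suc p. e (m + i)) = (\<Sum>i<p. e (m + i)) + e m"
    using assms[of m] by simp
  ultimately show ?case using Suc by simp
qed simp

lemma sum_power_reverse_le:
  fixes q :: real
  assumes "0 \<le> q" "q < 1"
  shows "(\<Sum>i<n. q ^ (n - i)) \<le> 1 / (1 - q)"
proof -
  have "(\<Sum>i<n. q ^ (n - i)) = (\<Sum>i<n. q ^ Suc i)"
    by (rule sum.reindex_bij_witness[of _ "\<lambda>i. n - Suc i" "\<lambda>i. n - Suc i"]) (auto simp: Suc_diff_Suc)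
  also have "\<dots> \<le> (\<Sum>i<n. q ^ i)"
    using assms by (intro sum_mono) (simp add: mult_left_le_one_le)
  also have "\<dots> \<le> 1 / (1 - q)"
    using assms by (simp add: sum_gp_strict divide_right_mono)
  finally show ?thesis .
qed

section \<open>Weakly expanding maps and sub-actions\<close>

text \<open>\<open>pullback\<close> moves a preimage along with a displacement of \<open>T y\<close>
  of any size, as path lifting does on the circle. It says nothing about a second given point; that
  is what \<open>expand\<close> controls, at scale \<open>\<rho>\<close> and with one of the points
  off \<open>c\<close>.\<close>

locale weakly_expanding =
  fixes T :: "'a::metric_space \<Rightarrow> 'a" and c :: 'a and M :: real
  assumes compact_space: "compact (UNIV :: 'a set)"
    and T_lipschitz: "M-lipschitz_on UNIV T"
    and T_fixed: "T c = c"
    and pullback: "r > 0 \<Longrightarrow> \<exists>\<theta>. 0 < \<theta> \<and> \<theta> < 1 \<and>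
      (\<forall>y x. \<exists>y'. T y' = x \<and> dist y y' \<le> dist (T y) x \<and>
        (r \<le> dist y c \<longrightarrow> dist y y' \<le> \<theta> * dist (T y) x))"
    and expand: "r > 0 \<Longrightarrow> \<exists>\<theta> \<rho>. 0 < \<theta> \<and> \<theta> < 1 \<and> 0 < \<rho> \<and>
      (\<forall>y y'. r \<le> dist y c \<longrightarrow> dist y y' < \<rho> \<longrightarrow> dist y y' \<le> \<theta> * dist (T y) (T y'))"
begin

text \<open>Preimages are chosen from time \<open>n\<close> backwards, so the deviation at time
  \<open>i\<close> has passed through the steps \<open>i\<close> to \<open>n - 1\<close> only. The
  rates are read along the orbit of \<open>y\<close>, and \<open>g\<close> may be negative at some
  of its points.\<close>

lemma pullback_orbit:
  assumes contr: "\<And>y x. \<exists>y'. T y' = x \<and> dist y y' \<le> exp (- g y) * dist (T y) x"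
  shows "\<exists>y'. (T ^^ n) y' = x \<and>
    (\<forall>i\<le>n. dist ((T ^^ i) y) ((T ^^ i) y') \<le> exp (- (\<Sum>j=i..<n. g ((T ^^ j) y))) * dist ((T ^^ n) y) x)"
proof (induction n arbitrary: y)
  case 0
  show ?case by (intro exI[of _ x]) simp
next
  case (Suc n)
  obtain y1 where y1: "(T ^^ n) y1 = x"
    "\<And>i. i \<le> n \<Longrightarrow> dist ((T ^^ i) (T y)) ((T ^^ i) y1) \<le>
      exp (- (\<Sum>j=i..<n. g ((T ^^ j) (T y)))) * dist ((T ^^ n) (T y)) x"
    using Suc.IH[of "T y"] by blast
  obtain y' where y': "T y' = y1" "dist y y' \<le> exp (- g y) * dist (T y) y1"
    using contr by blast
  have shift: "(\<Sum>j=i..<n. g ((T ^^ j) (T y))) = (\<Sum>j=Suc i..<Suc n. g ((T ^^ j) y))" for i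
    by (simp only: sum.shift_bounds_Suc_ivl) (simp add: funpow_swap1)
  have "dist ((T ^^ i) y) ((T ^^ i) y') \<le>
    exp (- (\<Sum>j=i..<Suc n. g ((T ^^ j) y))) * dist ((T ^^ Suc n) y) x" if "i \<le> Suc n" for i
  proof (cases i)
    case 0
    have "dist y y' \<le> exp (- g y) * (exp (- (\<Sum>j=1..<Suc n. g ((T ^^ j) y))) * dist ((T ^^ n) (T y)) x)"
      using y'(2) y1(2)[of 0] shift[of 0] by (smt (verit) One_nat_def exp_gt_zero funpow_0 le0 mult_left_mono)
    also have "\<dots> = exp (- (\<Sum>j=0..<Suc n. g ((T ^^ j) y))) * dist ((T ^^ Suc n) y) x"
      by (simp add: sum.atLeast_Suc_lessThan[of 0 "Suc n"] exp_add[symmetric] exp_diff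
        funpow_swap1 field_simps del: sum.op_ivl_Suc)
    finally show ?thesis using 0 by simp
  next
    case (Suc k)
    then show ?thesis
      using y1(2)[of k] that y'(1) shift[of k] by (simp add: funpow_swap1 del: sum.op_ivl_Suc)
  qed
  moreover have "(T ^^ Suc n) y' = x" using y' y1 by (simp add: funpow_swap1)
  ultimately show ?case by blast
qed

text \<open>\<open>u x\<close> is the supremum of the sums of \<open>f\<close> along finite backward
  orbits that end in \<open>x\<close>; appending one step to such an orbit gives the inequality.
  Finiteness and the Lipschitz bound both come from \<open>transport\<close>: a backward orbit
  without very negative tails can be moved to another end point at a cost proportional to the
  distance.\<close>

proposition subaction:
  assumes f_lip: "A-lipschitz_on UNIV f" and "f c < 0" and growth: "sublinear_growth T f"
  obtains u L where "L-lipschitz_on UNIV u" "\<And>y. f y + u y \<le> u (T y)"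
proof -
  \<comment> \<open>Half of the deficit at \<open>c\<close>, so that
    \<open>f \<le> - \<delta>\<close> persists on a ball around \<open>c\<close>.\<close>
  define \<delta> where "\<delta> = - f c / 2"
  have "\<delta> > 0" using assms by (simp add: \<delta>_def)
  have "A \<ge> 0" using f_lip by (rule lipschitz_on_nonneg)
  define r where "r = \<delta> / (A + 1)"
  have "r > 0" using \<open>\<delta> > 0\<close> \<open>A \<ge> 0\<close> by (simp add: r_def)
  have near: "f y \<le> - \<delta>" if "dist y c < r" for y
  proof -
    have "f y - f c \<le> A * dist y c"
      using lipschitz_onD[OF f_lip, of y c] by (simp add: dist_real_def)
    also have "\<dots> \<le> A * r" using that \<open>A \<ge> 0\<close> by (intro mult_left_mono) auto
    also have "\<dots> \<le> \<delta>" using \<open>A \<ge> 0\<close> \<open>\<delta> > 0\<close> by (simp add: r_def field_simps)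
    finally show ?thesis by (simp add: \<delta>_def)
  qed
  obtain B where "B > 0" and fB: "\<And>x. \<bar>f x\<bar> \<le> B"
    using lipschitz_compact_bounded[OF compact_space f_lip] by blast
  obtain \<theta> where \<theta>: "0 < \<theta>" "\<theta> < 1"
    and pb: "\<And>y x. \<exists>y'. T y' = x \<and> dist y y' \<le> dist (T y) x \<and>
        (r \<le> dist y c \<longrightarrow> dist y y' \<le> \<theta> * dist (T y) x)"
    using pullback[OF \<open>r > 0\<close>] by blast
  \<comment> \<open>Normalized so that \<open>exp (- s * (B + \<delta>)) = \<theta>\<close>: then
    \<open>exp (- g)\<close> is at least \<open>\<theta>\<close> everywhere and at least 1 near
    \<open>c\<close>, hence a valid rate in both regimes.\<close>
  define s where "s = - ln \<theta> / (B + \<delta>)"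
  have "s > 0" using \<theta> \<open>B > 0\<close> \<open>\<delta> > 0\<close> by (simp add: s_def divide_neg_pos)
  define g where "g y = s * (f y + \<delta>)" for y
  have contr: "\<exists>y'. T y' = x \<and> dist y y' \<le> exp (- g y) * dist (T y) x" for y x
  proof -
    obtain y' where y': "T y' = x" "dist y y' \<le> dist (T y) x"
        "r \<le> dist y c \<Longrightarrow> dist y y' \<le> \<theta> * dist (T y) x"
      using pb by blast
    have "dist y y' \<le> exp (- g y) * dist (T y) x"
    proof (cases "r \<le> dist y c")
      case True
      have "s * (f y + \<delta>) \<le> s * (B + \<delta>)" using fB[of y] \<open>s > 0\<close> by (intro mult_left_mono) auto
      then have "exp (ln \<theta>) \<le> exp (- g y)" using \<open>B > 0\<close> \<open>\<delta> > 0\<close> by (simp add: g_def s_def del: exp_ln)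
      then have "\<theta> * dist (T y) x \<le> exp (- g y) * dist (T y) x" using \<theta> by (intro mult_right_mono) auto
      then show ?thesis using y'(3)[OF True] by simp
    next
      case False
      then have "f y + \<delta> \<le> 0" using near[of y] by simp
      then have "g y \<le> 0" using \<open>s > 0\<close> by (simp add: g_def mult_nonneg_nonpos)
      then have "1 * dist (T y) x \<le> exp (- g y) * dist (T y) x" by (intro mult_right_mono) auto
      then show ?thesis using y'(2) by simp
    qed
    with y' show ?thesis by blast
  qed
  define q where "q = exp (- s * \<delta>)"
  have q: "0 < q" "q < 1" using \<open>s > 0\<close> \<open>\<delta> > 0\<close> by (simp_all add: q_def)
  define L where "L K = A * exp (s * K) / (1 - q)" for K
  have L_nonneg: "L K \<ge> 0" for K using \<open>A \<ge> 0\<close> q by (simp add: L_def)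
  \<comment> \<open>By \<open>tail\<close>, every tail of the sum of \<open>f\<close> is at least
    \<open>- K\<close>, so the sum of \<open>g\<close> from time \<open>i\<close> on is at least
    \<open>s * \<delta> * (n - i) - s * K\<close>.\<close>
  have transport: "\<exists>y'. (T ^^ n) y' = x \<and> birkhoff T f n y - L K * dist ((T ^^ n) y) x \<le> birkhoff T f n y'"
    if tail: "\<And>i. i \<le> n \<Longrightarrow> birkhoff T f i y \<le> birkhoff T f n y + K" for n y x K
  proof -
    obtain y' where y': "(T ^^ n) y' = x"
      "\<And>i. i \<le> n \<Longrightarrow> dist ((T ^^ i) y) ((T ^^ i) y') \<le> exp (- (\<Sum>j=i..<n. g ((T ^^ j) y))) * dist ((T ^^ n) y) x"
      using pullback_orbit[OF contr, of n x y] by blast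
    have bound: "dist ((T ^^ i) y) ((T ^^ i) y') \<le> exp (s * K) * q ^ (n - i) * dist ((T ^^ n) y) x" if "i < n" for i
    proof -
      have "(\<Sum>j=i..<n. g ((T ^^ j) y)) = s * (\<Sum>j=i..<n. f ((T ^^ j) y)) + s * \<delta> * (n - i)"
        using that by (simp add: g_def sum_distrib_left[symmetric] sum.distrib algebra_simps of_nat_diff)
      also have "\<dots> \<ge> s * (- K) + s * \<delta> * (n - i)"
        using tail[of i] that \<open>s > 0\<close> by (intro add_right_mono mult_left_mono) (simp_all add: sum_diff_birkhoff)
      finally have "exp (- (\<Sum>j=i..<n. g ((T ^^ j) y))) \<le> exp (s * K - s * \<delta> * (n - i))"
        by simp
      also have "\<dots> = exp (s * K) * q ^ (n - i)"
        by (simp add: q_def exp_diff exp_minus exp_of_nat2_mult[symmetric] power_inverse field_simps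
          flip: exp_of_nat_mult)
      finally show ?thesis using y'(2)[of i] that by (smt (verit) less_imp_le mult_right_mono zero_le_dist)
    qed
    have "birkhoff T f n y - birkhoff T f n y' = (\<Sum>i<n. f ((T ^^ i) y) - f ((T ^^ i) y'))"
      by (simp add: birkhoff_def sum_subtractf)
    also have "\<dots> \<le> (\<Sum>i<n. A * (exp (s * K) * q ^ (n - i) * dist ((T ^^ n) y) x))"
    proof (rule sum_mono)
      fix i assume "i \<in> {..<n}"
      then have "A * dist ((T ^^ i) y) ((T ^^ i) y') \<le> A * (exp (s * K) * q ^ (n - i) * dist ((T ^^ n) y) x)"
        using bound[of i] \<open>A \<ge> 0\<close> by (intro mult_left_mono) auto
      then show "f ((T ^^ i) y) - f ((T ^^ i) y') \<le> A * (exp (s * K) * q ^ (n - i) * dist ((T ^^ n) y) x)"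
        using lipschitz_onD[OF f_lip, of "(T ^^ i) y" "(T ^^ i) y'"] by (simp add: dist_real_def)
    qed
    also have "\<dots> = A * exp (s * K) * dist ((T ^^ n) y) x * (\<Sum>i<n. q ^ (n - i))"
      by (simp add: sum_distrib_left mult_ac)
    also have "\<dots> \<le> A * exp (s * K) * dist ((T ^^ n) y) x * (1 / (1 - q))"
      using q \<open>A \<ge> 0\<close> by (intro mult_left_mono sum_power_reverse_le) auto
    also have "\<dots> = L K * dist ((T ^^ n) y) x" by (simp add: L_def)
    finally show ?thesis using y'(1) by (intro exI[of _ y']) simp
  qed
  define R where "R = diameter (UNIV :: 'a set)"
  have R: "dist x y \<le> R" for x y :: 'a
    unfolding R_def using compact_imp_bounded[OF compact_space] by (rule diameter_bounded_bound) simp_all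
  \<comment> \<open>\<open>L 1 * R\<close> bounds the cost of a transport, one unit covers the
    near-maximality of the sum chosen below, and one unit remains as gain.\<close>
  define K2 where "K2 = L 1 * R + 2"
  have step_trivial: "birkhoff T f n x \<le> n * B" for n x
    using birkhoff_mono[of f "\<lambda>_. B" T n x] fB by (simp add: abs_le_iff)
  \<comment> \<open>A near-maximal sum among the times up to \<open>N\<close> has tails at least -1.
    If it exceeded \<open>K2\<close>, it could be transported to end at any prescribed point with
    sum at least 1; concatenating such blocks of length \<open>n\<close> yields growth rate at least
    \<open>1 / n\<close>.\<close>
  have bounded_sums: "birkhoff T f N x \<le> K2" for N x
  proof (rule ccontr)
    assume "\<not> birkhoff T f N x \<le> K2"
    define S where "S = (\<lambda>(n, y). birkhoff T f n y) ` ({..N} \<times> UNIV)"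
    have bdd: "bdd_above S"
      unfolding S_def
    proof (rule bdd_aboveI2, clarify)
      fix n y assume "n \<le> N"
      then show "birkhoff T f n y \<le> N * B"
        using step_trivial[of n y] \<open>B > 0\<close> by (smt (verit) mult_right_mono of_nat_le_iff)
    qed
    have "birkhoff T f N x \<in> S" by (force simp: S_def)
    then have "Sup S - 1 < Sup S" "S \<noteq> {}" "Sup S > K2"
      using cSup_upper[OF _ bdd] \<open>\<not> _ \<le> K2\<close> by force+
    then obtain n y where n: "n \<le> N" "Sup S - 1 < birkhoff T f n y"
      using less_cSupD[of S "Sup S - 1"] by (auto simp: S_def)
    have tail: "birkhoff T f i y \<le> birkhoff T f n y + 1" if "i \<le> n" for i
    proof -
      have "birkhoff T f i y \<in> S" using that n by (force simp: S_def)
      then show ?thesis using cSup_upper[OF _ bdd] n by fastforce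
    qed
    have gain: "\<exists>y'. (T ^^ n) y' = x' \<and> 1 \<le> birkhoff T f n y'" for x'
    proof -
      obtain y' where y': "(T ^^ n) y' = x'" "birkhoff T f n y - L 1 * dist ((T ^^ n) y) x' \<le> birkhoff T f n y'"
        using transport[OF tail] by blast
      have "L 1 * dist ((T ^^ n) y) x' \<le> L 1 * R" using R L_nonneg by (intro mult_left_mono)
      then show ?thesis using y' n \<open>Sup S > K2\<close> by (intro exI[of _ y']) (simp add: K2_def)
    qed
    then have "n > 0" by (metis birkhoff_0 gr0I not_one_le_zero)
    have iter: "\<exists>y'. (T ^^ (k * n)) y' = x' \<and> k \<le> birkhoff T f (k * n) y'" for k x'
    proof (induction k arbitrary: x')
      case (Suc k)
      obtain y1 where y1: "(T ^^ n) y1 = x'" "1 \<le> birkhoff T f n y1" using gain by blast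
      obtain y2 where y2: "(T ^^ (k * n)) y2 = y1" "k \<le> birkhoff T f (k * n) y2" using Suc by blast
      have "(T ^^ (n + k * n)) y2 = x'" using y1 y2 by (simp add: funpow_add)
      moreover have "Suc k \<le> birkhoff T f (k * n + n) y2"
        using y1 y2 by (simp add: birkhoff_add_time)
      ultimately show ?case by (auto simp: add.commute)
    qed auto
    have "0 < 1 / (2 * real n)" using \<open>n > 0\<close> by simp
    then obtain K where K: "\<And>m x. birkhoff T f m x \<le> 1 / (2 * real n) * real m + K"
      using growth unfolding sublinear_growth_def by blast
    obtain k :: nat where k: "k > 2 * K" using reals_Archimedean2 by blast
    obtain y' where "k \<le> birkhoff T f (k * n) y'" using iter by blast
    also have "\<dots> \<le> k / 2 + K" using K[of "k * n" y'] \<open>n > 0\<close> by simp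
    finally show False using k by simp
  qed
  define U where "U x = {birkhoff T f n y | n y. (T ^^ n) y = x}" for x
  have U0: "0 \<in> U x" for x
    unfolding U_def by (rule CollectI, rule exI[of _ 0], rule exI[of _ x]) simp
  have Ubdd: "bdd_above (U x)" for x
    by (rule bdd_aboveI[of _ K2]) (auto simp: U_def bounded_sums)
  define u where "u x = Sup (U x)" for x
  have u_nonneg: "0 \<le> u x" for x unfolding u_def using U0 Ubdd by (rule cSup_upper)
  have u_ge: "birkhoff T f n y \<le> u x" if "(T ^^ n) y = x" for n x y
    unfolding u_def using that Ubdd by (intro cSup_upper) (auto simp: U_def)
  \<comment> \<open>A sum within 1 of \<open>u x \<ge> 0\<close> is at least -1 and all sums are at
    most \<open>K2\<close>, so no tail is below \<open>- (1 + K2)\<close>. Capping \<open>e\<close>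
    at 1 keeps this constant independent of \<open>e\<close>.\<close>
  let ?L = "L (1 + K2)"
  have u_lip: "u x - ?L * dist x x' \<le> u x'" for x x'
  proof (rule field_le_epsilon)
    fix e :: real assume "e > 0"
    define e' where "e' = min e 1"
    have "u x - e' < Sup (U x)" using \<open>e > 0\<close> by (simp add: u_def e'_def)
    then obtain n y where ny: "(T ^^ n) y = x" "u x - e' < birkhoff T f n y"
      using less_cSupD[of "U x"] U0 by (fastforce simp: U_def)
    have "birkhoff T f i y \<le> birkhoff T f n y + (1 + K2)" for i
      using bounded_sums[of i y] ny(2) u_nonneg[of x] by (simp add: e'_def)
    then obtain y' where "(T ^^ n) y' = x'" "birkhoff T f n y - ?L * dist x x' \<le> birkhoff T f n y'"
      using transport[of n y "1 + K2" x'] ny(1) by blast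
    then show "u x - ?L * dist x x' \<le> u x' + e"
      using u_ge[of n y' x'] ny(2) by (simp add: e'_def)
  qed
  have "?L-lipschitz_on UNIV u"
  proof (rule lipschitz_onI)
    fix x x'
    show "dist (u x) (u x') \<le> ?L * dist x x'"
      using u_lip[of x x'] u_lip[of x' x] by (simp add: dist_real_def dist_commute abs_le_iff)
  qed (rule L_nonneg)
  moreover have "f y + u y \<le> u (T y)" for y
  proof -
    have "u y \<le> u (T y) - f y"
      unfolding u_def[of y]
    proof (rule cSup_least)
      show "U y \<noteq> {}" using U0 by blast
      fix t assume "t \<in> U y"
      then obtain n y' where "t = birkhoff T f n y'" "(T ^^ n) y' = y" by (auto simp: U_def)
      then show "t \<le> u (T y) - f y" using u_ge[of "Suc n" y' "T y"] by (simp add: birkhoff_Suc)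
    qed
    then show ?thesis by simp
  qed
  ultimately show thesis by (rule that)
qed

end

section \<open>Counting itineraries\<close>

lemma strict_mono_on_bounded_eq_id:
  fixes \<sigma> :: "nat \<Rightarrow> nat"
  assumes less: "\<And>i. Suc i < s \<Longrightarrow> \<sigma> i < \<sigma> (Suc i)" and bound: "\<And>i. i < s \<Longrightarrow> \<sigma> i < s"
    and "i < s"
  shows "\<sigma> i = i"
proof (rule antisym)
  show "i \<le> \<sigma> i" using \<open>i < s\<close>
  proof (induction i)
    case (Suc i)
    then show ?case using less[of i] by simp
  qed simp
  have "\<sigma> i + k < s" if "i + k < s" for k
  proof -
    have "\<sigma> i + k \<le> \<sigma> (i + k)" using that
    proof (induction k)
      case (Suc k)
      then show ?case using less[of "i + k"] by simp
    qed simp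
    then show ?thesis using bound[OF that] by simp
  qed
  from this[of "s - Suc i"] show "\<sigma> i \<le> i" using \<open>i < s\<close> by simp
qed

text \<open>
  If a digraph has no short cycle, then every set of \<open>s\<close> vertices induces an acyclic graph,
  which has at most one Hamiltonian path.
\<close>

lemma card_walks_le_binomial:
  assumes "finite V"
    and no_cycle: "\<And>t f. 0 < t \<Longrightarrow> t \<le> s \<Longrightarrow> f t = f 0 \<Longrightarrow> (\<And>i. i < t \<Longrightarrow> R (f i) (f (Suc i))) \<Longrightarrow> False"
    and P: "\<And>xs. xs \<in> P \<Longrightarrow> length xs = s \<and> set xs \<subseteq> V \<and> (\<forall>i. Suc i < s \<longrightarrow> R (xs ! i) (xs ! Suc i))"
  shows "card P \<le> card V choose s"
proof -
  \<comment> \<open>Such an edge would close the segment from \<open>i\<close> to \<open>j\<close>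
    to a cycle of length \<open>j - i + 1\<close>.\<close>
  have no_back_edge: "False"
    if xs: "xs \<in> P" and ij: "i \<le> j" "j < s" and R: "R (xs ! j) (xs ! i)" for xs i j
  proof (rule no_cycle[of "Suc (j - i)" "\<lambda>m. if m \<le> j - i then xs ! (i + m) else xs ! i"])
    show "Suc (j - i) \<le> s" using ij by simp
    fix m assume m: "m < Suc (j - i)"
    show "R (if m \<le> j - i then xs ! (i + m) else xs ! i)
        (if Suc m \<le> j - i then xs ! (i + Suc m) else xs ! i)"
    proof (cases "m = j - i")
      case True
      then show ?thesis using R ij by simp
    next
      case False
      then show ?thesis using m P[OF xs] ij by simp
    qed
  qed auto
  have distinct: "distinct xs" if xs: "xs \<in> P" for xs
  proof (rule ccontr)
    assume "\<not> distinct xs"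
    then obtain i j where ij: "i < j" "j < s" "xs ! i = xs ! j"
      using P[OF xs] by (metis distinct_conv_nth linorder_neqE_nat)
    have "R (xs ! (j - 1)) (xs ! i)" using P[OF xs] ij by (metis Suc_diff_1 gr_implies_not0 not_gr_zero)
    then show False by (rule no_back_edge[OF xs, rotated 2]) (use ij in auto)
  qed
  have "inj_on set P"
  proof (rule inj_onI)
    fix xs ys assume xs: "xs \<in> P" and ys: "ys \<in> P" and eq: "set xs = set ys"
    have "\<exists>k<s. ys ! i = xs ! k" if "i < s" for i
      using P[OF xs] P[OF ys] eq that by (metis in_set_conv_nth)
    then obtain \<sigma> where \<sigma>: "\<And>i. i < s \<Longrightarrow> \<sigma> i < s" "\<And>i. i < s \<Longrightarrow> ys ! i = xs ! \<sigma> i"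
      by metis
    \<comment> \<open>An edge of \<open>ys\<close> cannot point backwards along \<open>xs\<close>,
      so the reordering \<open>\<sigma>\<close> is increasing and hence the identity.\<close>
    have "\<sigma> i < \<sigma> (Suc i)" if "Suc i < s" for i
    proof (rule ccontr)
      assume "\<not> \<sigma> i < \<sigma> (Suc i)"
      moreover have "R (ys ! i) (ys ! Suc i)" using P[OF ys] that by blast
      then have "R (xs ! \<sigma> i) (xs ! \<sigma> (Suc i))" using \<sigma>(2)[of i] \<sigma>(2)[of "Suc i"] that by simp
      ultimately show False using no_back_edge[OF xs, of "\<sigma> (Suc i)" "\<sigma> i"] \<sigma>(1)[of i] that by simp
    qed
    then have "\<sigma> i = i" if "i < s" for i
      using strict_mono_on_bounded_eq_id[of s \<sigma> i] \<sigma>(1) that by blast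
    then show "xs = ys" using P[OF xs] P[OF ys] \<sigma>(2) by (intro nth_equalityI) auto
  qed
  then have "card P = card (set ` P)" by (simp add: card_image)
  also have "\<dots> \<le> card {A. A \<subseteq> V \<and> card A = s}"
    using P distinct \<open>finite V\<close> distinct_card by (intro card_mono) (auto, fastforce)
  also have "\<dots> = card V choose s" using \<open>finite V\<close> by (rule n_subsets)
  finally show ?thesis .
qed

lemma concat_map_upt_shift:
  "concat (map (\<lambda>i. map (\<lambda>k. f (n * i + k)) [0..<n]) [0..<s]) = map f [0..<s * n]"
proof (induction s)
  case (Suc s)
  have "map f [0..<Suc s * n] = map f ([0..<s * n] @ [s * n..<s * n + n])"
    using upt_add_eq_append[of 0 "s * n" n] by (simp add: add.commute)
  also have "map f [s * n..<s * n + n] = map (\<lambda>k. f (n * s + k)) [0..<n]"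
    by (rule nth_equalityI) (auto simp: mult.commute)
  ultimately show ?case using Suc by simp
qed simp

definition itinerary :: "('a \<Rightarrow> 'b) \<Rightarrow> ('a \<Rightarrow> 'a) \<Rightarrow> nat \<Rightarrow> 'a \<Rightarrow> 'b list"
  where "itinerary \<alpha> T n z = map (\<lambda>i. \<alpha> ((T ^^ i) z)) [0..<n]"

text \<open>Cut into blocks of length \<open>n\<close>, an itinerary is a walk with \<open>s\<close>
  vertices in the graph of \<open>n\<close>-words, whose edges are the pairs that follow each other
  along an orbit in \<open>Z\<close>. A cycle of this graph provides one point of \<open>Z\<close>
  for each edge, and these are the points that \<open>no_cycle\<close> forbids.\<close>

lemma card_itinerary_le_binomial:
  assumes "finite (range \<alpha>)" and inv: "\<And>z. z \<in> Z \<Longrightarrow> T z \<in> Z"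
    and no_cycle: "\<And>t \<zeta>. 0 < t \<Longrightarrow> t \<le> s \<Longrightarrow> (\<And>i. \<zeta> i \<in> Z) \<Longrightarrow> (\<And>i. \<zeta> (i + t) = \<zeta> i) \<Longrightarrow>
      (\<And>i. itinerary \<alpha> T n ((T ^^ n) (\<zeta> i)) = itinerary \<alpha> T n (\<zeta> (Suc i))) \<Longrightarrow> False"
  shows "card (itinerary \<alpha> T (s * n) ` Z) \<le> card (itinerary \<alpha> T n ` Z) choose s"
proof -
  define walk where "walk z = map (\<lambda>i. itinerary \<alpha> T n ((T ^^ (n * i)) z)) [0..<s]" for z
  define R where "R u v \<longleftrightarrow> (\<exists>z\<in>Z. itinerary \<alpha> T n z = u \<and> itinerary \<alpha> T n ((T ^^ n) z) = v)" for u v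
  have fin: "finite (itinerary \<alpha> T m ` Z)" for m
    by (rule finite_subset[OF _ finite_lists_length_eq[OF assms(1), of m]]) (auto simp: itinerary_def)
  have inv_pow: "(T ^^ m) z \<in> Z" if "z \<in> Z" for m z
    using that by (induction m) (auto intro: inv)
  have "itinerary \<alpha> T (s * n) z = concat (walk z)" for z
    using concat_map_upt_shift[of "\<lambda>i. \<alpha> ((T ^^ i) z)" n s]
    by (simp add: walk_def itinerary_def funpow_add add.commute)
  then have "itinerary \<alpha> T (s * n) ` Z = concat ` walk ` Z" by (simp add: image_image)
  moreover have "finite (walk ` Z)"
    by (rule finite_subset[OF _ finite_lists_length_eq[OF fin[of n], of s]])
      (auto simp: walk_def intro!: imageI inv_pow)
  ultimately have "card (itinerary \<alpha> T (s * n) ` Z) \<le> card (walk ` Z)" by (simp add: card_image_le)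
  also have "\<dots> \<le> card (itinerary \<alpha> T n ` Z) choose s"
  proof (rule card_walks_le_binomial[OF fin, where R = R])
    fix xs assume "xs \<in> walk ` Z"
    then obtain z where z: "z \<in> Z" "xs = walk z" by blast
    have "R (xs ! i) (xs ! Suc i)" if "Suc i < s" for i
      using that z inv_pow[OF z(1), of "n * i"] by (auto simp: R_def walk_def funpow_add intro!: bexI[of _ "(T ^^ (n * i)) z"])
    then show "length xs = s \<and> set xs \<subseteq> itinerary \<alpha> T n ` Z \<and> (\<forall>i. Suc i < s \<longrightarrow> R (xs ! i) (xs ! Suc i))"
      using z inv_pow by (auto simp: walk_def)
  next
    fix t f assume t: "0 < t" "t \<le> s" "f t = f 0" "\<And>i. i < t \<Longrightarrow> R (f i) (f (Suc i))"
    then obtain z where z: "\<And>i. i < t \<Longrightarrow> z i \<in> Z \<and> itinerary \<alpha> T n (z i) = f i \<and>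
        itinerary \<alpha> T n ((T ^^ n) (z i)) = f (Suc i)"
      unfolding R_def by metis
    show False
    \<comment> \<open>Reduction modulo \<open>t\<close> makes the finite cycle a periodic
      sequence.\<close>
    proof (rule no_cycle[OF t(1,2), of "\<lambda>i. z (i mod t)"])
      fix i
      show "z (i mod t) \<in> Z" using z t by simp
      show "itinerary \<alpha> T n ((T ^^ n) (z (i mod t))) = itinerary \<alpha> T n (z (Suc i mod t))"
      proof (cases "Suc (i mod t) = t")
        case True
        then show ?thesis using z[of "i mod t"] z[of 0] t(1,3) by (simp add: mod_Suc)
      next
        case False
        then have "Suc (i mod t) < t" using t(1) by (simp add: Suc_lessI)
        then show ?thesis using z[of "i mod t"] z[of "Suc (i mod t)"] by (simp add: mod_Suc)
      qed
    qed simp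
  qed
  finally show ?thesis .
qed

text \<open>The term of index \<open>s\<close> of the exponential series at \<open>s\<close> is at
  most its sum.\<close>

lemma fact_ge_power: "(real s / exp 1) ^ s \<le> fact s"
proof -
  have "real s ^ s / fact s \<le> exp (real s)"
  proof -
    have "(\<Sum>k\<in>{s}. inverse (fact k) * real s ^ k) \<le> (\<Sum>k. inverse (fact k) * real s ^ k)"
      using summable_exp[of "real s"] by (intro sum_le_suminf) auto
    then show ?thesis by (simp add: exp_def divide_inverse mult.commute)
  qed
  then show ?thesis
    by (simp add: power_divide field_simps flip: exp_of_nat_mult)
qed

text \<open>
  The counting inequality forces the exponential growth rate \<open>ln (W n) / n\<close> to drop by a
  fixed amount when passing from \<open>n\<close> to \<open>s * n\<close>, which cannot be repeated forever.
\<close>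

lemma no_repeated_drop:
  fixes W :: "nat \<Rightarrow> nat"
  assumes W: "\<And>n. W n \<ge> 1" and "\<epsilon> > 0"
    and drop: "\<And>n. n \<ge> n0 \<Longrightarrow> \<exists>s\<ge>1. ln (W (s * n)) + real s * real n * \<epsilon> \<le> real s * ln (W n)"
  shows False
proof -
  define h where "h n = ln (W n) / real n" for n
  have h_nonneg: "0 \<le> h n" for n using W[of n] by (simp add: h_def)
  define H where "H = h ` {Suc n0..}"
  have bdd: "bdd_below H" by (rule bdd_belowI[of _ 0]) (auto simp: H_def h_nonneg)
  have "H \<noteq> {}" by (simp add: H_def)
  \<comment> \<open>A rate within \<open>\<epsilon>\<close> of the infimum cannot drop by
    \<open>\<epsilon>\<close>, so one application of \<open>drop\<close> suffices.\<close>
  then obtain y where "y \<in> H" "y < Inf H + \<epsilon>"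
    using cInf_lessD[of H "Inf H + \<epsilon>"] \<open>\<epsilon> > 0\<close> by auto
  then obtain n where n: "n > n0" "h n < Inf H + \<epsilon>"
    by (auto simp: H_def Suc_le_eq)
  obtain s where s: "s \<ge> 1" "ln (W (s * n)) + real s * real n * \<epsilon> \<le> real s * ln (W n)"
    using drop[of n] n by auto
  have "h (s * n) + \<epsilon> \<le> h n"
    using divide_right_mono[OF s(2), of "real (s * n)"] s(1) n by (simp add: h_def add_divide_distrib)
  moreover have "s * n \<ge> Suc n0" using s n by (metis Suc_leI le_trans mult_le_mono1 nat_mult_1)
  then have "Inf H \<le> h (s * n)" by (intro cInf_lower bdd) (simp add: H_def)
  ultimately show False using n by simp
qed

text \<open>Choosing sets instead of sequences saves the factor \<open>fact s\<close>, since
  \<open>(b choose s) * fact s \<le> b ^ s\<close>. This factor is at least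
  \<open>(s / exp 1) ^ s\<close>, hence at least \<open>exp (s * n * \<epsilon>)\<close> by the
  condition on \<open>s\<close>.\<close>

lemma drop_of_binomial_bound:
  assumes "real a \<le> real (b choose s)" "a \<ge> 1" "s \<ge> 1" "exp 1 * exp (real n * \<epsilon>) \<le> real s"
  shows "ln (real a) + real s * real n * \<epsilon> \<le> real s * ln (real b)"
proof -
  have "b choose s \<noteq> 0" using assms by (intro notI) simp
  then have "b > 0" using assms by (cases b) auto
  have "real a * exp (real s * real n * \<epsilon>) = real a * exp (real n * \<epsilon>) ^ s"
    by (simp add: exp_of_nat_mult[symmetric] mult_ac)
  also have "\<dots> \<le> real (b choose s) * (real s / exp 1) ^ s"
    using assms by (intro mult_mono power_mono) (auto simp: field_simps)
  also have "\<dots> \<le> real (b choose s) * fact s" by (intro mult_left_mono fact_ge_power) auto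
  also have "\<dots> = real ((b choose s) * fact s)" by simp
  also have "\<dots> \<le> real (b ^ s)" using binomial_fact_pow[of b s] by (simp only: of_nat_le_iff)
  also have "\<dots> = real b ^ s" by simp
  finally have "ln (real a * exp (real s * real n * \<epsilon>)) \<le> ln (real b ^ s)"
    using assms by (intro ln_mono) auto
  then show ?thesis using assms \<open>b > 0\<close> by (simp add: ln_mult ln_realpow)
qed

section \<open>Periodic pseudo-orbits\<close>

context weakly_expanding
begin

text \<open>The error is summed over a period rather than bounded at each jump: a piece cut out of
  the pseudo-orbit then inherits at most \<open>E\<close>, plus the jump that closes it.
  \<open>p\<close> is some period, possibly not the least.\<close>

definition periodic_pseudo_orbit :: "'a set \<Rightarrow> nat \<Rightarrow> real \<Rightarrow> (nat \<Rightarrow> 'a) \<Rightarrow> bool"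
  where "periodic_pseudo_orbit Z p E z \<longleftrightarrow> p > 0 \<and> (\<forall>n. z n \<in> Z) \<and> (\<forall>n. z (n + p) = z n) \<and>
    (\<Sum>i<p. dist (T (z i)) (z (Suc i))) \<le> E"

lemma T_power_continuous: "continuous_on UNIV (T ^^ n)"
  using lipschitz_on_continuous_on[OF T_lipschitz] by (rule continuous_on_funpow)

context
  fixes Z :: "'a set" and r \<theta> \<rho> :: real
  assumes Z_far: "\<And>z. z \<in> Z \<Longrightarrow> 2 * r \<le> dist z c"
    and r: "r > 0" and \<theta>: "0 < \<theta>" "\<theta> < 1" and \<rho>: "\<rho> > 0"
    and pb: "\<And>y x. \<exists>y'. T y' = x \<and> (r \<le> dist y c \<longrightarrow> dist y y' \<le> \<theta> * dist (T y) x)"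
    and ex: "\<And>y y'. r \<le> dist y c \<Longrightarrow> dist y y' < \<rho> \<Longrightarrow> dist y y' \<le> \<theta> * dist (T y) (T y')"
begin

text \<open>The jump after time \<open>j + i\<close> reaches time \<open>j\<close> through
  \<open>i + 1\<close> inverse branches based at points of \<open>Z\<close>, all far from
  \<open>c\<close>. The shadowing orbit ends exactly in \<open>z N\<close>, so no error starts
  there.\<close>

lemma backward_shadow:
  assumes "\<And>n. z n \<in> Z"
  shows "\<exists>x. \<forall>j\<le>N. dist ((T ^^ j) x) (z j) \<le>
    (\<Sum>i<N - j. \<theta> ^ Suc i * dist (T (z (j + i))) (z (Suc (j + i))))"
  using assms
proof (induction N arbitrary: z)
  case 0
  show ?case by (intro exI[of _ "z 0"]) simp
next
  case (Suc N)
  obtain x1 where x1: "\<And>j. j \<le> N \<Longrightarrow> dist ((T ^^ j) x1) (z (Suc j)) \<le>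
    (\<Sum>i<N - j. \<theta> ^ Suc i * dist (T (z (Suc (j + i)))) (z (Suc (Suc (j + i)))))"
    using Suc.IH[of "\<lambda>n. z (Suc n)"] Suc.prems by auto
  have "r \<le> dist (z 0) c" using Z_far[OF Suc.prems, of 0] r by simp
  then obtain x where x: "T x = x1" "dist (z 0) x \<le> \<theta> * dist (T (z 0)) x1"
    using pb[of x1 "z 0"] by blast
  have "dist ((T ^^ j) x) (z j) \<le>
    (\<Sum>i<Suc N - j. \<theta> ^ Suc i * dist (T (z (j + i))) (z (Suc (j + i))))" if "j \<le> Suc N" for j
  proof (cases j)
    case 0
    have "dist x (z 0) \<le> \<theta> * (dist (T (z 0)) (z 1) + dist x1 (z 1))"
      using x(2) \<theta> by (smt (verit) dist_commute dist_triangle mult_left_mono)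
    also have "\<dots> \<le> \<theta> * (dist (T (z 0)) (z 1) +
        (\<Sum>i<N. \<theta> ^ Suc i * dist (T (z (Suc i))) (z (Suc (Suc i)))))"
      using x1[of 0] \<theta> by (intro mult_left_mono add_left_mono) auto
    also have "\<dots> = (\<Sum>i<Suc N. \<theta> ^ Suc i * dist (T (z i)) (z (Suc i)))"
      by (subst sum.lessThan_Suc_shift) (simp add: distrib_left sum_distrib_left mult_ac)
    finally show ?thesis using 0 by simp
  next
    case (Suc k)
    then show ?thesis using x1[of k] that x(1) by (simp add: funpow_swap1)
  qed
  then show ?case by blast
qed

text \<open>Backward shadows over longer and longer stretches have a limit point \<open>w\<close>
  that shadows for all times. Its image under \<open>T ^^ p\<close> shadows the same pseudo-orbit,
  and two orbits that stay within \<open>\<rho>\<close> of each other in the expanding region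
  coincide.\<close>

lemma shadowing:
  assumes "periodic_pseudo_orbit Z p E z" and small: "2 * (E / (1 - \<theta>)) < \<rho>" "E / (1 - \<theta>) \<le> r"
  obtains w where "(T ^^ p) w = w" "(\<Sum>i<p. dist ((T ^^ i) w) (z i)) \<le> E / (1 - \<theta>)"
    "\<And>i. dist ((T ^^ i) w) (z i) \<le> E / (1 - \<theta>)"
proof -
  have "p > 0" and zZ: "\<And>n. z n \<in> Z" and per: "\<And>n. z (n + p) = z n"
    and E: "(\<Sum>i<p. dist (T (z i)) (z (Suc i))) \<le> E"
    using assms by (auto simp: periodic_pseudo_orbit_def)
  define e where "e i = dist (T (z i)) (z (Suc i))" for i
  have e_nonneg: "0 \<le> e i" for i by (simp add: e_def)
  have e_per: "e (i + p) = e i" for i using per[of i] per[of "Suc i"] by (simp add: e_def)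
  have window: "(\<Sum>i<p. e (m + i)) \<le> E" for m
    using sum_periodic_shift[of e p m, OF e_per] E by (simp add: e_def)
  have e_le: "e m \<le> E" for m
    using window[of m] member_le_sum[of 0 "{..<p}" "\<lambda>i. e (m + i)"] \<open>p > 0\<close> e_nonneg by fastforce
  have "0 \<le> E" using e_le[of 0] e_nonneg[of 0] by simp
  have geom: "(\<Sum>i<n. \<theta> ^ Suc i) \<le> 1 / (1 - \<theta>)" for n
  proof -
    have "(\<Sum>i<n. \<theta> ^ Suc i) \<le> (\<Sum>i<n. \<theta> ^ i)"
      using \<theta> by (intro sum_mono) (simp add: mult_left_le_one_le)
    also have "\<dots> \<le> 1 / (1 - \<theta>)" using \<theta> by (simp add: sum_gp_strict divide_right_mono)
    finally show ?thesis .
  qed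
  have approx: "\<exists>x. (\<forall>j\<le>N. dist ((T ^^ j) x) (z j) \<le> E / (1 - \<theta>)) \<and>
    (\<Sum>j<p. dist ((T ^^ j) x) (z j)) \<le> E / (1 - \<theta>)" if "p \<le> N" for N
  proof -
    obtain x where x: "\<And>j. j \<le> N \<Longrightarrow> dist ((T ^^ j) x) (z j) \<le> (\<Sum>i<N - j. \<theta> ^ Suc i * e (j + i))"
      using backward_shadow[of z N, OF zZ] by (auto simp: e_def)
    have "dist ((T ^^ j) x) (z j) \<le> E / (1 - \<theta>)" if "j \<le> N" for j
    proof -
      have "(\<Sum>i<N - j. \<theta> ^ Suc i * e (j + i)) \<le> (\<Sum>i<N - j. \<theta> ^ Suc i * E)"
        using e_le \<theta> by (intro sum_mono mult_left_mono) auto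
      also have "\<dots> \<le> 1 / (1 - \<theta>) * E"
        unfolding sum_distrib_right[symmetric] using geom \<open>0 \<le> E\<close> by (rule mult_right_mono)
      finally show ?thesis using x[OF that] by simp
    qed
    moreover have "(\<Sum>j<p. dist ((T ^^ j) x) (z j)) \<le> E / (1 - \<theta>)"
    proof -
      have "(\<Sum>j<p. dist ((T ^^ j) x) (z j)) \<le> (\<Sum>j<p. \<Sum>i<N. \<theta> ^ Suc i * e (j + i))"
      proof (rule sum_mono)
        fix j assume "j \<in> {..<p}"
        then have "dist ((T ^^ j) x) (z j) \<le> (\<Sum>i<N - j. \<theta> ^ Suc i * e (j + i))"
          using x \<open>p \<le> N\<close> by simp
        also have "\<dots> \<le> (\<Sum>i<N. \<theta> ^ Suc i * e (j + i))"
          using \<theta> e_nonneg by (intro sum_mono2) auto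
        finally show "dist ((T ^^ j) x) (z j) \<le> (\<Sum>i<N. \<theta> ^ Suc i * e (j + i))" .
      qed
      \<comment> \<open>After the exchange, each power of \<open>\<theta>\<close> meets a full
        window of \<open>p\<close> consecutive jumps, whose total is at most
        \<open>E\<close>.\<close>
      also have "\<dots> = (\<Sum>i<N. \<theta> ^ Suc i * (\<Sum>j<p. e (i + j)))"
        by (subst sum.swap) (simp only: sum_distrib_left add.commute)
      also have "\<dots> \<le> (\<Sum>i<N. \<theta> ^ Suc i * E)"
        using window \<theta> by (intro sum_mono mult_left_mono) auto
      also have "\<dots> \<le> 1 / (1 - \<theta>) * E"
        unfolding sum_distrib_right[symmetric] using geom \<open>0 \<le> E\<close> by (rule mult_right_mono)
      finally show ?thesis by simp
    qed
    ultimately show ?thesis by blast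
  qed
  then obtain x where x: "\<And>N j. p \<le> N \<Longrightarrow> j \<le> N \<Longrightarrow> dist ((T ^^ j) (x N)) (z j) \<le> E / (1 - \<theta>)"
    "\<And>N. p \<le> N \<Longrightarrow> (\<Sum>j<p. dist ((T ^^ j) (x N)) (z j)) \<le> E / (1 - \<theta>)"
    by metis
  obtain w \<sigma> where "strict_mono (\<sigma> :: nat \<Rightarrow> nat)" and lim: "(x \<circ> \<sigma>) \<longlonglongrightarrow> w"
    using compact_imp_seq_compact[OF compact_space] unfolding seq_compact_def by (metis UNIV_I)
  have limT: "(\<lambda>n. (T ^^ j) (x (\<sigma> n))) \<longlonglongrightarrow> (T ^^ j) w" for j
    using continuous_on_tendsto_compose[OF T_power_continuous lim] by (simp add: o_def)
  have \<sigma>_ge: "n \<le> \<sigma> n" for n using \<open>strict_mono \<sigma>\<close> by (rule strict_mono_imp_increasing)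
  have w: "dist ((T ^^ j) w) (z j) \<le> E / (1 - \<theta>)" for j
  proof (rule LIMSEQ_le_const2[OF tendsto_dist[OF limT tendsto_const]])
    show "\<exists>N. \<forall>n\<ge>N. dist ((T ^^ j) (x (\<sigma> n))) (z j) \<le> E / (1 - \<theta>)"
      using \<sigma>_ge by (intro exI[of _ "max p j"] allI impI x) (meson max.boundedE order_trans)+
  qed
  moreover have "(\<Sum>j<p. dist ((T ^^ j) w) (z j)) \<le> E / (1 - \<theta>)"
  proof (rule LIMSEQ_le_const2[OF tendsto_sum[OF tendsto_dist[OF limT tendsto_const]]])
    show "\<exists>N. \<forall>n\<ge>N. (\<Sum>j<p. dist ((T ^^ j) (x (\<sigma> n))) (z j)) \<le> E / (1 - \<theta>)"
      using \<sigma>_ge by (intro exI[of _ p] allI impI x) (meson order_trans)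
  qed
  moreover have "(T ^^ p) w = w"
  proof -
    have close: "dist ((T ^^ j) w) ((T ^^ j) ((T ^^ p) w)) \<le> 2 * (E / (1 - \<theta>))" for j
      using w[of j] w[of "j + p"] per[of j] dist_triangle2[of "(T ^^ j) w" "(T ^^ (j + p)) w" "z j"]
      by (simp add: funpow_add)
    have contr: "dist ((T ^^ j) w) ((T ^^ j) ((T ^^ p) w)) \<le> \<theta> * dist ((T ^^ Suc j) w) ((T ^^ Suc j) ((T ^^ p) w))" for j
    proof -
      \<comment> \<open>The factor 2 in \<open>Z_far\<close> pays for the shadowing error: the orbit
        of \<open>w\<close> itself stays at distance \<open>r\<close> from \<open>c\<close>.\<close>
      have "2 * r \<le> dist (z j) c" by (rule Z_far[OF zZ])
      also have "\<dots> \<le> dist ((T ^^ j) w) (z j) + dist ((T ^^ j) w) c"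
        by (rule dist_triangle3)
      finally have "r \<le> dist ((T ^^ j) w) c" using w[of j] small by simp
      then show ?thesis using ex[of "(T ^^ j) w"] close[of j] small by simp
    qed
    have "dist w ((T ^^ p) w) \<le> \<theta> ^ j * dist ((T ^^ j) w) ((T ^^ j) ((T ^^ p) w))" for j
    proof (induction j)
      case (Suc j)
      then show ?case
        using mult_left_mono[OF contr[of j], of "\<theta> ^ j"] \<theta>
        by (simp add: mult_ac order.trans)
    qed simp
    then have "dist w ((T ^^ p) w) \<le> \<theta> ^ j * (2 * (E / (1 - \<theta>)))" for j
      using mult_left_mono[OF close[of j], of "\<theta> ^ j"] \<theta> by (smt (verit) zero_le_power)
    moreover have "(\<lambda>j. \<theta> ^ j * (2 * (E / (1 - \<theta>)))) \<longlonglongrightarrow> 0"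
      using \<theta> by (intro tendsto_mult_left_zero LIMSEQ_realpow_zero) auto
    ultimately have "dist w ((T ^^ p) w) \<le> 0"
      by (intro LIMSEQ_le_const) auto
    then show ?thesis by simp
  qed
  ultimately show thesis by (intro that)
qed

text \<open>Descent on \<open>p\<close> with the invariant
  \<open>E * real p ^ \<kappa> \<le> e1\<close>: a cut multiplies the error by at most
  \<open>2 ^ \<kappa>\<close>, which halving the period compensates. It ends at the latest with
  \<open>p = 1\<close>, where no two indices are left to compare.\<close>

lemma gap_orbit:
  fixes \<kappa> :: nat
  assumes \<Lambda>: "\<Lambda> \<ge> 0" "1 + 2 * (1 / (1 - \<theta>)) + \<Lambda> \<le> 2 ^ \<kappa>"
    and e1: "2 * (e1 / (1 - \<theta>)) < \<rho>" "e1 / (1 - \<theta>) \<le> r"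
    and "periodic_pseudo_orbit Z p E z" "E * real p ^ \<kappa> \<le> e1"
  shows "\<exists>p' E' z' w. p' > 0 \<and> (T ^^ p') w = w \<and> E' \<le> e1 \<and> (\<forall>n. z' n \<in> Z) \<and>
    (\<Sum>i<p'. dist ((T ^^ i) w) (z' i)) \<le> E' / (1 - \<theta>) \<and>
    (\<forall>i. dist ((T ^^ i) w) (z' i) \<le> E' / (1 - \<theta>)) \<and>
    (\<forall>i<p'. \<forall>j<p'. i \<noteq> j \<longrightarrow> \<Lambda> * E' < dist ((T ^^ i) w) ((T ^^ j) w))"
  using assms(5,6)
proof (induction p arbitrary: E z rule: less_induct)
  case (less p)
  have "p > 0" and zZ: "\<And>n. z n \<in> Z" and per: "\<And>n. z (n + p) = z n"
    and E: "(\<Sum>i<p. dist (T (z i)) (z (Suc i))) \<le> E"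
    using less.prems by (auto simp: periodic_pseudo_orbit_def)
  define K where "K = 1 / (1 - \<theta>)"
  have "0 \<le> E" using E sum_nonneg[of "{..<p}" "\<lambda>i. dist (T (z i)) (z (Suc i))"] by simp
  have "E * 1 \<le> E * real p ^ \<kappa>" using \<open>0 \<le> E\<close> \<open>p > 0\<close> by (intro mult_left_mono one_le_power) auto
  then have "E \<le> e1" using less.prems by simp
  then have "E / (1 - \<theta>) \<le> e1 / (1 - \<theta>)" using \<theta> by (simp add: divide_right_mono)
  then have "2 * (E / (1 - \<theta>)) < \<rho>" "E / (1 - \<theta>) \<le> r" using e1 by linarith+
  then obtain w where w: "(T ^^ p) w = w" "(\<Sum>i<p. dist ((T ^^ i) w) (z i)) \<le> E / (1 - \<theta>)"
    "\<And>i. dist ((T ^^ i) w) (z i) \<le> E / (1 - \<theta>)"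
    using shadowing[OF less.prems(1)] by blast
  have w_per: "(T ^^ (i + p)) w = (T ^^ i) w" for i by (simp add: funpow_add w)
  show ?case
  proof (cases "\<exists>i j. i < p \<and> j < p \<and> i \<noteq> j \<and> dist ((T ^^ i) w) ((T ^^ j) w) \<le> \<Lambda> * E")
    case False
    then show ?thesis
      using \<open>p > 0\<close> w \<open>E \<le> e1\<close> zZ
      by (intro exI[of _ p] exI[of _ E] exI[of _ z] exI[of _ w]) (auto simp: not_le)
  next
    case True
    then obtain i j where ij: "i < j" "j < p" "dist ((T ^^ i) w) ((T ^^ j) w) \<le> \<Lambda> * E"
      by (metis dist_commute linorder_neqE_nat)
    \<comment> \<open>If \<open>j - i\<close> exceeds half the period, the complementary arc from
      \<open>j\<close> to \<open>i + p\<close> is taken.\<close>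
    have "\<exists>i l. 0 < l \<and> 2 * l \<le> p \<and> dist ((T ^^ i) w) ((T ^^ (i + l)) w) \<le> \<Lambda> * E"
    proof (cases "2 * (j - i) \<le> p")
      case True
      then show ?thesis using ij by (intro exI[of _ i] exI[of _ "j - i"]) auto
    next
      case False
      then show ?thesis
        using ij w_per[of i] by (intro exI[of _ j] exI[of _ "i + p - j"]) (auto simp: dist_commute)
    qed
    then obtain i l where l: "0 < l" "2 * l \<le> p" and close: "dist ((T ^^ i) w) ((T ^^ (i + l)) w) \<le> \<Lambda> * E"
      by blast
    define z' where "z' n = z (i + n mod l)" for n
    define e where "e i = dist (T (z i)) (z (Suc i))" for i
    have e_per: "e (i + p) = e i" for i using per[of i] per[of "Suc i"] by (simp add: e_def)
    obtain m where m: "l = Suc m" using l by (cases l) auto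
    have z'_Suc: "z' (Suc n) = z (Suc (i + n))" "z' n = z (i + n)" if "n < m" for n
      using that by (simp_all add: z'_def m)
    have z'_m: "z' m = z (i + m)" "z' (Suc m) = z i" by (simp_all add: z'_def m)
    have "(\<Sum>n<l. dist (T (z' n)) (z' (Suc n))) = (\<Sum>n<m. e (i + n)) + dist (T (z (i + m))) (z i)"
      by (simp add: m z'_Suc e_def z'_m)
    \<comment> \<open>The closing jump goes to \<open>z i\<close> instead of
      \<open>z (i + l)\<close>. These two points are compared through the orbit of \<open>w\<close>,
      which costs the shadowing error twice and \<open>\<Lambda> * E\<close> once.\<close>
    also have "\<dots> \<le> (\<Sum>n<m. e (i + n)) + (e (i + m) + dist (z (i + l)) (z i))"
      using dist_triangle[of "T (z (i + m))" "z i" "z (i + l)"] by (simp add: e_def m)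
    also have "\<dots> = (\<Sum>n<l. e (i + n)) + dist (z (i + l)) (z i)" by (simp add: m)
    also have "(\<Sum>n<l. e (i + n)) \<le> (\<Sum>n<p. e (i + n))"
      using l by (intro sum_mono2) (auto simp: e_def)
    also have "\<dots> \<le> E" using sum_periodic_shift[of e p i, OF e_per] E by (simp add: e_def)
    also have "dist (z (i + l)) (z i) \<le> 2 * (K * E) + \<Lambda> * E"
      using w(3)[of i] w(3)[of "i + l"] close dist_triangle[of "z (i + l)" "z i" "(T ^^ (i + l)) w"]
        dist_triangle[of "(T ^^ (i + l)) w" "z i" "(T ^^ i) w"]
      by (simp add: dist_commute K_def)
    finally have E': "(\<Sum>n<l. dist (T (z' n)) (z' (Suc n))) \<le> (1 + 2 * K + \<Lambda>) * E"
      by (simp add: algebra_simps)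
    then have ppo: "periodic_pseudo_orbit Z l ((1 + 2 * K + \<Lambda>) * E) z'"
      using l zZ by (simp add: periodic_pseudo_orbit_def z'_def)
    have "(1 + 2 * K + \<Lambda>) * E * real l ^ \<kappa> \<le> 2 ^ \<kappa> * E * real l ^ \<kappa>"
      using \<Lambda> \<open>0 \<le> E\<close> by (intro mult_right_mono) (auto simp: K_def)
    also have "\<dots> = E * (2 * real l) ^ \<kappa>" by (simp add: power_mult_distrib)
    also have "\<dots> \<le> E * real p ^ \<kappa>"
      using l \<open>0 \<le> E\<close> by (intro mult_left_mono power_mono) linarith+
    finally have "(1 + 2 * K + \<Lambda>) * E * real l ^ \<kappa> \<le> e1" using less.prems(2) by simp
    moreover have "l < p" using l by simp
    ultimately show ?thesis using less.IH[OF _ ppo] by blast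
  qed
qed

end

section \<open>Pseudo-orbits from repeated words\<close>

lemma finite_partition:
  assumes "\<rho> > 0"
  obtains \<alpha> :: "'a \<Rightarrow> 'a" where "finite (range \<alpha>)" "\<And>x y. \<alpha> x = \<alpha> y \<Longrightarrow> dist x y < \<rho>"
proof -
  obtain k :: "'a set" where k: "finite k" "UNIV \<subseteq> (\<Union>x\<in>k. ball x (\<rho> / 2))"
    using compact_space half_gt_zero[OF assms] unfolding compact_eq_totally_bounded by blast
  then have "\<exists>a\<in>k. x \<in> ball a (\<rho> / 2)" for x by blast
  then obtain \<alpha> where \<alpha>: "\<And>x. \<alpha> x \<in> k" "\<And>x. dist (\<alpha> x) x < \<rho> / 2" by (metis mem_ball)
  have "dist x y < \<rho>" if "\<alpha> x = \<alpha> y" for x y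
    using \<alpha>(2)[of x] \<alpha>(2)[of y] that dist_triangle3[of x y "\<alpha> x"] by simp
  moreover have "finite (range \<alpha>)" using \<alpha>(1) k(1) by (meson finite_subset image_subsetI)
  ultimately show thesis using that by blast
qed

context
  fixes Z :: "'a set" and r \<theta> \<rho> :: real
  assumes Z_far: "\<And>z. z \<in> Z \<Longrightarrow> 2 * r \<le> dist z c"
    and r: "r > 0" and \<theta>: "0 < \<theta>" "\<theta> < 1" and \<rho>: "\<rho> > 0"
    and ex: "\<And>y y'. r \<le> dist y c \<Longrightarrow> dist y y' < \<rho> \<Longrightarrow> dist y y' \<le> \<theta> * dist (T y) (T y')"
begin

text \<open>Each \<open>\<zeta> i\<close> is followed for \<open>n\<close> steps before a jump to
  \<open>\<zeta> (Suc i)\<close>; only the jumps are errors. Equal words keep the two orbits within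
  \<open>\<rho>\<close> at the times 0 to \<open>n - 1\<close>, so \<open>n - 1\<close> expansion
  steps bound a jump.\<close>

lemma closed_walk_pseudo_orbit:
  assumes inv: "\<And>z. z \<in> Z \<Longrightarrow> T z \<in> Z" and \<alpha>: "\<And>x y. \<alpha> x = \<alpha> y \<Longrightarrow> dist x y < \<rho>"
    and "n > 0" "t > 0" and \<zeta>: "\<And>i. \<zeta> i \<in> Z" "\<And>i. \<zeta> (i + t) = \<zeta> i"
    and word: "\<And>i. itinerary \<alpha> T n ((T ^^ n) (\<zeta> i)) = itinerary \<alpha> T n (\<zeta> (Suc i))"
  shows "periodic_pseudo_orbit Z (t * n) (real t * (\<theta> ^ (n - 1) * \<rho>)) (\<lambda>m. (T ^^ (m mod n)) (\<zeta> (m div n)))"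
proof -
  have inv_pow: "(T ^^ m) z \<in> Z" if "z \<in> Z" for m z
    using that by (induction m) (auto intro: inv)
  have jump: "dist ((T ^^ n) (\<zeta> i)) (\<zeta> (Suc i)) \<le> \<theta> ^ (n - 1) * \<rho>" for i
  proof -
    let ?x = "(T ^^ n) (\<zeta> i)" and ?y = "\<zeta> (Suc i)"
    have close: "dist ((T ^^ k) ?x) ((T ^^ k) ?y) < \<rho>" if "k < n" for k
    proof (rule \<alpha>)
      have "itinerary \<alpha> T n ?x ! k = itinerary \<alpha> T n ?y ! k" using word by simp
      then show "\<alpha> ((T ^^ k) ?x) = \<alpha> ((T ^^ k) ?y)" using that by (simp add: itinerary_def)
    qed
    have "dist ?x ?y \<le> \<theta> ^ k * dist ((T ^^ k) ?x) ((T ^^ k) ?y)" if "k < n" for k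
      using that
    proof (induction k)
      case (Suc k)
      have "(T ^^ k) ?x \<in> Z" by (intro inv_pow \<zeta>)
      then have "r \<le> dist ((T ^^ k) ?x) c" using Z_far r by fastforce
      then have step: "dist ((T ^^ k) ?x) ((T ^^ k) ?y) \<le> \<theta> * dist ((T ^^ Suc k) ?x) ((T ^^ Suc k) ?y)"
        using ex close[of k] Suc.prems by simp
      have "dist ?x ?y \<le> \<theta> ^ k * dist ((T ^^ k) ?x) ((T ^^ k) ?y)" using Suc by simp
      also have "\<dots> \<le> \<theta> ^ k * (\<theta> * dist ((T ^^ Suc k) ?x) ((T ^^ Suc k) ?y))"
        using \<theta> step by (intro mult_left_mono) auto
      finally show ?case by (simp add: mult_ac)
    qed simp
    from this[of "n - 1"] have "dist ?x ?y \<le> \<theta> ^ (n - 1) * dist ((T ^^ (n - 1)) ?x) ((T ^^ (n - 1)) ?y)"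
      using \<open>n > 0\<close> by simp
    also have "\<dots> \<le> \<theta> ^ (n - 1) * \<rho>"
      using close[of "n - 1"] \<open>n > 0\<close> \<theta> by (intro mult_left_mono) auto
    finally show ?thesis .
  qed
  define z where "z m = (T ^^ (m mod n)) (\<zeta> (m div n))" for m
  let ?e = "\<lambda>m. dist (T (z m)) (z (Suc m))"
  have block: "(\<Sum>j<n. ?e (j + i * n)) \<le> \<theta> ^ (n - 1) * \<rho>" for i
  proof -
    obtain n' where n': "n = Suc n'" using \<open>n > 0\<close> by (cases n) auto
    have split: "z (j + i * n) = (T ^^ j) (\<zeta> i)" if "j < n" for j
    proof -
      have "(j + i * n) div n = i" using that by simp
      then show ?thesis using that by (simp add: z_def)
    qed
    have inner: "?e (j + i * n) = 0" if "j < n'" for j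
    proof -
      have "Suc j < n" "j < n" using that n' by simp_all
      then have "z (Suc j + i * n) = T (z (j + i * n))" by (simp only: split) simp
      then show ?thesis by simp
    qed
    have "Suc (n' + i * n) = Suc i * n" using n' by simp
    then have "z (Suc (n' + i * n)) = \<zeta> (Suc i)" unfolding z_def using \<open>n > 0\<close> by (simp del: mult_Suc)
    moreover have "T (z (n' + i * n)) = (T ^^ n) (\<zeta> i)" using split[of n'] n' by simp
    ultimately have "?e (n' + i * n) \<le> \<theta> ^ (n - 1) * \<rho>" using jump[of i] by simp
    then show ?thesis using inner by (simp add: n')
  qed
  have "(\<Sum>m<t * n. ?e m) = (\<Sum>i<t. sum ?e {i * n..<i * n + n})"
    by (rule sum.nat_group[symmetric])
  also have "\<dots> = (\<Sum>i<t. \<Sum>j<n. ?e (j + i * n))"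
  proof (rule sum.cong[OF refl])
    fix i
    show "sum ?e {i * n..<i * n + n} = (\<Sum>j<n. ?e (j + i * n))"
      using sum.shift_bounds_nat_ivl[of ?e 0 "i * n" n]
      by (simp only: atLeast0LessThan add_0 add.commute[of n])
  qed
  also have "\<dots> \<le> (\<Sum>i<t. \<theta> ^ (n - 1) * \<rho>)" using block by (intro sum_mono)
  finally have "(\<Sum>m<t * n. ?e m) \<le> real t * (\<theta> ^ (n - 1) * \<rho>)" by simp
  moreover have "\<zeta> (t + i) = \<zeta> i" for i using \<zeta>(2)[of i] by (simp add: add.commute)
  ultimately show ?thesis
    using \<open>t > 0\<close> \<open>n > 0\<close> \<zeta>(1) inv_pow
    by (simp add: periodic_pseudo_orbit_def z_def)
qed

text \<open>Otherwise the graph of \<open>n\<close>-words has no cycle of length up to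
  \<open>s\<close> whenever \<open>s ^ Suc \<kappa> * n ^ \<kappa> * \<theta> ^ (n - 1) *
  \<rho>\<close> is at most \<open>e1\<close>. This admits an \<open>s\<close> exponential in
  \<open>n\<close>, and the resulting loss in the counting would occur at every large
  \<open>n\<close>.\<close>

proposition short_pseudo_orbit:
  assumes "Z \<noteq> {}" and inv: "\<And>z. z \<in> Z \<Longrightarrow> T z \<in> Z" and "e1 > 0"
  shows "\<exists>p E z. periodic_pseudo_orbit Z p E z \<and> E * real p ^ \<kappa> \<le> e1"
proof (rule ccontr)
  assume none: "\<not> ?thesis"
  obtain \<alpha> :: "'a \<Rightarrow> 'a" where \<alpha>: "finite (range \<alpha>)" "\<And>x y. \<alpha> x = \<alpha> y \<Longrightarrow> dist x y < \<rho>"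
    using finite_partition[OF \<rho>] by blast
  define W where "W n = card (itinerary \<alpha> T n ` Z)" for n
  have fin: "finite (itinerary \<alpha> T m ` Z)" for m
    by (rule finite_subset[OF _ finite_lists_length_eq[OF \<alpha>(1), of m]]) (auto simp: itinerary_def)
  have W: "W n \<ge> 1" for n
    unfolding W_def using fin[of n] \<open>Z \<noteq> {}\<close> by (simp add: Suc_le_eq card_gt_0_iff)
  have counting: "W (s * n) \<le> W n choose s"
    if "n > 0" and s: "real s ^ Suc \<kappa> * real n ^ \<kappa> * (\<theta> ^ (n - 1) * \<rho>) \<le> e1" for n s
    unfolding W_def
  proof (rule card_itinerary_le_binomial[OF \<alpha>(1) inv])
    fix t \<zeta>
    assume t: "0 < t" "t \<le> s" and \<zeta>: "\<And>i. \<zeta> i \<in> Z" "\<And>i. \<zeta> (i + t) = \<zeta> i"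
      "\<And>i. itinerary \<alpha> T n ((T ^^ n) (\<zeta> i)) = itinerary \<alpha> T n (\<zeta> (Suc i))"
    have "e1 < (real t * (\<theta> ^ (n - 1) * \<rho>)) * real (t * n) ^ \<kappa>"
      using none closed_walk_pseudo_orbit[OF inv \<alpha>(2) \<open>n > 0\<close> t(1) \<zeta>] by force
    also have "\<dots> = real t ^ Suc \<kappa> * real n ^ \<kappa> * (\<theta> ^ (n - 1) * \<rho>)"
      by (simp add: power_mult_distrib mult_ac)
    also have "\<dots> \<le> real s ^ Suc \<kappa> * real n ^ \<kappa> * (\<theta> ^ (n - 1) * \<rho>)"
      using t \<theta> \<rho> by (intro mult_right_mono power_mono) auto
    finally show False using s by simp
  qed
  \<comment> \<open>Thus \<open>\<theta> ^ n = exp (- 2 * n * a)\<close>. One half of this decay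
    cancels \<open>s ^ Suc \<kappa>\<close> for \<open>s\<close> of order
    \<open>exp (n * \<epsilon>)\<close>, the other half beats \<open>n ^ \<kappa>\<close>.\<close>
  define a where "a = - ln \<theta> / 2"
  have "a > 0" using \<theta> by (simp add: a_def)
  define \<epsilon> where "\<epsilon> = a / real (Suc \<kappa>)"
  have "\<epsilon> > 0" using \<open>a > 0\<close> by (simp add: \<epsilon>_def)
  \<comment> \<open>Collects the constants: the division by \<open>\<theta>\<close> comes from the
    exponent \<open>n - 1\<close>, and \<open>a ^ \<kappa>\<close> turns \<open>n ^ \<kappa>\<close>
    into \<open>(n * a) ^ \<kappa>\<close>.\<close>
  define C where "C = (2 * exp 1) ^ Suc \<kappa> * \<rho> / (\<theta> * a ^ \<kappa>)"
  have "C > 0" using \<theta> \<rho> \<open>a > 0\<close> by (simp add: C_def)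
  have "filterlim (\<lambda>n. real n * a) at_top sequentially"
    using \<open>a > 0\<close> by (intro filterlim_at_top_mult_tendsto_pos[OF tendsto_const] filterlim_real_sequentially)
  then have "(\<lambda>n. (real n * a) ^ \<kappa> / exp (real n * a)) \<longlonglongrightarrow> 0"
    by (rule filterlim_compose[OF tendsto_power_div_exp_0])
  then have "\<forall>\<^sub>F n in sequentially. (real n * a) ^ \<kappa> / exp (real n * a) < e1 / C"
    using \<open>C > 0\<close> \<open>e1 > 0\<close> by (intro order_tendstoD(2)[of _ 0]) auto
  then obtain n0 where n0: "\<And>n. n \<ge> n0 \<Longrightarrow> (real n * a) ^ \<kappa> / exp (real n * a) < e1 / C"
    by (auto simp: eventually_sequentially)
  have "\<exists>s\<ge>1. ln (W (s * n)) + real s * real n * \<epsilon> \<le> real s * ln (W n)" if n: "n \<ge> max 1 n0" for n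
  proof -
    define y where "y = exp 1 * exp (real n * \<epsilon>)"
    have "y \<ge> 1" using \<open>\<epsilon> > 0\<close> by (simp add: y_def flip: exp_add)
    define s where "s = nat \<lceil>y\<rceil>"
    have s: "y \<le> real s" "real s \<le> 2 * y" "s \<ge> 1"
      using \<open>y \<ge> 1\<close> by (auto simp: s_def) linarith+
    have "real s ^ Suc \<kappa> \<le> (2 * y) ^ Suc \<kappa>" using s by (intro power_mono) auto
    also have "\<dots> = (2 * exp 1) ^ Suc \<kappa> * exp (real n * \<epsilon>) ^ Suc \<kappa>"
      by (simp only: y_def power_mult_distrib mult_ac)
    also have "exp (real n * \<epsilon>) ^ Suc \<kappa> = exp (real n * a)"
      by (simp only: exp_of_nat_mult[symmetric]) (simp add: \<epsilon>_def field_simps)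
    finally have s_pow: "real s ^ Suc \<kappa> \<le> (2 * exp 1) ^ Suc \<kappa> * exp (real n * a)" .
    have "\<theta> ^ n = exp (real n * ln \<theta>)" using \<theta> by (simp add: exp_of_nat_mult)
    also have "\<dots> = exp (- (real n * a + real n * a))" by (simp add: a_def)
    also have "\<dots> = 1 / (exp (real n * a) * exp (real n * a))" by (simp only: exp_minus exp_add inverse_eq_divide)
    finally have \<theta>_pow: "\<theta> ^ (n - Suc 0) = 1 / (exp (real n * a) * exp (real n * a)) / \<theta>"
      using n \<theta> by (cases n) (auto simp: field_simps)
    have "real s ^ Suc \<kappa> * real n ^ \<kappa> * (\<theta> ^ (n - 1) * \<rho>) \<le>
      (2 * exp 1) ^ Suc \<kappa> * exp (real n * a) * real n ^ \<kappa> * (\<theta> ^ (n - 1) * \<rho>)"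
      using s_pow \<theta> \<rho> by (intro mult_right_mono) auto
    also have "\<dots> = C * ((real n * a) ^ \<kappa> / exp (real n * a))"
      using \<open>a > 0\<close> \<theta> by (simp add: C_def \<theta>_pow field_simps)
    also have "\<dots> \<le> e1" using n0[of n] n \<open>C > 0\<close> by (simp add: field_simps)
    finally have "W (s * n) \<le> W n choose s" using n by (intro counting) auto
    then show ?thesis
      using drop_of_binomial_bound[of "W (s * n)" "W n" s n \<epsilon>] W s
      by (intro exI[of _ s]) (simp add: y_def)
  qed
  then show False using no_repeated_drop[of W \<epsilon> "max 1 n0"] W \<open>\<epsilon> > 0\<close> by blast
qed

end

section \<open>Gap orbits and perturbations\<close>

text \<open>While an orbit stays within \<open>R\<close> of the periodic one, its distances grow
  geometrically, so the total deviation is dominated by the last distance; the periodic orbit itself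
  has mean zero for the normalized function. Hence such a stretch gains at most \<open>Q\<close>,
  and \<open>small\<close> is exactly the condition that makes
  \<open>Q \<le> \<epsilon> / 2 * R\<close>, the price of the first step outside. After that step
  the count restarts from 0.\<close>

lemma perturbed_sums_bounded:
  fixes p :: nat and w :: 'a
  defines "\<O> \<equiv> (\<lambda>i. (T ^^ i) w) ` {..<p}"
  assumes \<theta>: "0 < \<theta>" "\<theta> < 1"
    and ex: "\<And>y y'. r \<le> dist y c \<Longrightarrow> dist y y' < \<rho> \<Longrightarrow> dist y y' \<le> \<theta> * dist (T y) (T y')"
    and p: "p > 0" "(T ^^ p) w = w" and far: "\<And>i. r \<le> dist ((T ^^ i) w) c"
    and gap: "\<And>i j. i < p \<Longrightarrow> j < p \<Longrightarrow> i \<noteq> j \<Longrightarrow> G \<le> dist ((T ^^ i) w) ((T ^^ j) w)"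
    and G: "0 < G" "G \<le> \<rho>"
    and f: "L-lipschitz_on UNIV f" "\<And>x. f x \<le> 0"
    and f_orbit: "- (\<Sum>i<p. f ((T ^^ i) w)) \<le> \<sigma> * G"
    and \<epsilon>: "0 < \<epsilon>" and small: "\<sigma> * (4 * (L + 2 * \<epsilon>) / (\<epsilon> * (1 - \<theta>)) + 2) \<le> \<epsilon> / (4 * (M + 1))"
    and h: "\<tau>-lipschitz_on UNIV h" "\<And>x. \<bar>h x\<bar> \<le> \<tau>" and \<tau>: "\<tau> \<le> \<epsilon>" "2 * real p * \<tau> \<le> \<sigma> * G"
  shows "\<exists>Q. \<forall>n x. birkhoff T (\<lambda>x. f x - \<epsilon> * infdist x \<O> + h x -
    (\<Sum>i<p. f ((T ^^ i) w) + h ((T ^^ i) w)) / real p) n x \<le> Q"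
proof -
  define a where "a = (\<Sum>i<p. f ((T ^^ i) w) + h ((T ^^ i) w)) / real p"
  define \<psi> where "\<psi> x = f x - \<epsilon> * infdist x \<O> + h x - a" for x
  have "M \<ge> 0" using T_lipschitz by (rule lipschitz_on_nonneg)
  have "L \<ge> 0" using f(1) by (rule lipschitz_on_nonneg)
  have "\<tau> \<ge> 0" using h(1) by (rule lipschitz_on_nonneg)
  have "\<sigma> * G \<ge> 0" using \<tau>(2) \<open>\<tau> \<ge> 0\<close> by (smt (verit) mult_nonneg_nonneg of_nat_0_le_iff)
  then have "\<sigma> \<ge> 0" using G by (simp add: zero_le_mult_iff)
  \<comment> \<open>Covers the slopes of \<open>f\<close> and \<open>h\<close>; moving off the
    orbit, the penalty only lowers the value.\<close>
  define L' where "L' = L + 2 * \<epsilon>"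
  have L': "L' \<ge> 2 * \<epsilon>" "L + \<tau> \<le> L'" using \<open>L \<ge> 0\<close> \<tau> \<epsilon> by (simp_all add: L'_def)
  \<comment> \<open>An upper bound for \<open>\<psi>\<close>: \<open>h\<close> and its mean account
    for \<open>2 * \<tau>\<close>, the mean of \<open>f\<close> over the orbit for the rest.\<close>
  define \<alpha> where "\<alpha> = 2 * \<tau> + \<sigma> * G / p"
  have "\<alpha> \<ge> 0" using \<open>\<tau> \<ge> 0\<close> \<open>\<sigma> * G \<ge> 0\<close> by (simp add: \<alpha>_def)
  have p\<alpha>: "p * \<alpha> \<le> 2 * (\<sigma> * G)" using \<tau>(2) p(1) by (simp add: \<alpha>_def distrib_left mult_ac)
  have "1 * \<alpha> \<le> p * \<alpha>" using p(1) \<open>\<alpha> \<ge> 0\<close> by (intro mult_right_mono) auto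
  then have \<alpha>_le: "\<alpha> \<le> 2 * (\<sigma> * G)" using p\<alpha> by simp
  \<comment> \<open>At this distance half of the penalty equals \<open>\<alpha>\<close>; from there
    on \<open>\<psi>\<close> is nonpositive.\<close>
  define \<rho>1 where "\<rho>1 = 2 * \<alpha> / \<epsilon>"
  \<comment> \<open>Makes \<open>R + M * R\<close> half the gap: if \<open>x\<close> is within
    \<open>R\<close> of \<open>v\<close> and \<open>T x\<close> within \<open>R\<close> of the
    orbit, then the orbit point nearest to \<open>T x\<close> can only be
    \<open>T v\<close>.\<close>
  define R where "R = G / (2 * (M + 1))"
  have "R > 0" using G \<open>M \<ge> 0\<close> by (simp add: R_def)
  define N where "N = M + 1"
  have "N > 0" using \<open>M \<ge> 0\<close> by (simp add: N_def)
  then have "N * R = G / 2" unfolding R_def N_def[symmetric] by simp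
  then have "(M + 1) * R = G / 2" by (simp only: N_def)
  then have R_eq: "R + M * R = G / 2" by (simp add: algebra_simps)
  have "R \<le> G / 2" using R_eq \<open>M \<ge> 0\<close> \<open>R > 0\<close> by (smt (verit) mult_nonneg_nonneg)
  define Q where "Q = p * \<alpha> + L' * (\<rho>1 / (1 - \<theta>))"
  have "\<rho>1 \<ge> 0" using \<open>\<alpha> \<ge> 0\<close> \<epsilon> by (simp add: \<rho>1_def)
  have "Q \<ge> 0" using \<open>\<alpha> \<ge> 0\<close> \<open>\<rho>1 \<ge> 0\<close> \<theta> L' \<epsilon> by (simp add: Q_def)
  have "Q \<le> 2 * (\<sigma> * G) + L' * ((4 * (\<sigma> * G) / \<epsilon>) / (1 - \<theta>))"
    unfolding Q_def \<rho>1_def using p\<alpha> \<alpha>_le L' \<epsilon> \<theta>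
    by (intro add_mono mult_left_mono divide_right_mono) (auto simp: mult_ac)
  also have "\<dots> = \<sigma> * (4 * L' / (\<epsilon> * (1 - \<theta>)) + 2) * G"
    using \<epsilon> \<theta> by (simp add: field_simps)
  also have "\<dots> \<le> \<epsilon> / (4 * (M + 1)) * G"
    using small G by (intro mult_right_mono) (simp_all add: L'_def)
  also have "\<dots> = \<epsilon> / 2 * R" by (simp add: R_def)
  finally have Q_le: "Q \<le> \<epsilon> / 2 * R" .
  have "\<rho>1 \<le> R"
  proof -
    have "\<epsilon> * \<rho>1 \<le> L' * (\<rho>1 / (1 - \<theta>))"
      using L' \<epsilon> \<theta> \<open>\<rho>1 \<ge> 0\<close> by (intro mult_mono) (auto simp: field_simps)
    also have "\<dots> \<le> Q" using \<open>\<alpha> \<ge> 0\<close> by (simp add: Q_def)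
    also have "\<dots> \<le> \<epsilon> * R" using Q_le \<open>Q \<ge> 0\<close> by simp
    finally show ?thesis using \<epsilon> by simp
  qed
  have fin: "finite \<O>" and ne: "\<O> \<noteq> {}" using p by (auto simp: \<O>_def)
  have orbit: "(T ^^ i) w \<in> \<O>" for i
    unfolding \<O>_def using p by (rule funpow_in_image_lessThan)
  have T_orbit: "T v \<in> \<O>" if "v \<in> \<O>" for v
    using that orbit[of "Suc _"] by (auto simp: \<O>_def)
  have T_pow_orbit: "(T ^^ i) v \<in> \<O>" if "v \<in> \<O>" for i v
    using that by (induction i) (auto intro: T_orbit)
  have near: "\<exists>v\<in>\<O>. infdist x \<O> = dist x v" for x
  proof -
    have "infdist x \<O> = Min (dist x ` \<O>)"
      using fin ne by (simp add: infdist_notempty cInf_eq_Min)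
    also have "\<dots> \<in> dist x ` \<O>" using fin ne by (intro Min_in) auto
    finally show ?thesis by auto
  qed
  have on_orbit: "\<psi> v = f v + h v - a" if "v \<in> \<O>" for v
    using that by (simp add: \<psi>_def)
  have track: "dist (T x) (T v) = infdist (T x) \<O>"
    if v: "v \<in> \<O>" and x: "dist x v < R" and Tx: "infdist (T x) \<O> < R" for x v
  proof -
    obtain v' where v': "v' \<in> \<O>" "infdist (T x) \<O> = dist (T x) v'" using near by blast
    have "dist (T x) (T v) \<le> M * R"
      using lipschitz_onD[OF T_lipschitz, of x v] x \<open>M \<ge> 0\<close> by (smt (verit) UNIV_I mult_left_mono)
    then have "dist v' (T v) < G"
      using Tx v' R_eq G dist_triangle3[of v' "T v" "T x"] by simp
    then have "v' = T v"
      using gap T_orbit[OF v] v'(1) unfolding \<O>_def by fastforce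
    then show ?thesis using v' by simp
  qed
  have contr: "dist x v \<le> \<theta> * dist (T x) (T v)" if "v \<in> \<O>" "dist x v < R" for x v
    using ex[of v x] that far G \<open>R \<le> G / 2\<close> by (auto simp: \<O>_def dist_commute)
  have "- a = (- (\<Sum>i<p. f ((T ^^ i) w)) - (\<Sum>i<p. h ((T ^^ i) w))) / p"
    by (simp add: a_def sum.distrib minus_divide_left)
  also have "\<dots> \<le> (\<sigma> * G + p * \<tau>) / p"
  proof (intro divide_right_mono)
    have "- (p * \<tau>) \<le> (\<Sum>i<p. h ((T ^^ i) w))"
      using sum_mono[of "{..<p}" "\<lambda>_. - \<tau>" "\<lambda>i. h ((T ^^ i) w)"] h(2) by (fastforce simp: abs_le_iff minus_le_iff)
    then show "- (\<Sum>i<p. f ((T ^^ i) w)) - (\<Sum>i<p. h ((T ^^ i) w)) \<le> \<sigma> * G + p * \<tau>"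
      using f_orbit by simp
  qed simp
  finally have a_ge: "- a \<le> \<sigma> * G / p + \<tau>" using p(1) by (simp add: add_divide_distrib)
  have \<psi>_le: "\<psi> y \<le> \<alpha> - \<epsilon> * infdist y \<O>" for y
    using f(2)[of y] h(2)[of y] a_ge by (simp add: \<psi>_def \<alpha>_def abs_le_iff)
  have \<psi>_off: "\<psi> y \<le> - (\<epsilon> / 2 * infdist y \<O>)" if "\<rho>1 \<le> infdist y \<O>" for y
  proof -
    have "\<alpha> \<le> \<epsilon> / 2 * infdist y \<O>" using that \<epsilon> by (simp add: \<rho>1_def field_simps)
    then show ?thesis using \<psi>_le[of y] by simp
  qed
  have \<psi>_near: "\<psi> y \<le> \<psi> v + L' * dist y v" if "v \<in> \<O>" for y v
  proof -
    have "f y - f v \<le> L * dist y v" "h y - h v \<le> \<tau> * dist y v"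
      using lipschitz_onD[OF f(1), of y v] lipschitz_onD[OF h(1), of y v] by (simp_all add: dist_real_def)
    moreover have "(L + \<tau>) * dist y v \<le> L' * dist y v" using L' by (intro mult_right_mono) auto
    moreover have "0 \<le> \<epsilon> * infdist y \<O>" using \<epsilon> by (simp add: infdist_nonneg)
    ultimately show ?thesis unfolding \<psi>_def[of y] on_orbit[OF that] by (simp add: distrib_right)
  qed
  have period_sum: "birkhoff T \<psi> p v = 0" "(T ^^ p) v = v" if v: "v \<in> \<O>" for v
  proof -
    obtain j where j: "v = (T ^^ j) w" using v by (auto simp: \<O>_def)
    have per: "(T ^^ (n + p)) w = (T ^^ n) w" for n by (simp add: funpow_add p)
    have "birkhoff T \<psi> p v = (\<Sum>i<p. \<psi> ((T ^^ (j + i)) w))"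
      by (simp add: birkhoff_def j funpow_add flip: add.commute[of _ j])
    also have "\<dots> = (\<Sum>i<p. \<psi> ((T ^^ i) w))"
      using sum_periodic_shift[of "\<lambda>i. \<psi> ((T ^^ i) w)" p j] per by simp
    also have "\<dots> = (\<Sum>i<p. f ((T ^^ i) w) + h ((T ^^ i) w)) - p * a"
      by (simp add: on_orbit orbit sum_subtractf)
    also have "\<dots> = 0" using p(1) by (simp add: a_def)
    finally show "birkhoff T \<psi> p v = 0" .
    show "(T ^^ p) v = v" using per[of j] by (simp only: j add.commute[of j] funpow_add o_apply)
  qed
  \<comment> \<open>Full periods cancel; fewer than \<open>p\<close> terms remain, each at most
    \<open>\<alpha>\<close>.\<close>
  have orbit_sum: "birkhoff T \<psi> m v \<le> p * \<alpha>" if v: "v \<in> \<O>" for m v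
  proof (induction m rule: less_induct)
    case (less m)
    show ?case
    proof (cases "m < p")
      case True
      have "\<psi> ((T ^^ i) v) \<le> \<alpha>" for i using \<psi>_le[of "(T ^^ i) v"] T_pow_orbit[OF v, of i] by simp
      then have "birkhoff T \<psi> m v \<le> m * \<alpha>"
        using sum_mono[of "{..<m}" "\<lambda>i. \<psi> ((T ^^ i) v)" "\<lambda>_. \<alpha>"] by (simp add: birkhoff_def)
      also have "\<dots> \<le> p * \<alpha>" using True \<open>\<alpha> \<ge> 0\<close> by (intro mult_right_mono) auto
      finally show ?thesis .
    next
      case False
      then have "birkhoff T \<psi> m v = birkhoff T \<psi> (m - p) v"
        using birkhoff_add_time[of T \<psi> p "m - p" v] period_sum[OF v] by simp
      then show ?thesis using less[of "m - p"] False p(1) by simp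
    qed
  qed
  have shadow: "birkhoff T \<psi> n x \<le> Q" if R_near: "\<And>i. i < n \<Longrightarrow> infdist ((T ^^ i) x) \<O> < R" for n x
  proof -
    obtain v where v: "v \<in> \<O>" "infdist x \<O> = dist x v" using near by blast
    define \<delta> where "\<delta> i = infdist ((T ^^ i) x) \<O>" for i
    have follow: "dist ((T ^^ i) x) ((T ^^ i) v) = \<delta> i" if "i < n" for i
      using that
    proof (induction i)
      case (Suc i)
      then show ?case
        using track[of "(T ^^ i) v" "(T ^^ i) x"] T_pow_orbit[OF v(1), of i] R_near[of i] R_near[of "Suc i"]
        by (simp add: \<delta>_def)
    qed (simp add: \<delta>_def v)
    have grow: "\<delta> i \<le> \<theta> * \<delta> (Suc i)" if "Suc i < n" for i
      using contr[of "(T ^^ i) v" "(T ^^ i) x"] follow[of i] follow[of "Suc i"] that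
        T_pow_orbit[OF v(1), of i] R_near[of i] by (simp add: \<delta>_def)
    have \<delta>_sum: "(\<Sum>i<Suc m. \<delta> i) \<le> \<delta> m / (1 - \<theta>)" if "m < n" for m
      using that
    proof (induction m)
      case 0
      have "\<delta> 0 * (1 - \<theta>) \<le> \<delta> 0 * 1" using \<theta> by (intro mult_left_mono) (auto simp: \<delta>_def infdist_nonneg)
      then show ?case using \<theta> by (simp add: field_simps)
    next
      case (Suc m)
      have "(\<Sum>i<Suc (Suc m). \<delta> i) \<le> \<theta> * \<delta> (Suc m) / (1 - \<theta>) + \<delta> (Suc m)"
        using Suc grow[of m] \<theta> divide_right_mono[of "\<delta> m" "\<theta> * \<delta> (Suc m)" "1 - \<theta>"] by simp
      also have "\<dots> = \<delta> (Suc m) / (1 - \<theta>)" using \<theta> by (simp add: field_simps)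
      finally show ?case .
    qed
    have "birkhoff T \<psi> m x \<le> Q" if "m \<le> n" for m
      using that
    proof (induction m)
      case (Suc m)
      show ?case
      \<comment> \<open>Trailing times at distance at least \<open>\<rho>1\<close> contribute
        nothing positive and are dropped. The last remaining distance is below
        \<open>\<rho>1\<close>, so the total deviation is at most
        \<open>\<rho>1 / (1 - \<theta>)\<close>.\<close>
      proof (cases "\<rho>1 \<le> \<delta> m")
        case True
        then have "\<psi> ((T ^^ m) x) \<le> - (\<epsilon> / 2 * \<delta> m)" using \<psi>_off by (simp add: \<delta>_def)
        also have "\<dots> \<le> 0" using \<epsilon> by (simp add: \<delta>_def infdist_nonneg)
        finally show ?thesis using Suc by (simp add: birkhoff_Suc)
      next
        case False
        have "birkhoff T \<psi> (Suc m) x \<le> (\<Sum>i<Suc m. \<psi> ((T ^^ i) v) + L' * \<delta> i)"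
          unfolding birkhoff_def
        proof (rule sum_mono)
          fix i assume "i \<in> {..<Suc m}"
          then show "\<psi> ((T ^^ i) x) \<le> \<psi> ((T ^^ i) v) + L' * \<delta> i"
            using \<psi>_near[of "(T ^^ i) v" "(T ^^ i) x"] T_pow_orbit[OF v(1), of i] follow[of i] Suc.prems
            by simp
        qed
        also have "\<dots> = birkhoff T \<psi> (Suc m) v + L' * (\<Sum>i<Suc m. \<delta> i)"
          by (simp only: sum.distrib birkhoff_def sum_distrib_left)
        also have "\<dots> \<le> p * \<alpha> + L' * (\<delta> m / (1 - \<theta>))"
          using Suc.prems L' \<epsilon> by (intro add_mono orbit_sum v mult_left_mono \<delta>_sum) auto
        also have "\<dots> \<le> Q"
          unfolding Q_def using False L' \<epsilon> \<theta>
          by (intro add_left_mono mult_left_mono divide_right_mono) auto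
        finally show ?thesis .
      qed
    qed (simp add: \<open>Q \<ge> 0\<close>)
    then show ?thesis by simp
  qed
  have "birkhoff T \<psi> n x \<le> Q" for n x
  proof (induction n arbitrary: x rule: less_induct)
    case (less n)
    show ?case
    proof (cases "\<forall>i<n. infdist ((T ^^ i) x) \<O> < R")
      case True
      then show ?thesis by (intro shadow) auto
    next
      case False
      define m where "m = (LEAST i. R \<le> infdist ((T ^^ i) x) \<O>)"
      obtain i where i: "i < n" "R \<le> infdist ((T ^^ i) x) \<O>" using False by (auto simp: not_less)
      have "R \<le> infdist ((T ^^ m) x) \<O>" unfolding m_def using i(2) by (rule LeastI)
      moreover have "m \<le> i" unfolding m_def using i(2) by (rule Least_le)
      moreover have "infdist ((T ^^ j) x) \<O> < R" if "j < m" for j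
        using not_less_Least that unfolding m_def by (metis not_le)
      ultimately have m: "m < n" "birkhoff T \<psi> m x \<le> Q" "R \<le> infdist ((T ^^ m) x) \<O>"
        using i by (auto intro: shadow)
      have "\<psi> ((T ^^ m) x) \<le> - (\<epsilon> / 2 * infdist ((T ^^ m) x) \<O>)"
        using m(3) \<open>\<rho>1 \<le> R\<close> by (intro \<psi>_off) simp
      also have "\<dots> \<le> - (\<epsilon> / 2 * R)" using m(3) \<epsilon> by simp
      finally have "birkhoff T \<psi> (Suc m) x \<le> 0" using m(2) Q_le by (simp add: birkhoff_Suc)
      moreover have "birkhoff T \<psi> (n - Suc m) ((T ^^ Suc m) x) \<le> Q" using m(1) by (intro less) simp
      ultimately show ?thesis
        using birkhoff_add_time[of T \<psi> "Suc m" "n - Suc m" x] m(1) by simp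
    qed
  qed
  then show ?thesis unfolding \<psi>_def[abs_def] a_def by (intro exI[of _ Q] allI)
qed

end

section \<open>From Birkhoff sums to invariant measures\<close>

lemma integral_birkhoff:
  fixes g :: "'a::metric_space \<Rightarrow> real"
  assumes \<mu>: "\<mu> \<in> invariant_measures T" and T: "continuous_on UNIV T"
    and g: "continuous_on UNIV g" and B: "\<And>x. \<bar>g x\<bar> \<le> B"
  shows "integrable \<mu> g" "integrable \<mu> (birkhoff T g n)" "integral\<^sup>L \<mu> (birkhoff T g n) = n * integral\<^sup>L \<mu> g"
proof -
  interpret prob_space \<mu> using \<mu> by (simp add: invariant_measures_def)
  have sets: "sets \<mu> = sets borel" and inv: "distr \<mu> borel T = \<mu>"
    using \<mu> by (auto simp: invariant_measures_def)
  have T_meas: "T \<in> \<mu> \<rightarrow>\<^sub>M borel"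
    using borel_measurable_continuous_onI[OF T] measurable_cong_sets[OF sets refl] by blast
  have cont: "continuous_on UNIV (\<lambda>x. g ((T ^^ i) x))" for i
    using continuous_on_compose2[OF g continuous_on_funpow[OF T]] by simp
  have meas: "(\<lambda>x. g ((T ^^ i) x)) \<in> borel_measurable borel" for i
    using cont by (rule borel_measurable_continuous_onI)
  have int: "integrable \<mu> (\<lambda>x. g ((T ^^ i) x))" for i
    using meas[of i] B by (intro integrable_const_bound[of _ B]) (auto simp: measurable_cong_sets[OF sets refl])
  from int[of 0] show "integrable \<mu> g" by simp
  have eq: "(\<integral>x. g ((T ^^ i) x) \<partial>\<mu>) = integral\<^sup>L \<mu> g" for i
  proof (induction i)
    case (Suc i)
    have "integral\<^sup>L \<mu> g = (\<integral>x. g ((T ^^ i) x) \<partial>distr \<mu> borel T)" using Suc inv by simp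
    also have "\<dots> = (\<integral>x. g ((T ^^ i) (T x)) \<partial>\<mu>)" using T_meas meas by (rule integral_distr)
    finally show ?case by (simp add: funpow_swap1)
  qed simp
  show "integrable \<mu> (birkhoff T g n)" unfolding birkhoff_def using int by auto
  show "integral\<^sup>L \<mu> (birkhoff T g n) = n * integral\<^sup>L \<mu> g"
    unfolding birkhoff_def using int eq by (subst Bochner_Integration.integral_sum) auto
qed

lemma integral_nonpos_of_sublinear_growth:
  fixes g :: "'a::metric_space \<Rightarrow> real"
  assumes \<mu>: "\<mu> \<in> invariant_measures T" and T: "continuous_on UNIV T"
    and g: "continuous_on UNIV g" "\<And>x. \<bar>g x\<bar> \<le> B" and growth: "sublinear_growth T g"
  shows "integral\<^sup>L \<mu> g \<le> 0"
proof (rule field_le_epsilon)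
  interpret prob_space \<mu> using \<mu> by (simp add: invariant_measures_def)
  note I = integral_birkhoff[OF \<mu> T g]
  fix \<eta> :: real assume "\<eta> > 0"
  then have "\<eta> / 2 > 0" by simp
  then obtain K where K: "\<And>n x. birkhoff T g n x \<le> \<eta> / 2 * real n + K"
    using growth unfolding sublinear_growth_def by blast
  have "n * integral\<^sup>L \<mu> g \<le> \<eta> / 2 * real n + K" for n
  proof -
    have "integral\<^sup>L \<mu> (birkhoff T g n) \<le> (\<integral>x. \<eta> / 2 * real n + K \<partial>\<mu>)"
      using I(2) K by (intro integral_mono) auto
    then show ?thesis using I(3) by (simp add: prob_space)
  qed
  moreover obtain n :: nat where n: "n > 2 * \<bar>K\<bar> / \<eta>" using reals_Archimedean2 by blast
  ultimately have "n * integral\<^sup>L \<mu> g \<le> \<eta> / 2 * real n + K" by blast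
  also have "\<dots> \<le> real n * \<eta>" using n \<open>\<eta> > 0\<close> by (simp add: field_simps)
  finally have "n * integral\<^sup>L \<mu> g \<le> n * \<eta>" .
  moreover have "0 \<le> 2 * \<bar>K\<bar> / \<eta>" using \<open>\<eta> > 0\<close> by simp
  then have "real n > 0" using n by linarith
  ultimately show "integral\<^sup>L \<mu> g \<le> 0 + \<eta>" by simp
qed

context weakly_expanding
begin

text \<open>The growth bound integrates to an inequality in which the mean distance to the orbit has
  weight \<open>\<gamma>\<close>. A maximizing measure therefore has distance zero almost
  everywhere, and the orbit carries only one invariant probability measure. Injectivity makes the
  mean over \<open>p\<close> times agree with the mean over the set.\<close>

lemma uniquely_maximized_of_growth:
  fixes p :: nat and w :: 'a
  defines "\<O> \<equiv> (\<lambda>i. (T ^^ i) w) ` {..<p}"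
  assumes p: "p > 0" "(T ^^ p) w = w" "inj_on (\<lambda>i. (T ^^ i) w) {..<p}"
    and \<psi>: "L-lipschitz_on UNIV \<psi>" and "\<gamma> > 0"
    and growth: "sublinear_growth T (\<lambda>x. \<psi> x - (\<Sum>i<p. \<psi> ((T ^^ i) w)) / p + \<gamma> * infdist x \<O>)"
  shows "uniquely_maximized T \<psi> \<O>"
proof -
  define a where "a = (\<Sum>i<p. \<psi> ((T ^^ i) w)) / p"
  have T: "continuous_on UNIV T" using T_lipschitz by (rule lipschitz_on_continuous_on)
  have orb: "periodic_orbit T \<O>" unfolding periodic_orbit_def \<O>_def using p by blast
  have fin: "finite \<O>" and ne: "\<O> \<noteq> {}" using periodic_orbit_finite[OF orb] periodic_orbit_nonempty[OF orb] .
  have \<nu>: "orbit_measure \<O> \<in> invariant_measures T" using orbit_measure_unique[OF T orb] by blast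
  obtain B where "B > 0" and B: "\<And>x. \<bar>\<psi> x\<bar> \<le> B"
    using lipschitz_compact_bounded[OF compact_space \<psi>] by blast
  have "1-lipschitz_on UNIV (\<lambda>x. infdist x \<O>)"
    by (rule lipschitz_onI) (simp_all add: dist_real_def infdist_triangle_abs)
  then obtain B' where "B' > 0" and B': "\<And>x. \<bar>infdist x \<O>\<bar> \<le> B'"
    using lipschitz_compact_bounded[OF compact_space] by blast
  have \<psi>_cont: "continuous_on UNIV \<psi>" using \<psi> by (rule lipschitz_on_continuous_on)
  have inf_cont: "continuous_on UNIV (\<lambda>x. infdist x \<O>)" by (intro continuous_intros)
  have \<nu>_int: "integral\<^sup>L (orbit_measure \<O>) \<psi> = a"
  proof -
    have "(\<lambda>x. x) \<in> uniform_count_measure \<O> \<rightarrow>\<^sub>M borel"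
      by (auto simp: measurable_def sets_uniform_count_measure space_uniform_count_measure)
    then have "integral\<^sup>L (orbit_measure \<O>) \<psi> = integral\<^sup>L (uniform_count_measure \<O>) \<psi>"
      unfolding orbit_measure_def using borel_measurable_continuous_onI[OF \<psi>_cont] by (rule integral_distr)
    also have "\<dots> = a"
      using p(3) by (simp add: integral_uniform_count_measure fin)
        (simp add: a_def \<O>_def sum.reindex card_image)
    finally show ?thesis .
  qed
  have le: "integral\<^sup>L \<mu> \<psi> \<le> a" and eq: "integral\<^sup>L \<mu> \<psi> = a \<Longrightarrow> \<mu> = orbit_measure \<O>"
    if \<mu>: "\<mu> \<in> invariant_measures T" for \<mu>
  proof -
    interpret prob_space \<mu> using \<mu> by (simp add: invariant_measures_def)
    have sets: "sets \<mu> = sets borel" using \<mu> by (auto simp: invariant_measures_def)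
    note int = integral_birkhoff(1)[OF \<mu> T \<psi>_cont B] integral_birkhoff(1)[OF \<mu> T inf_cont B']
    have "integral\<^sup>L \<mu> (\<lambda>x. \<psi> x - a + \<gamma> * infdist x \<O>) \<le> 0"
    proof (rule integral_nonpos_of_sublinear_growth[OF \<mu> T])
      show "continuous_on UNIV (\<lambda>x. \<psi> x - a + \<gamma> * infdist x \<O>)"
        using \<psi>_cont by (intro continuous_intros)
      fix x
      have "\<gamma> * infdist x \<O> \<le> \<gamma> * B'" using B'[of x] \<open>\<gamma> > 0\<close> by (intro mult_left_mono) auto
      moreover have "0 \<le> \<gamma> * infdist x \<O>" using \<open>\<gamma> > 0\<close> by (simp add: infdist_nonneg)
      ultimately show "\<bar>\<psi> x - a + \<gamma> * infdist x \<O>\<bar> \<le> B + \<bar>a\<bar> + \<gamma> * B'" using B[of x] by linarith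
    next
      show "sublinear_growth T (\<lambda>x. \<psi> x - a + \<gamma> * infdist x \<O>)" using growth by (simp add: a_def)
    qed
    then have main: "integral\<^sup>L \<mu> \<psi> - a + \<gamma> * (\<integral>x. infdist x \<O> \<partial>\<mu>) \<le> 0"
      using int by (simp add: prob_space)
    have nonneg: "0 \<le> (\<integral>x. infdist x \<O> \<partial>\<mu>)" by (simp add: infdist_nonneg)
    then show "integral\<^sup>L \<mu> \<psi> \<le> a" using main \<open>\<gamma> > 0\<close> by (smt (verit) mult_nonneg_nonneg)
    assume "integral\<^sup>L \<mu> \<psi> = a"
    then have "(\<integral>x. infdist x \<O> \<partial>\<mu>) = 0"
      using main nonneg \<open>\<gamma> > 0\<close> by (simp add: mult_le_0_iff)
    then have "AE x in \<mu>. infdist x \<O> = 0"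
      using integral_nonneg_eq_0_iff_AE[OF int(2)] by (simp add: infdist_nonneg)
    then have "AE x in \<mu>. x \<in> \<O>"
      by eventually_elim (use fin ne in \<open>simp add: in_closed_iff_infdist_zero finite_imp_closed\<close>)
    moreover have "\<O> \<in> sets \<mu>" unfolding sets using fin by (intro borel_closed finite_imp_closed)
    ultimately have "emeasure \<mu> \<O> = 1" by (simp add: emeasure_eq_1_AE)
    then show "\<mu> = orbit_measure \<O>" using orbit_measure_unique[OF T orb] \<mu> by blast
  qed
  have max: "max_ergodic_average T \<psi> = a"
    unfolding max_ergodic_average_def
    using \<nu> \<nu>_int le by (intro cSup_eq_maximum) (force, auto)
  show ?thesis
    unfolding uniquely_maximized_def maximizing_measure_def max
    using \<nu> \<nu>_int eq by blast
qed

section \<open>Gap orbits close to the zero set\<close>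

lemma gap_orbit_near_zero_set:
  assumes f: "L-lipschitz_on UNIV f" "\<And>x. f x \<le> 0" and "f c < 0"
    and Z: "\<exists>z. \<forall>n. f ((T ^^ n) z) = 0"
  shows "\<exists>r \<theta> \<rho>. 0 < \<theta> \<and> \<theta> < 1 \<and>
    (\<forall>y y'. r \<le> dist y c \<longrightarrow> dist y y' < \<rho> \<longrightarrow> dist y y' \<le> \<theta> * dist (T y) (T y')) \<and>
    (\<forall>\<sigma>>0. \<exists>p w G. p > 0 \<and> (T ^^ p) w = w \<and> (\<forall>i. r \<le> dist ((T ^^ i) w) c) \<and>
      0 < G \<and> G \<le> \<rho> \<and> (\<forall>i<p. \<forall>j<p. i \<noteq> j \<longrightarrow> G \<le> dist ((T ^^ i) w) ((T ^^ j) w)) \<and>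
      - (\<Sum>i<p. f ((T ^^ i) w)) \<le> \<sigma> * G)"
proof -
  define Z where "Z = {z. \<forall>n. f ((T ^^ n) z) = 0}"
  have "Z \<noteq> {}" using Z by (auto simp: Z_def)
  have fZ_pow: "f ((T ^^ n) z) = 0" if "z \<in> Z" for z n using that by (simp add: Z_def)
  have Z_inv: "T z \<in> Z" if "z \<in> Z" for z
    unfolding Z_def using fZ_pow[OF that, of "Suc _"] by (simp add: funpow_swap1)
  have fZ: "f z = 0" if "z \<in> Z" for z using fZ_pow[OF that, of 0] by simp
  have "L \<ge> 0" using f(1) by (rule lipschitz_on_nonneg)
  \<comment> \<open>The Lipschitz bound keeps zeros of \<open>f\<close> at distance at least
    \<open>- f c / (L + 1)\<close> from \<open>c\<close>; half of it is reserved for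
    shadowing.\<close>
  define r where "r = - f c / (2 * (L + 1))"
  have "r > 0" using \<open>f c < 0\<close> \<open>L \<ge> 0\<close> by (simp add: r_def divide_neg_pos)
  have Z_far: "2 * r \<le> dist z c" if "z \<in> Z" for z
  proof -
    have "- f c \<le> L * dist z c"
      using lipschitz_onD[OF f(1), of z c] fZ[OF that] by (simp add: dist_real_def)
    also have "\<dots> \<le> (L + 1) * dist z c" by (intro mult_right_mono) auto
    finally show ?thesis using \<open>L \<ge> 0\<close> by (simp add: r_def field_simps)
  qed
  obtain \<theta>1 where \<theta>1: "0 < \<theta>1" "\<theta>1 < 1" "\<And>y x. \<exists>y'. T y' = x \<and> dist y y' \<le> dist (T y) x \<and>
        (r \<le> dist y c \<longrightarrow> dist y y' \<le> \<theta>1 * dist (T y) x)"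
    using pullback[OF \<open>r > 0\<close>] by blast
  obtain \<theta>2 \<rho> where \<theta>2: "0 < \<theta>2" "\<theta>2 < 1" "0 < \<rho>"
    "\<And>y y'. r \<le> dist y c \<Longrightarrow> dist y y' < \<rho> \<Longrightarrow> dist y y' \<le> \<theta>2 * dist (T y) (T y')"
    using expand[OF \<open>r > 0\<close>] by blast
  define \<theta> where "\<theta> = max \<theta>1 \<theta>2"
  have \<theta>: "0 < \<theta>" "\<theta> < 1" using \<theta>1 \<theta>2 by (auto simp: \<theta>_def)
  have \<theta>_ge: "\<theta>1 * d \<le> \<theta> * d" "\<theta>2 * d \<le> \<theta> * d" if "0 \<le> d" for d
    using that by (auto simp: \<theta>_def intro!: mult_right_mono)
  have pb: "\<exists>y'. T y' = x \<and> (r \<le> dist y c \<longrightarrow> dist y y' \<le> \<theta> * dist (T y) x)" for y x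
  proof -
    obtain y' where y': "T y' = x" "r \<le> dist y c \<longrightarrow> dist y y' \<le> \<theta>1 * dist (T y) x"
      using \<theta>1(3)[of x y] by blast
    then show ?thesis
      using \<theta>_ge(1)[OF zero_le_dist, of "T y" x] order_trans by (intro exI[of _ y']) blast
  qed
  have ex: "dist y y' \<le> \<theta> * dist (T y) (T y')" if "r \<le> dist y c" "dist y y' < \<rho>" for y y'
    using \<theta>2(4)[OF that] \<theta>_ge(2)[of "dist (T y) (T y')"] by simp
  \<comment> \<open>\<open>r\<close>, \<open>\<theta>\<close> and \<open>\<rho>\<close> are fixed
    before \<open>\<sigma>\<close>, because the later choice of \<open>\<sigma>\<close> depends on
    \<open>\<theta>\<close>.\<close>
  have "\<exists>p w G. p > 0 \<and> (T ^^ p) w = w \<and> (\<forall>i. r \<le> dist ((T ^^ i) w) c) \<and>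
      0 < G \<and> G \<le> \<rho> \<and> (\<forall>i<p. \<forall>j<p. i \<noteq> j \<longrightarrow> G \<le> dist ((T ^^ i) w) ((T ^^ j) w)) \<and>
      - (\<Sum>i<p. f ((T ^^ i) w)) \<le> \<sigma> * G" if "\<sigma> > 0" for \<sigma>
  proof -
    \<comment> \<open>With this value the bound \<open>L * (E' / (1 - \<theta>))\<close> for the
      orbit sum of \<open>- f\<close> equals \<open>\<sigma> * (\<Lambda> * E')\<close>, and
      \<open>\<Lambda> * E'\<close> lies below all gaps.\<close>
    define \<Lambda> where "\<Lambda> = L / ((1 - \<theta>) * \<sigma>)"
    have "\<Lambda> \<ge> 0" using \<open>L \<ge> 0\<close> \<theta> \<open>\<sigma> > 0\<close> by (simp add: \<Lambda>_def)
    obtain \<kappa> where \<kappa>: "1 + 2 * (1 / (1 - \<theta>)) + \<Lambda> < 2 ^ \<kappa>"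
      using real_arch_pow[of 2] by force
    \<comment> \<open>The admissible shadowing error: below \<open>\<rho> / 2\<close> for
      periodicity of the shadow, at most \<open>r\<close> to stay away from \<open>c\<close>, and
      with \<open>L * \<epsilon> \<le> \<sigma> * \<rho>\<close> for the case that \<open>G\<close>
      is \<open>\<rho>\<close>.\<close>
    define \<epsilon> where "\<epsilon> = min (\<rho> / 4) (min r (\<sigma> * \<rho> / (L + 1)))"
    have "\<epsilon> > 0" using \<theta>2 \<open>r > 0\<close> \<open>\<sigma> > 0\<close> \<open>L \<ge> 0\<close> by (simp add: \<epsilon>_def)
    have "\<epsilon> \<le> \<rho> / 4" unfolding \<epsilon>_def by (rule min.cobounded1)
    moreover have "\<epsilon> \<le> r" unfolding \<epsilon>_def by (intro min.coboundedI2 min.cobounded1)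
    ultimately have \<epsilon>: "2 * \<epsilon> < \<rho>" "\<epsilon> \<le> r" using \<theta>2(3) by simp_all
    have "L * \<epsilon> \<le> (L + 1) * (\<sigma> * \<rho> / (L + 1))"
      using \<open>L \<ge> 0\<close> \<open>\<epsilon> > 0\<close> by (intro mult_mono) (auto simp: \<epsilon>_def)
    then have L\<epsilon>: "L * \<epsilon> \<le> \<sigma> * \<rho>" using \<open>L \<ge> 0\<close> by simp
    define e1 where "e1 = (1 - \<theta>) * \<epsilon>"
    have "e1 > 0" using \<theta> \<open>\<epsilon> > 0\<close> by (simp add: e1_def)
    have e1: "e1 / (1 - \<theta>) = \<epsilon>" using \<theta> by (simp add: e1_def)
    obtain p E z where ppo: "periodic_pseudo_orbit Z p E z" "E * real p ^ \<kappa> \<le> e1"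
      using short_pseudo_orbit[OF Z_far \<open>r > 0\<close> \<theta> \<theta>2(3) ex \<open>Z \<noteq> {}\<close> Z_inv \<open>e1 > 0\<close>] by blast
    obtain p' E' z' w where p': "p' > 0" "(T ^^ p') w = w" "E' \<le> e1" "\<And>n. z' n \<in> Z"
      "(\<Sum>i<p'. dist ((T ^^ i) w) (z' i)) \<le> E' / (1 - \<theta>)"
      "\<And>i. dist ((T ^^ i) w) (z' i) \<le> E' / (1 - \<theta>)"
      "\<And>i j. i < p' \<Longrightarrow> j < p' \<Longrightarrow> i \<noteq> j \<Longrightarrow> \<Lambda> * E' < dist ((T ^^ i) w) ((T ^^ j) w)"
      using gap_orbit[OF Z_far \<open>r > 0\<close> \<theta> \<theta>2(3) pb ex \<open>\<Lambda> \<ge> 0\<close> less_imp_le[OF \<kappa>] _ _ ppo] \<epsilon>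
      unfolding e1 by (metis (no_types, lifting))
    have E'_le: "E' / (1 - \<theta>) \<le> \<epsilon>" using p'(3) \<theta> e1 by (metis diff_gt_0_iff_gt divide_right_mono less_imp_le)
    have "0 \<le> E' / (1 - \<theta>)" using p'(6)[of 0] zero_le_dist order_trans by blast
    then have "E' \<ge> 0" using \<theta> by (simp add: zero_le_divide_iff)
    have far: "r \<le> dist ((T ^^ i) w) c" for i
      using Z_far[OF p'(4), of i] p'(6)[of i] E'_le \<epsilon>(2) dist_triangle3[of "z' i" c "(T ^^ i) w"] by simp
    define D where "D = (\<lambda>(i, j). dist ((T ^^ i) w) ((T ^^ j) w)) ` {(i, j). i < p' \<and> j < p' \<and> i \<noteq> j}"
    have "finite {(i, j). i < p' \<and> j < p' \<and> i \<noteq> j}"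
      by (rule finite_subset[of _ "{..<p'} \<times> {..<p'}"]) auto
    then have "finite D" by (simp add: D_def)
    \<comment> \<open>Inserting \<open>\<rho>\<close> also covers an orbit of period 1, for which
      \<open>D\<close> is empty.\<close>
    define G where "G = Min (insert \<rho> D)"
    have D: "\<Lambda> * E' < d" if "d \<in> D" for d using that p'(7) by (auto simp: D_def)
    have "G \<le> \<rho>" using \<open>finite D\<close> by (simp add: G_def)
    have G_le: "G \<le> dist ((T ^^ i) w) ((T ^^ j) w)" if "i < p'" "j < p'" "i \<noteq> j" for i j
      unfolding G_def using \<open>finite D\<close> that by (intro Min_le) (auto simp: D_def)
    have G_cases: "G = \<rho> \<or> G \<in> D"
      using Min_in[of "insert \<rho> D"] \<open>finite D\<close> by (auto simp: G_def)
    have "0 \<le> \<Lambda> * E'" using \<open>\<Lambda> \<ge> 0\<close> \<open>E' \<ge> 0\<close> by simp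
    then have "G > 0" using G_cases D[of G] \<theta>2(3) by auto
    have "- (\<Sum>i<p'. f ((T ^^ i) w)) \<le> (\<Sum>i<p'. L * dist ((T ^^ i) w) (z' i))"
      unfolding sum_negf[symmetric]
    proof (rule sum_mono)
      fix i
      show "- f ((T ^^ i) w) \<le> L * dist ((T ^^ i) w) (z' i)"
        using lipschitz_onD[OF f(1), of "(T ^^ i) w" "z' i"] fZ[OF p'(4), of i] by (simp add: dist_real_def)
    qed
    also have "\<dots> \<le> L * (E' / (1 - \<theta>))"
      unfolding sum_distrib_left[symmetric] using p'(5) \<open>L \<ge> 0\<close> by (rule mult_left_mono)
    also have "\<dots> \<le> \<sigma> * G"
    proof (cases "G = \<rho>")
      case True
      have "L * (E' / (1 - \<theta>)) \<le> L * \<epsilon>" using E'_le \<open>L \<ge> 0\<close> by (rule mult_left_mono)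
      then show ?thesis using True L\<epsilon> by simp
    next
      case False
      then have "\<Lambda> * E' < G" using G_cases D by blast
      then have "\<sigma> * (\<Lambda> * E') \<le> \<sigma> * G" using \<open>\<sigma> > 0\<close> by simp
      moreover have "\<sigma> * (\<Lambda> * E') = L * (E' / (1 - \<theta>))" using \<open>\<sigma> > 0\<close> by (simp add: \<Lambda>_def)
      ultimately show ?thesis by simp
    qed
    finally show ?thesis
      using p'(1,2) far \<open>G > 0\<close> \<open>G \<le> \<rho>\<close> G_le by blast
  qed
  then have "\<forall>\<sigma>>0. \<exists>p w G. p > 0 \<and> (T ^^ p) w = w \<and> (\<forall>i. r \<le> dist ((T ^^ i) w) c) \<and>
      0 < G \<and> G \<le> \<rho> \<and> (\<forall>i<p. \<forall>j<p. i \<noteq> j \<longrightarrow> G \<le> dist ((T ^^ i) w) ((T ^^ j) w)) \<and>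
      - (\<Sum>i<p. f ((T ^^ i) w)) \<le> \<sigma> * G" by blast
  moreover have "\<forall>y y'. r \<le> dist y c \<longrightarrow> dist y y' < \<rho> \<longrightarrow> dist y y' \<le> \<theta> * dist (T y) (T y')"
    using ex by blast
  ultimately show ?thesis
    using \<theta> by (intro exI[of _ r] exI[of _ \<theta>] exI[of _ \<rho>] conjI)
qed

text \<open>If every orbit met \<open>f < 0\<close>, compactness would give one time
  \<open>N\<close> by which all orbits do, and a uniform loss over \<open>N\<close> steps. That is a
  negative linear rate, which \<open>sharp\<close> excludes.\<close>

lemma zero_set_nonempty:
  assumes f: "continuous_on UNIV f" "\<And>x. f x \<le> 0"
    and sharp: "\<And>b K. (\<And>n x. birkhoff T f n x \<le> b * real n + K) \<Longrightarrow> 0 \<le> b"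
  shows "\<exists>z. \<forall>n. f ((T ^^ n) z) = 0"
proof (rule ccontr)
  assume "\<not> ?thesis"
  then have neg: "\<exists>n. f ((T ^^ n) z) < 0" for z using f(2) by (metis less_eq_real_def)
  define S where "S n = {z. f ((T ^^ n) z) < 0}" for n
  have "open (S n)" for n
    unfolding S_def using continuous_on_compose2[OF f(1) T_power_continuous, of n]
    by (intro open_Collect_less continuous_on_const) auto
  moreover have "UNIV \<subseteq> (\<Union>n\<in>UNIV. S n)" using neg by (auto simp: S_def)
  ultimately obtain I where I: "finite I" "UNIV \<subseteq> (\<Union>n\<in>I. S n)"
    using compactE_image[OF compact_space, of UNIV S] by (metis UNIV_I)
  define N where "N = Suc (Max (insert 0 I))"
  have "N > 0" by (simp add: N_def)
  have less_N: "n < N" if "n \<in> I" for n using that I(1) by (simp add: N_def less_Suc_eq_le)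
  have S_neg: "birkhoff T f N z < 0" for z
  proof -
    obtain n where n: "n \<in> I" "f ((T ^^ n) z) < 0" using I(2) by (auto simp: S_def)
    have "birkhoff T f N z = f ((T ^^ n) z) + (\<Sum>i\<in>{..<N} - {n}. f ((T ^^ i) z))"
      unfolding birkhoff_def using less_N[OF n(1)] by (intro sum.remove) auto
    moreover have "(\<Sum>i\<in>{..<N} - {n}. f ((T ^^ i) z)) \<le> 0" using f(2) by (intro sum_nonpos)
    ultimately show ?thesis using n by simp
  qed
  have "continuous_on UNIV (birkhoff T f N)"
    unfolding birkhoff_def using continuous_on_compose2[OF f(1) T_power_continuous] by (intro continuous_intros) auto
  then obtain m where m: "\<And>z. birkhoff T f N z \<le> birkhoff T f N m"
    using continuous_attains_sup[OF compact_space] by (metis UNIV_I UNIV_not_empty)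
  define \<eta> where "\<eta> = - birkhoff T f N m"
  have "\<eta> > 0" using S_neg by (simp add: \<eta>_def)
  \<comment> \<open>The additive \<open>\<eta>\<close> compensates for the incomplete last block,
    where only \<open>birkhoff T f n x \<le> 0\<close> is known.\<close>
  have "birkhoff T f n x \<le> - (\<eta> / N) * real n + \<eta>" for n x
  proof (induction n arbitrary: x rule: less_induct)
    case (less n)
    show ?case
    proof (cases "n < N")
      case True
      have "birkhoff T f n x \<le> 0" unfolding birkhoff_def using f(2) by (intro sum_nonpos) auto
      moreover have "\<eta> / N * real n \<le> \<eta> / N * real N" using True \<open>\<eta> > 0\<close> by (intro mult_left_mono) auto
      ultimately show ?thesis using \<open>N > 0\<close> by simp
    next
      case False
      have "birkhoff T f n x = birkhoff T f N x + birkhoff T f (n - N) ((T ^^ N) x)"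
        using birkhoff_add_time[of T f N "n - N" x] False by simp
      also have "\<dots> \<le> - \<eta> + (- (\<eta> / N) * real (n - N) + \<eta>)"
        using m[of x] less[of "n - N" "(T ^^ N) x"] False \<open>N > 0\<close> by (intro add_mono) (auto simp: \<eta>_def)
      also have "\<dots> = - (\<eta> / N) * real n + \<eta>"
        using False \<open>N > 0\<close> by (simp add: of_nat_diff field_simps)
      finally show ?thesis .
    qed
  qed
  then have "0 \<le> - (\<eta> / N)" by (rule sharp)
  moreover have "\<eta> / N > 0" using \<open>\<eta> > 0\<close> \<open>N > 0\<close> by (intro divide_pos_pos) auto
  ultimately show False by linarith
qed

text \<open>The bound \<open>\<tau>\<close> serves all small \<open>h\<close> with the same orbit,
  so this gives density and local constancy together.\<close>

lemma locally_constant_perturbation: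
  assumes \<phi>: "A-lipschitz_on UNIV \<phi>" and "\<epsilon> > 0"
  obtains p w \<tau> where "\<tau> > 0" "periodic_orbit T ((\<lambda>i. (T ^^ i) w) ` {..<p})"
    "\<And>h :: 'a \<Rightarrow> real. \<tau>-lipschitz_on UNIV h \<Longrightarrow> (\<And>x. \<bar>h x\<bar> \<le> \<tau>) \<Longrightarrow>
      uniquely_maximized T (\<lambda>x. \<phi> x - \<epsilon> * infdist x ((\<lambda>i. (T ^^ i) w) ` {..<p}) + h x)
        ((\<lambda>i. (T ^^ i) w) ` {..<p})"
proof -
  define bounds where "bounds = {b. \<exists>K. \<forall>n x. birkhoff T \<phi> n x \<le> b * real n + K}"
  define \<beta> where "\<beta> = Inf bounds"
  have c_fix: "(T ^^ n) c = c" for n by (induction n) (simp_all add: T_fixed)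
  have c_le: "\<phi> c \<le> b" if b: "b \<in> bounds" for b
  proof (rule field_le_epsilon)
    fix e :: real assume "e > 0"
    obtain K where K: "\<And>n x. birkhoff T \<phi> n x \<le> b * real n + K" using b by (auto simp: bounds_def)
    obtain n :: nat where n: "n > \<bar>K\<bar> / e" using reals_Archimedean2 by blast
    moreover have "0 \<le> \<bar>K\<bar> / e" using \<open>e > 0\<close> by simp
    ultimately have "real n > 0" by linarith
    have "real n * \<phi> c \<le> b * real n + K"
      using K[of n c] by (simp add: birkhoff_def c_fix)
    also have "\<dots> \<le> real n * (b + e)" using n \<open>e > 0\<close> by (simp add: field_simps)
    finally show "\<phi> c \<le> b + e" using \<open>real n > 0\<close> by simp
  qed
  obtain B where "B > 0" and B: "\<And>x. \<bar>\<phi> x\<bar> \<le> B"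
    using lipschitz_compact_bounded[OF compact_space \<phi>] by blast
  have "B \<in> bounds"
    unfolding bounds_def
    using birkhoff_mono[of \<phi> "\<lambda>_. B" T] B by (auto simp: abs_le_iff mult.commute intro!: exI[of _ 0])
  have bdd: "bdd_below bounds" using c_le by (rule bdd_belowI)
  have "\<phi> c \<le> \<beta>" unfolding \<beta>_def using \<open>B \<in> bounds\<close> c_le by (intro cInf_greatest) auto
  have growth: "sublinear_growth T (\<lambda>x. \<phi> x - \<beta>)"
    unfolding sublinear_growth_def
  proof (intro allI impI)
    fix \<eta> :: real assume "\<eta> > 0"
    then obtain b where b: "b \<in> bounds" "b < \<beta> + \<eta>"
      using cInf_lessD[of bounds "\<beta> + \<eta>"] \<open>B \<in> bounds\<close> by (auto simp: \<beta>_def)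
    then obtain K where K: "\<And>n x. birkhoff T \<phi> n x \<le> b * real n + K" by (auto simp: bounds_def)
    have "birkhoff T (\<lambda>x. \<phi> x - \<beta>) n x \<le> \<eta> * real n + K" for n x
    proof -
      have "b * real n \<le> (\<beta> + \<eta>) * real n" using b(2) by (intro mult_right_mono) auto
      then show ?thesis using K[of n x] by (simp add: birkhoff_diff algebra_simps)
    qed
    then show "\<exists>K. \<forall>n x. birkhoff T (\<lambda>x. \<phi> x - \<beta>) n x \<le> \<eta> * real n + K" by blast
  qed
  have inf_lip: "1-lipschitz_on UNIV (\<lambda>x. infdist x S)" for S :: "'a set"
    by (rule lipschitz_onI) (simp_all add: dist_real_def infdist_triangle_abs)
  have \<psi>_lip: "\<exists>L. L-lipschitz_on UNIV (\<lambda>x. \<phi> x - \<epsilon> * infdist x S + h x)"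
    if "\<tau>-lipschitz_on UNIV h" for S :: "'a set" and h :: "'a \<Rightarrow> real" and \<tau>
    using lipschitz_on_add[OF lipschitz_on_diff[OF \<phi> lipschitz_on_cmult_real[OF inf_lip[of S]]] that] by blast
  show thesis
  proof (cases "\<phi> c = \<beta>")
    case True
    let ?\<O> = "(\<lambda>i. (T ^^ i) c) ` {..<Suc 0}"
    have \<O>: "?\<O> = {c}" by (auto simp: c_fix)
    show thesis
    proof (rule that[of "\<epsilon> / 2" c "Suc 0"])
      show "periodic_orbit T ?\<O>"
        unfolding periodic_orbit_def using T_fixed by (intro exI[of _ c] exI[of _ "Suc 0"]) simp
      fix h :: "'a \<Rightarrow> real" assume h: "(\<epsilon> / 2)-lipschitz_on UNIV h" "\<And>x. \<bar>h x\<bar> \<le> \<epsilon> / 2"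
      let ?\<psi> = "\<lambda>x. \<phi> x - \<epsilon> * infdist x ?\<O> + h x"
      obtain L where L: "L-lipschitz_on UNIV ?\<psi>" using \<psi>_lip[OF h(1)] by blast
      show "uniquely_maximized T ?\<psi> ?\<O>"
      proof (rule uniquely_maximized_of_growth[OF _ _ _ L, where \<gamma> = "\<epsilon> / 2"])
        \<comment> \<open>Half of the penalty absorbs the variation of \<open>h\<close> around
          \<open>c\<close>, the other half cancels the added distance term; what is left is at most
          \<open>\<phi> - \<beta>\<close>.\<close>
        have "?\<psi> x - (\<Sum>i<Suc 0. ?\<psi> ((T ^^ i) c)) / real (Suc 0) + \<epsilon> / 2 * infdist x ?\<O> \<le> \<phi> x - \<beta>" for x
        proof -
          have "\<bar>h x - h c\<bar> \<le> \<epsilon> / 2 * dist x c"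
            using lipschitz_onD[OF h(1), of x c] by (simp add: dist_real_def)
          then have "h x - h c \<le> \<epsilon> / 2 * dist x c" by (rule abs_le_D1)
          then show ?thesis using True unfolding \<O> by simp
        qed
        then have "birkhoff T (\<lambda>x. ?\<psi> x - (\<Sum>i<Suc 0. ?\<psi> ((T ^^ i) c)) / real (Suc 0) + \<epsilon> / 2 * infdist x ?\<O>) n y
          \<le> birkhoff T (\<lambda>x. \<phi> x - \<beta>) n y" for n y
          by (rule birkhoff_mono)
        then show "sublinear_growth T (\<lambda>x. ?\<psi> x - (\<Sum>i<Suc 0. ?\<psi> ((T ^^ i) c)) / real (Suc 0) + \<epsilon> / 2 * infdist x ?\<O>)"
          using growth unfolding sublinear_growth_def by (meson order_trans)
      qed (use \<open>\<epsilon> > 0\<close> T_fixed in \<open>auto simp: inj_on_def\<close>)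
    qed (use \<open>\<epsilon> > 0\<close> in simp)
  next
    case False
    then have neg: "\<phi> c - \<beta> < 0" using \<open>\<phi> c \<le> \<beta>\<close> by simp
    have "A-lipschitz_on UNIV (\<lambda>x. \<phi> x - \<beta>)"
      using lipschitz_on_diff[OF \<phi> lipschitz_on_constant] by simp
    then obtain u A' where u: "A'-lipschitz_on UNIV u" "\<And>y. \<phi> y - \<beta> + u y \<le> u (T y)"
      using subaction[of A "\<lambda>x. \<phi> x - \<beta>"] neg growth by blast
    obtain B' where "B' > 0" and B': "\<And>x. \<bar>u x\<bar> \<le> B'"
      using lipschitz_compact_bounded[OF compact_space u(1)] by blast
    define f where "f x = \<phi> x - \<beta> + (u x - u (T x))" for x
    have f_le: "f x \<le> 0" for x using u(2)[of x] by (simp add: f_def)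
    have "(A' * M)-lipschitz_on UNIV (\<lambda>x. u (T x))"
      using lipschitz_on_compose2[OF T_lipschitz, of A' u] u(1) by (simp add: lipschitz_on_subset)
    then obtain L where L: "L-lipschitz_on UNIV f"
      unfolding f_def
      using lipschitz_on_add[OF lipschitz_on_diff[OF \<phi> lipschitz_on_constant] lipschitz_on_diff[OF u(1)]] by blast
    have "L \<ge> 0" using L by (rule lipschitz_on_nonneg)
    have "f c < 0" using neg by (simp add: f_def T_fixed)
    have birk_f: "birkhoff T f n x = birkhoff T \<phi> n x - n * \<beta> + (u x - u ((T ^^ n) x))" for n x
      unfolding f_def birkhoff_add birkhoff_coboundary by (simp add: birkhoff_diff)
    have zero: "\<exists>z. \<forall>n. f ((T ^^ n) z) = 0"
    proof (rule zero_set_nonempty[OF lipschitz_on_continuous_on[OF L] f_le])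
      fix b K assume bK: "\<And>n x. birkhoff T f n x \<le> b * real n + K"
      have "birkhoff T \<phi> n x \<le> (b + \<beta>) * real n + (K + 2 * B')" for n x
        using bK[of n x] B'[of x] B'[of "(T ^^ n) x"] by (simp add: birk_f abs_le_iff algebra_simps)
      then have "b + \<beta> \<in> bounds" unfolding bounds_def by blast
      then have "\<beta> \<le> b + \<beta>" unfolding \<beta>_def using bdd by (rule cInf_lower)
      then show "0 \<le> b" by simp
    qed
    obtain r \<theta> \<rho> where \<theta>: "0 < \<theta>" "\<theta> < 1"
      and ex: "\<forall>y y'. r \<le> dist y c \<longrightarrow> dist y y' < \<rho> \<longrightarrow> dist y y' \<le> \<theta> * dist (T y) (T y')"
      and orbits: "\<forall>\<sigma>>0. \<exists>p w G. p > 0 \<and> (T ^^ p) w = w \<and> (\<forall>i. r \<le> dist ((T ^^ i) w) c) \<and>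
        0 < G \<and> G \<le> \<rho> \<and> (\<forall>i<p. \<forall>j<p. i \<noteq> j \<longrightarrow> G \<le> dist ((T ^^ i) w) ((T ^^ j) w)) \<and>
        - (\<Sum>i<p. f ((T ^^ i) w)) \<le> \<sigma> * G"
      using gap_orbit_near_zero_set[OF L f_le \<open>f c < 0\<close> zero] by (elim exE conjE) (rule that)
    \<comment> \<open>One half of the penalty keeps the sums bounded, the other is the margin
      \<open>\<gamma>\<close> that yields uniqueness.\<close>
    define \<epsilon>' where "\<epsilon>' = \<epsilon> / 2"
    have "\<epsilon>' > 0" using \<open>\<epsilon> > 0\<close> by (simp add: \<epsilon>'_def)
    have "M \<ge> 0" using T_lipschitz by (rule lipschitz_on_nonneg)
    \<comment> \<open>The bracket in the smallness condition of
      \<open>perturbed_sums_bounded\<close>, which \<open>\<sigma>\<close> turns into an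
      equality.\<close>
    define C where "C = 4 * (L + 2 * \<epsilon>') / (\<epsilon>' * (1 - \<theta>)) + 2"
    have "C > 0" using \<open>L \<ge> 0\<close> \<open>\<epsilon>' > 0\<close> \<theta> by (simp add: C_def add_nonneg_pos)
    define \<sigma> where "\<sigma> = \<epsilon>' / (4 * (M + 1)) / C"
    have "\<sigma> > 0" using \<open>\<epsilon>' > 0\<close> \<open>M \<ge> 0\<close> \<open>C > 0\<close> by (simp add: \<sigma>_def)
    have small: "\<sigma> * (4 * (L + 2 * \<epsilon>') / (\<epsilon>' * (1 - \<theta>)) + 2) \<le> \<epsilon>' / (4 * (M + 1))"
      unfolding C_def[symmetric] \<sigma>_def using \<open>C > 0\<close> by simp
    obtain p w G where p: "p > 0" "(T ^^ p) w = w" and far: "\<forall>i. r \<le> dist ((T ^^ i) w) c"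
      and G: "0 < G" "G \<le> \<rho>" and gap: "\<forall>i<p. \<forall>j<p. i \<noteq> j \<longrightarrow> G \<le> dist ((T ^^ i) w) ((T ^^ j) w)"
      and f_orbit: "- (\<Sum>i<p. f ((T ^^ i) w)) \<le> \<sigma> * G"
      using orbits[rule_format, OF \<open>\<sigma> > 0\<close>] by (elim exE conjE) (rule that)
    have ex': "dist y y' \<le> \<theta> * dist (T y) (T y')" if "r \<le> dist y c" "dist y y' < \<rho>" for y y'
      using ex that by blast
    have gap': "G \<le> dist ((T ^^ i) w) ((T ^^ j) w)" if "i < p" "j < p" "i \<noteq> j" for i j
      using gap that by blast
    let ?\<O> = "(\<lambda>i. (T ^^ i) w) ` {..<p}"
    define \<tau> where "\<tau> = min \<epsilon>' (\<sigma> * G / (2 * p))"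
    have \<tau>: "\<tau> > 0" "\<tau> \<le> \<epsilon>'" using \<open>\<epsilon>' > 0\<close> \<open>\<sigma> > 0\<close> G p by (auto simp: \<tau>_def)
    have "2 * real p * \<tau> \<le> 2 * real p * (\<sigma> * G / (2 * p))" by (intro mult_left_mono) (auto simp: \<tau>_def)
    then have \<tau>': "2 * real p * \<tau> \<le> \<sigma> * G" using p(1) by simp
    show thesis
    proof (rule that[OF \<tau>(1), of w p])
      show "periodic_orbit T ?\<O>" unfolding periodic_orbit_def using p by blast
      fix h :: "'a \<Rightarrow> real" assume h: "\<tau>-lipschitz_on UNIV h" "\<And>x. \<bar>h x\<bar> \<le> \<tau>"
      let ?\<psi> = "\<lambda>x. \<phi> x - \<epsilon> * infdist x ?\<O> + h x"
      obtain A'' where A'': "A''-lipschitz_on UNIV ?\<psi>" using \<psi>_lip[OF h(1)] by blast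
      let ?a = "(\<Sum>i<p. f ((T ^^ i) w) + h ((T ^^ i) w)) / real p"
      let ?g = "\<lambda>x. f x - \<epsilon>' * infdist x ?\<O> + h x - ?a"
      have "\<exists>Q. \<forall>n x. birkhoff T ?g n x \<le> Q"
        by (rule perturbed_sums_bounded[OF \<theta> _ p spec[OF far] _ G L f_le f_orbit
            \<open>\<epsilon>' > 0\<close> small h \<tau>(2) \<tau>']) (use ex' gap' in blast)+
      then obtain Q where Q: "\<forall>n x. birkhoff T ?g n x \<le> Q" ..
      show "uniquely_maximized T ?\<psi> ?\<O>"
      proof (rule uniquely_maximized_of_growth[OF p _ A'' \<open>\<epsilon>' > 0\<close>])
        show "inj_on (\<lambda>i. (T ^^ i) w) {..<p}"
        proof (rule inj_onI, rule ccontr)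
          fix i j assume "i \<in> {..<p}" "j \<in> {..<p}" "(T ^^ i) w = (T ^^ j) w" "i \<noteq> j"
          then show False using gap'[of i j] G by simp
        qed
        \<comment> \<open>Over a full period the coboundary in \<open>f\<close> telescopes to zero,
          and the penalty vanishes on the orbit.\<close>
        have "(\<Sum>i<p. ?\<psi> ((T ^^ i) w)) = (\<Sum>i<p. f ((T ^^ i) w) + h ((T ^^ i) w)) + p * \<beta>"
          using birk_f[of p w] p(2)
          by (simp add: funpow_in_image_lessThan[OF p] sum.distrib birkhoff_def)
        then have avg: "(\<Sum>i<p. ?\<psi> ((T ^^ i) w)) / real p = ?a + \<beta>"
          using p(1) by (simp add: add_divide_distrib)
        have split: "?\<psi> x - (\<Sum>i<p. ?\<psi> ((T ^^ i) w)) / real p + \<epsilon>' * infdist x ?\<O> =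
          (f x - \<epsilon>' * infdist x ?\<O> + h x - ?a) - (u x - u (T x))" for x
          unfolding avg by (simp add: f_def \<epsilon>'_def field_simps)
        have "birkhoff T (\<lambda>x. ?\<psi> x - (\<Sum>i<p. ?\<psi> ((T ^^ i) w)) / real p + \<epsilon>' * infdist x ?\<O>) n x \<le>
          Q + 2 * B'" for n x
          unfolding split birkhoff_diff[of T _ "\<lambda>x. u x - u (T x)"] birkhoff_coboundary
          using Q[rule_format, of n x] B'[of x] B'[of "(T ^^ n) x"] by (simp add: abs_le_iff)
        then have bound: "birkhoff T (\<lambda>x. ?\<psi> x - (\<Sum>i<p. ?\<psi> ((T ^^ i) w)) / real p + \<epsilon>' * infdist x ?\<O>) n x \<le>
          \<eta> * real n + (Q + 2 * B')" if "\<eta> > 0" for n x \<eta>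
          using that by (smt (verit) mult_nonneg_nonneg of_nat_0_le_iff)
        show "sublinear_growth T (\<lambda>x. ?\<psi> x - (\<Sum>i<p. ?\<psi> ((T ^^ i) w)) / real p + \<epsilon>' * infdist x ?\<O>)"
          unfolding sublinear_growth_def using bound by blast
      qed
    qed
  qed
qed

section \<open>Openness and density\<close>

theorem lipschitz_TPO: "lipschitz_TPO T"
proof -
  \<comment> \<open>The largest candidate, open by its form, so that only density has
    content.\<close>
  define \<G> :: "'a lip set" where "\<G> = {\<phi>. \<exists>\<V> \<O>. open \<V> \<and> \<phi> \<in> \<V> \<and> periodic_orbit T \<O> \<and>
    (\<forall>\<psi>\<in>\<V>. uniquely_maximized T (apply_lip \<psi>) \<O>)}"
  have "open \<G>"
    unfolding open_subopen[of \<G>]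
  proof (rule ballI)
    fix \<phi> assume "\<phi> \<in> \<G>"
    then obtain \<V> \<O> where V: "open \<V>" "\<phi> \<in> \<V>" "periodic_orbit T \<O>"
      "\<forall>\<psi>\<in>\<V>. uniquely_maximized T (apply_lip \<psi>) \<O>" by (auto simp: \<G>_def)
    then have "\<V> \<subseteq> \<G>" unfolding \<G>_def by blast
    with V show "\<exists>S. open S \<and> \<phi> \<in> S \<and> S \<subseteq> \<G>" by blast
  qed
  define R where "R = diameter (UNIV :: 'a set)"
  have R: "dist x y \<le> R" for x y :: 'a
    unfolding R_def using compact_imp_bounded[OF compact_space] by (rule diameter_bounded_bound) simp_all
  have "R \<ge> 0" using R[of c c] by simp
  have "\<phi> \<in> closure \<G>" for \<phi>
    unfolding closure_approachable
  proof (intro allI impI)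
    fix e :: real assume "e > 0"
    \<comment> \<open>The distance to an orbit has sup norm at most \<open>R\<close> and Lipschitz
      constant at most 1, so the penalty moves \<open>\<phi>\<close> by at most
      \<open>e / 2\<close>.\<close>
    define \<epsilon> where "\<epsilon> = e / (2 * (R + 1))"
    have "\<epsilon> > 0" using \<open>e > 0\<close> \<open>R \<ge> 0\<close> by (simp add: \<epsilon>_def)
    obtain A where A: "A-lipschitz_on UNIV (apply_lip \<phi>)" using apply_lip[of \<phi>] by blast
    show "\<exists>y\<in>\<G>. dist y \<phi> < e"
    proof (rule locally_constant_perturbation[OF A \<open>\<epsilon> > 0\<close>])
      fix p w \<tau>
      assume "\<tau> > 0" and orb: "periodic_orbit T ((\<lambda>i. (T ^^ i) w) ` {..<p})"
        and max: "\<And>h. \<tau>-lipschitz_on UNIV h \<Longrightarrow> (\<And>x. \<bar>h x\<bar> \<le> \<tau>) \<Longrightarrow>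
          uniquely_maximized T (\<lambda>x. apply_lip \<phi> x - \<epsilon> * infdist x ((\<lambda>i. (T ^^ i) w) ` {..<p}) + h x)
          ((\<lambda>i. (T ^^ i) w) ` {..<p})"
      define \<O> where "\<O> = (\<lambda>i. (T ^^ i) w) ` {..<p}"
      have "\<O> \<noteq> {}" using periodic_orbit_nonempty[OF orb] by (simp add: \<O>_def)
      have inf_le: "\<bar>infdist x \<O>\<bar> \<le> R" for x
      proof -
        obtain y where "y \<in> \<O>" using \<open>\<O> \<noteq> {}\<close> by blast
        then show ?thesis using infdist_le[of y \<O> x] R[of x y] by (simp add: infdist_nonneg)
      qed
      have inf_lip: "1-lipschitz_on UNIV (\<lambda>x. infdist x \<O>)"
        by (rule lipschitz_onI) (simp_all add: dist_real_def infdist_triangle_abs)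
      define D where "D = Lip (\<lambda>x. infdist x \<O>)"
      have D: "apply_lip D = (\<lambda>x. infdist x \<O>)"
        unfolding D_def using inf_le inf_lip by (intro Lip_inverse) (auto simp: bounded_iff)
      have "norm D \<le> R + 1"
        unfolding norm_lip.rep_eq D using inf_le inf_lip by (intro add_mono sup_norm_le lip_const_le)
      define \<phi>' where "\<phi>' = \<phi> - \<epsilon> *\<^sub>R D"
      have "dist \<phi>' \<phi> = \<epsilon> * norm D" using \<open>\<epsilon> > 0\<close> by (simp add: \<phi>'_def dist_norm)
      also have "\<dots> \<le> \<epsilon> * (R + 1)" using \<open>norm D \<le> R + 1\<close> \<open>\<epsilon> > 0\<close> by simp
      also have "\<dots> = e / 2" using \<open>R \<ge> 0\<close> by (simp add: \<epsilon>_def field_simps)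
      also have "\<dots> < e" using \<open>e > 0\<close> by simp
      finally have "dist \<phi>' \<phi> < e" .
      moreover have "\<phi>' \<in> \<G>"
      proof -
        have "uniquely_maximized T (apply_lip \<psi>) \<O>" if "\<psi> \<in> ball \<phi>' \<tau>" for \<psi>
        proof -
          define h where "h = \<psi> - \<phi>'"
          have norm_h: "sup_norm (apply_lip h) + lip_const (apply_lip h) < \<tau>"
            using that unfolding norm_lip.rep_eq[symmetric] by (simp add: h_def dist_norm norm_minus_commute)
          obtain L where h: "bounded (range (apply_lip h))" "L-lipschitz_on UNIV (apply_lip h)"
            using apply_lip[of h] by blast
          have lip: "(lip_const (apply_lip h))-lipschitz_on UNIV (apply_lip h)"
            using h(2) by (rule lip_const_lipschitz)
          have sup: "\<bar>apply_lip h x\<bar> \<le> sup_norm (apply_lip h)" for x using h(1) by (rule abs_le_sup_norm)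
          have "0 \<le> lip_const (apply_lip h)" "0 \<le> sup_norm (apply_lip h)"
            using lipschitz_on_nonneg[OF lip] sup[of c] by auto
          then have "\<tau>-lipschitz_on UNIV (apply_lip h)"
            using norm_h by (intro lipschitz_on_le[OF lip]) simp
          moreover have "\<bar>apply_lip h x\<bar> \<le> \<tau>" for x
            using sup[of x] norm_h \<open>0 \<le> lip_const (apply_lip h)\<close> by linarith
          ultimately have "uniquely_maximized T (\<lambda>x. apply_lip \<phi> x - \<epsilon> * infdist x \<O> + apply_lip h x) \<O>"
            using max[of "apply_lip h"] by (simp add: \<O>_def)
          moreover have "apply_lip \<psi> = (\<lambda>x. apply_lip \<phi> x - \<epsilon> * infdist x \<O> + apply_lip h x)"
            by (simp add: h_def \<phi>'_def minus_lip.rep_eq scaleR_lip.rep_eq D)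
          ultimately show ?thesis by simp
        qed
        then show ?thesis
          using orb \<open>\<tau> > 0\<close> unfolding \<G>_def \<O>_def[symmetric]
          by (intro CollectI exI[of _ "ball \<phi>' \<tau>"] exI[of _ \<O>]) auto
      qed
      ultimately show "\<exists>y\<in>\<G>. dist y \<phi> < e" by blast
    qed
  qed
  then have "closure \<G> = UNIV" by blast
  with \<open>open \<G>\<close> show ?thesis
    unfolding lipschitz_TPO_def by (intro exI[of _ \<G>]) (auto simp: \<G>_def)
qed

end

section \<open>Expanding lifts of circle maps\<close>

text \<open>If \<open>G b < G a\<close>, take a level in between that is not attained on
  \<open>N\<close>, and the last point where \<open>G\<close> is at least this level. The level is
  attained there, so the derivative is positive and \<open>G\<close> exceeds the level further to
  the right. The image of \<open>N\<close> has to be null because it is a level that must avoid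
  it.\<close>

lemma mono_of_deriv_pos_ae:
  fixes G :: "real \<Rightarrow> real"
  assumes "a \<le> b" and cont: "continuous_on {a..b} G" and null: "negligible (G ` (N \<inter> {a..b}))"
    and deriv: "\<And>x. x \<in> {a..b} \<Longrightarrow> x \<notin> N \<Longrightarrow> \<exists>D>0. (G has_real_derivative D) (at x)"
  shows "G a \<le> G b"
proof (rule ccontr)
  assume "\<not> G a \<le> G b"
  then have "\<not> negligible {G b<..<G a}" using negligible_interval(2)[of "G b" "G a"] by (simp add: box_real)
  then obtain y where y: "G b < y" "y < G a" "y \<notin> G ` (N \<inter> {a..b})"
    using negligible_subset[OF null] by (meson greaterThanLessThan_iff subsetI)
  define S where "S = {t \<in> {a..b}. y \<le> G t}"
  have "compact S"
  proof -
    have "closed S"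
      unfolding S_def using cont by (intro continuous_on_closed_Collect_le continuous_on_const) auto
    moreover have "bounded S" by (rule bounded_subset[of "{a..b}"]) (auto simp: S_def)
    ultimately show ?thesis by (simp add: compact_eq_bounded_closed)
  qed
  moreover have "a \<in> S" using y \<open>a \<le> b\<close> by (simp add: S_def)
  ultimately obtain x where x: "x \<in> S" "\<And>t. t \<in> S \<Longrightarrow> t \<le> x"
    using compact_attains_sup[of S] by blast
  have xab: "a \<le> x" "x \<le> b" "y \<le> G x" using x(1) by (auto simp: S_def)
  have "\<exists>t\<ge>x. t \<le> b \<and> G t = y"
    using xab y by (intro IVT2') (auto intro: continuous_on_subset[OF cont])
  then obtain t where t: "x \<le> t" "t \<le> b" "G t = y" by blast
  have "t = x" using x(2)[of t] t xab by (simp add: S_def)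
  then have "G x = y" "x < b" using t y xab by (auto simp: less_le)
  then have "x \<notin> N" using y(3) xab by auto
  then obtain D where "D > 0" "(G has_real_derivative D) (at x)" using deriv xab by auto
  then obtain d where d: "d > 0" "\<And>h. 0 < h \<Longrightarrow> h < d \<Longrightarrow> G x < G (x + h)"
    using DERIV_pos_inc_right by blast
  define h where "h = min (d / 2) (b - x)"
  have "0 < h" "h < d" "x + h \<le> b" using \<open>d > 0\<close> \<open>x < b\<close> by (auto simp: h_def)
  then have "x + h \<in> S" using d(2)[of h] xab \<open>G x = y\<close> by (simp add: S_def)
  then show False using x(2) \<open>0 < h\<close> by fastforce
qed

text \<open>Monotonicity of \<open>F x - k * x\<close>: a locally Lipschitz map sends null sets to
  null sets, monotonicity of \<open>F\<close> fixes the sign of \<open>D\<close>, and the strict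
  bound makes \<open>D - k\<close> positive.\<close>

lemma expansion_of_deriv_ae:
  fixes F :: "real \<Rightarrow> real"
  assumes "a \<le> b" and cont: "continuous_on UNIV F" and "strict_mono F"
    and lip: "\<eta> > 0" "\<And>s t. \<bar>s - t\<bar> < \<eta> \<Longrightarrow> \<bar>F s - F t\<bar> \<le> K * \<bar>s - t\<bar>"
    and "negligible N"
    and deriv: "\<And>x. x \<in> {a..b} \<Longrightarrow> x \<notin> N \<Longrightarrow> \<exists>D. k < \<bar>D\<bar> \<and> (F has_real_derivative D) (at x)"
  shows "k * (b - a) \<le> F b - F a"
proof -
  define G where "G x = F x - k * x" for x
  have "G a \<le> G b"
  proof (rule mono_of_deriv_pos_ae[OF \<open>a \<le> b\<close>])
    show "continuous_on {a..b} G"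
      unfolding G_def using cont by (intro continuous_intros) (auto intro: continuous_on_subset)
    show "negligible (G ` (N \<inter> {a..b}))"
    proof (rule negligible_locally_Lipschitz_image)
      show "negligible (N \<inter> {a..b})" using \<open>negligible N\<close> by (simp add: negligible_Int)
      fix x
      have "norm (G y - G x) \<le> (K + \<bar>k\<bar>) * norm (y - x)" if "y \<in> ball x \<eta>" for y
      proof -
        have "\<bar>F y - F x\<bar> \<le> K * \<bar>y - x\<bar>"
          using that lip(2)[of y x] by (simp add: dist_real_def abs_minus_commute)
        moreover have "\<bar>k * y - k * x\<bar> = \<bar>k\<bar> * \<bar>y - x\<bar>" by (simp add: abs_mult flip: right_diff_distrib)
        ultimately show ?thesis unfolding G_def real_norm_def distrib_right by linarith
      qed
      then show "\<exists>T B. open T \<and> x \<in> T \<and> (\<forall>y\<in>N \<inter> {a..b} \<inter> T. norm (G y - G x) \<le> B * norm (y - x))"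
        using lip(1) by (intro exI[of _ "ball x \<eta>"] exI[of _ "K + \<bar>k\<bar>"]) auto
    qed simp
    fix x assume "x \<in> {a..b}" "x \<notin> N"
    then obtain D where D: "k < \<bar>D\<bar>" "(F has_real_derivative D) (at x)" using deriv by blast
    have "D \<ge> 0"
      using mono_on_imp_deriv_nonneg[of UNIV F D x] D(2) \<open>strict_mono F\<close>
      by (simp add: strict_mono_mono)
    then have "k < D" using D(1) by simp
    moreover have "(G has_real_derivative (D - k * 1)) (at x)"
      unfolding G_def using D(2) by (intro DERIV_diff DERIV_cmult DERIV_ident)
    ultimately show "\<exists>D>0. (G has_real_derivative D) (at x)" by (intro exI[of _ "D - k"]) simp
  qed
  then show ?thesis by (simp add: G_def algebra_simps)
qed

section \<open>Lifts of circle maps to the line\<close>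

lemma infdist_Ints_small: "\<bar>x\<bar> \<le> 1 / 2 \<Longrightarrow> infdist x \<int> = \<bar>x :: real\<bar>"
proof (rule antisym)
  assume x: "\<bar>x\<bar> \<le> 1 / 2"
  show "infdist x \<int> \<le> \<bar>x\<bar>" using infdist_le[of 0 \<int> x] by (simp add: dist_real_def)
  obtain a where a: "a \<in> \<int>" "infdist x \<int> = dist x a"
    using infdist_attains_inf[of "\<int> :: real set" x] Ints_0 closed_Ints by blast
  show "\<bar>x\<bar> \<le> infdist x \<int>"
  proof (cases "a = 0")
    case False
    then have "1 \<le> \<bar>a\<bar>" using a(1) Ints_nonzero_abs_ge1 by blast
    then show ?thesis using a(2) x by (simp add: dist_real_def)
  qed (simp add: a(2) dist_real_def)
qed

lemma dist_to_circle_small: "\<bar>s - t\<bar> \<le> 1 / 2 \<Longrightarrow> dist (to_circle s) (to_circle t) = \<bar>s - t\<bar>"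
  by (simp add: dist_to_circle infdist_Ints_small)

lemma circle_lift_near:
  obtains t where "to_circle t = y" "\<bar>s - t\<bar> = dist (to_circle s) y" "\<bar>s - t\<bar> \<le> 1 / 2"
proof -
  obtain t0 where t0: "y = to_circle t0" by (metis Quotient_abs_rep Quotient_circle)
  obtain a where a: "a \<in> \<int>" "infdist (s - t0) \<int> = dist (s - t0) a"
    using infdist_attains_inf[of "\<int> :: real set" "s - t0"] Ints_0 closed_Ints by blast
  show thesis
  proof (rule that[of "t0 + a"])
    show "to_circle (t0 + a) = y" using a by (simp add: t0 to_circle_eq_iff)
    show d: "\<bar>s - (t0 + a)\<bar> = dist (to_circle s) y"
      using a(2) by (simp add: t0 dist_to_circle dist_real_def algebra_simps)
    have "dist (to_circle s) y \<le> dist (s - t0) (of_int (round (s - t0)))"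
      by (simp add: t0 dist_to_circle infdist_le)
    also have "\<dots> \<le> 1 / 2"
      using of_int_round_abs_le[of "s - t0"] by (simp add: dist_real_def abs_minus_commute)
    finally show "\<bar>s - (t0 + a)\<bar> \<le> 1 / 2" using d by simp
  qed
qed

text \<open>The difference of the lifts is continuous with integer values.\<close>

lemma lift_unique:
  fixes F F' :: "real \<Rightarrow> real"
  assumes "continuous_on UNIV F" "continuous_on UNIV F'" and eq: "\<And>s. to_circle (F s) = to_circle (F' s)"
  obtains m where "\<And>s. F s = F' s + m"
proof -
  have "(\<lambda>s. F s - F' s) constant_on (UNIV :: real set)"
  proof (rule continuous_discrete_range_constant)
    show "continuous_on UNIV (\<lambda>s. F s - F' s)" using assms by (intro continuous_intros)
    fix s
    have int: "F t - F' t \<in> \<int>" for t using eq[of t] by (simp add: to_circle_eq_iff)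
    have "1 \<le> norm ((F t - F' t) - (F s - F' s))" if "F t - F' t \<noteq> F s - F' s" for t
      using Ints_nonzero_abs_ge1[OF Ints_diff[OF int[of t] int[of s]]] that by simp
    then show "\<exists>e>0. \<forall>t. t \<in> UNIV \<and> F t - F' t \<noteq> F s - F' s \<longrightarrow> e \<le> norm ((F t - F' t) - (F s - F' s))"
      by (intro exI[of _ 1]) auto
  qed simp
  then obtain m where "\<And>s. F s - F' s = m" by (auto simp: constant_on_def)
  then have "F s = F' s + m" for s by (metis diff_add_cancel add.commute)
  then show thesis by (rule that)
qed

text \<open>\<open>has_circle_derivative\<close> brings its own lift and representative at each
  point; translating the argument by the integer \<open>t - s\<close> and comparing lifts transfers
  the derivative to the one lift \<open>F\<close>.\<close>

lemma has_circle_derivative_lift: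
  assumes "has_circle_derivative T D (to_circle s)"
    and F: "continuous_on UNIV F" "\<And>s. to_circle (F s) = T (to_circle s)"
  shows "(F has_real_derivative D) (at s)"
proof -
  obtain F' t where F': "continuous_on UNIV F'" "\<And>s. to_circle (F' s) = T (to_circle s)"
    and t: "to_circle t = to_circle s" "(F' has_real_derivative D) (at t)"
    using assms(1) unfolding has_circle_derivative_def by blast
  have shift: "to_circle (u + (t - s)) = to_circle u" for u
    using t(1) by (simp add: to_circle_eq_iff)
  obtain m where m: "\<And>u. F u = F' (u + (t - s)) + m"
  proof (rule lift_unique[of F "\<lambda>u. F' (u + (t - s))"])
    show "continuous_on UNIV (\<lambda>u. F' (u + (t - s)))"
      by (rule continuous_on_compose2[OF F'(1)]) (auto intro!: continuous_intros)
  qed (use F F' shift in auto)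
  have "((\<lambda>u. F' (u + (t - s)) + m) has_real_derivative D + 0) (at s)"
    using t(2) DERIV_shift[of F' D s "t - s"] by (intro DERIV_add DERIV_const) simp
  moreover have "F = (\<lambda>u. F' (u + (t - s)) + m)" using m by blast
  ultimately show ?thesis by simp
qed

text \<open>Countably many integer translates of the exceptional set in \<open>{0..<1}\<close> cover
  it on the whole line.\<close>

lemma AE_circle_lebesgue_negligible:
  assumes "AE x in circle_lebesgue. P x"
  shows "negligible {s. \<not> P (to_circle s)}"
proof -
  have "AE s in restrict_space lborel {0..<1}. P (to_circle s)"
    using assms unfolding circle_lebesgue_def
    by (rule AE_distrD[rotated])
      (intro measurable_restrict_space1, simp add: borel_measurable_continuous_onI continuous_on_to_circle)
  then have "AE s in lborel. s \<in> {0..<1} \<longrightarrow> P (to_circle s)"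
    by (subst (asm) AE_restrict_space_iff) auto
  then obtain N where N: "{s. \<not> (s \<in> {0..<1} \<longrightarrow> P (to_circle s))} \<subseteq> N" "N \<in> null_sets lborel"
    by (auto elim!: AE_E simp: null_sets_def)
  have "negligible N" unfolding negligible_iff_null_sets using N(2) by (rule null_sets_completionI)
  have "{s. \<not> P (to_circle s)} \<subseteq> \<Union> (range (\<lambda>n::int. (+) (of_int n) ` N))"
  proof
    fix s assume "s \<in> {s. \<not> P (to_circle s)}"
    moreover have "to_circle (frac s) = to_circle s" by (simp add: to_circle_eq_iff frac_def)
    ultimately have "frac s \<in> N" using N(1) by (auto simp: frac_lt_1)
    then show "s \<in> \<Union> (range (\<lambda>n::int. (+) (of_int n) ` N))"
      by (auto simp: image_iff frac_def intro!: exI[of _ "\<lfloor>s\<rfloor>"] bexI[of _ "frac s"])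
  qed
  moreover have "negligible (\<Union> (range (\<lambda>n::int. (+) (real_of_int n) ` N)))"
    using \<open>negligible N\<close> by (intro negligible_countable_Union) (auto intro: negligible_translation)
  ultimately show ?thesis by (meson negligible_subset)
qed

text \<open>Equal values at \<open>a < b\<close> force an interior extremum on
  \<open>{a..b}\<close>: either the maximum or the minimum is interior, or both sit at the ends and
  the function is constant. Near an interior point a continuous locally injective function is
  strictly monotone.\<close>

lemma locally_injective_imp_injective:
  fixes F :: "real \<Rightarrow> real"
  assumes cont: "continuous_on UNIV F" and loc: "\<And>x. \<exists>e>0. inj_on F (ball x e)"
  shows "inj F"
proof (rule ccontr)
  have no_extremum: False
    if x: "x \<in> {a<..<b}" and ext: "(\<forall>t\<in>{a..b}. F t \<le> F x) \<or> (\<forall>t\<in>{a..b}. F x \<le> F t)" for x a b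
  proof -
    obtain e where e: "e > 0" "inj_on F (ball x e)" using loc by blast
    define d where "d = min (e / 2) (min (x - a) (b - x))"
    have d: "d > 0" "d < e" "a \<le> x - d" "x + d \<le> b" using e x by (auto simp: d_def)
    have "inj_on F {x - d..x + d}"
      using d by (intro inj_on_subset[OF e(2)]) (auto simp: dist_real_def)
    then have "(F (x - d) < F x \<and> F x < F (x + d)) \<or> (F (x + d) < F x \<and> F x < F (x - d))"
      using d by (intro continuous_inj_imp_mono continuous_on_subset[OF cont]) auto
    moreover have "x - d \<in> {a..b}" "x + d \<in> {a..b}" using d x by auto
    ultimately show False using ext by (metis less_le_not_le)
  qed
  assume "\<not> inj F"
  then obtain a b where ab: "a < b" "F a = F b" by (metis injI linorder_neqE)
  have cont_ab: "continuous_on {a..b} F" using cont by (rule continuous_on_subset) simp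
  obtain u where u: "u \<in> {a..b}" "\<And>t. t \<in> {a..b} \<Longrightarrow> F t \<le> F u"
    using continuous_attains_sup[OF compact_Icc _ cont_ab] ab by auto
  obtain l where l: "l \<in> {a..b}" "\<And>t. t \<in> {a..b} \<Longrightarrow> F l \<le> F t"
    using continuous_attains_inf[OF compact_Icc _ cont_ab] ab by auto
  show False
  proof (cases "u \<in> {a<..<b} \<or> l \<in> {a<..<b}")
    case True
    then show ?thesis using no_extremum u(2) l(2) by blast
  next
    case False
    then have "F u = F l" using u(1) l(1) ab(2) by (auto simp: less_le)
    moreover have "F l \<le> F ((a + b) / 2)" using ab by (intro l(2)) auto
    ultimately have "\<forall>t\<in>{a..b}. F t \<le> F ((a + b) / 2)" using u(2) by fastforce
    then show ?thesis using no_extremum[of "(a + b) / 2" a b] ab by simp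
  qed
qed

lemma continuous_injective_strict_mono:
  fixes F :: "real \<Rightarrow> real"
  assumes cont: "continuous_on UNIV F" and "inj F"
  shows "strict_mono F \<or> strict_mono (\<lambda>x. - F x)"
proof -
  have mono3: "(F a < F x \<and> F x < F b) \<or> (F b < F x \<and> F x < F a)" if "a < x" "x < b" for a x b
    using that assms by (intro continuous_inj_imp_mono) (auto intro: continuous_on_subset inj_on_subset)
  have "F 0 \<noteq> F 1" using injD[OF \<open>inj F\<close>, of 0 1] by auto
  then consider "F 0 < F 1" | "F 1 < F 0" by linarith
  then show ?thesis
  proof cases
    case 1
    have "F s < F t" if "s < t" for s t
    proof -
      \<comment> \<open>An interval around \<open>s\<close>, \<open>t\<close>, 0 and 1 carries the
        direction of \<open>F\<close> from \<open>0 < 1\<close> over to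
        \<open>s < t\<close>.\<close>
      define a where "a = min s 0 - 1"
      define b where "b = max t 1 + 1"
      have ab: "a < 0" "a < s" "1 < b" "t < b" by (auto simp: a_def b_def)
      then have "F a < F b" using mono3[of a 0 1] mono3[of a 1 b] 1 by auto
      then have "F a < F s" "F s < F b" using mono3[of a s b] that ab by auto
      then show ?thesis using mono3[of s t b] that ab by auto
    qed
    then show ?thesis by (auto intro: strict_monoI)
  next
    case 2
    have "F t < F s" if "s < t" for s t
    proof -
      define a where "a = min s 0 - 1"
      define b where "b = max t 1 + 1"
      have ab: "a < 0" "a < s" "1 < b" "t < b" by (auto simp: a_def b_def)
      then have "F b < F a" using mono3[of a 0 1] mono3[of a 1 b] 2 by auto
      then have "F b < F s" using mono3[of a s b] that ab by auto
      then show ?thesis using mono3[of s t b] that ab by auto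
    qed
    then show ?thesis by (auto intro: strict_monoI)
  qed
qed

lemma covering_space_locally_injective:
  assumes "covering_space UNIV T UNIV"
  obtains U where "open U" "x \<in> U" "inj_on T U"
proof -
  obtain V v where V: "T x \<in> V" "\<Union>v = T -` V"
    "\<forall>u\<in>v. openin (top_of_set UNIV) u" "\<forall>u\<in>v. \<exists>q. homeomorphism u V T q"
    using assms unfolding covering_space_def by (metis Int_UNIV_left UNIV_I)
  then obtain u where u: "u \<in> v" "x \<in> u" by blast
  then obtain q where "homeomorphism u V T q" using V by blast
  then have "inj_on T u" by (metis homeomorphism_apply1 inj_on_inverseI)
  moreover have "open u" using V(3) u by simp
  ultimately show thesis using u by (intro that)
qed

lemma circle_lift_inj:
  assumes "covering_space UNIV T UNIV"
    and F: "continuous_on UNIV F" "\<And>s. to_circle (F s) = T (to_circle s)"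
  shows "inj F"
proof (rule locally_injective_imp_injective[OF F(1)])
  fix x
  obtain U where U: "open U" "to_circle x \<in> U" "inj_on T U"
    using covering_space_locally_injective[OF assms(1)] by blast
  obtain e where e: "e > 0" "ball (to_circle x) e \<subseteq> U" using U openE by blast
  have "inj_on F (ball x (min e (1 / 2)))"
  proof (rule inj_onI)
    fix s t assume st: "s \<in> ball x (min e (1 / 2))" "t \<in> ball x (min e (1 / 2))" "F s = F t"
    have "to_circle s \<in> U" "to_circle t \<in> U"
      using st e(2) dist_to_circle_le[of x s] dist_to_circle_le[of x t] by auto
    moreover have "T (to_circle s) = T (to_circle t)" using st(3) F(2) by metis
    ultimately have "s - t \<in> \<int>" using U(3) by (auto simp: to_circle_eq_iff dest: inj_onD)
    moreover have "\<bar>x - s\<bar> < 1 / 2" "\<bar>x - t\<bar> < 1 / 2" using st by (auto simp: dist_real_def)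
    then have "\<bar>s - t\<bar> < 1" by linarith
    ultimately show "s = t" using Ints_nonzero_abs_less1[of "s - t"] by simp
  qed
  then show "\<exists>e>0. inj_on F (ball x e)" using e(1) by (intro exI[of _ "min e (1 / 2)"]) simp
qed

text \<open>Distances on the line and on the circle agree up to \<open>1 / 2\<close>. To move by
  more, the continuous lift would have to pass a displacement of exactly \<open>1 / 2\<close>,
  whereas the threshold on \<open>s - t\<close> keeps displacements on the circle at most
  \<open>1 / 4\<close>.\<close>

lemma circle_lift_lipschitz:
  assumes T: "M-lipschitz_on UNIV T"
    and F: "continuous_on UNIV F" "\<And>s. to_circle (F s) = T (to_circle s)"
    and st: "\<bar>s - t\<bar> \<le> 1 / (4 * (M + 1))"
  shows "\<bar>F s - F t\<bar> \<le> M * \<bar>s - t\<bar>" "\<bar>F s - F t\<bar> \<le> 1 / 2"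
proof -
  have "M \<ge> 0" using T by (rule lipschitz_on_nonneg)
  have d: "dist (to_circle (F u)) (to_circle (F v)) \<le> M * \<bar>u - v\<bar>" for u v
    using lipschitz_onD[OF T, of "to_circle u" "to_circle v"] dist_to_circle_le[of u v] \<open>M \<ge> 0\<close>
    by (simp add: F(2)) (smt (verit) dist_real_def mult_left_mono)
  show half: "\<bar>F s - F t\<bar> \<le> 1 / 2"
  proof (rule ccontr)
    assume far: "\<not> \<bar>F s - F t\<bar> \<le> 1 / 2"
    have "connected ((\<lambda>u. \<bar>F s - F u\<bar>) ` closed_segment s t)"
      using F(1) by (intro connected_continuous_image continuous_intros) (auto intro: continuous_on_subset)
    moreover have "\<bar>F s - F s\<bar> \<in> (\<lambda>u. \<bar>F s - F u\<bar>) ` closed_segment s t"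
      "\<bar>F s - F t\<bar> \<in> (\<lambda>u. \<bar>F s - F u\<bar>) ` closed_segment s t" by (intro imageI, simp)+
    ultimately have "1 / 2 \<in> (\<lambda>u. \<bar>F s - F u\<bar>) ` closed_segment s t"
      by (rule connectedD_interval) (use far in auto)
    then obtain u where u: "u \<in> closed_segment s t" "\<bar>F s - F u\<bar> = 1 / 2" by auto
    have "1 / 2 \<le> M * \<bar>s - u\<bar>" using d[of s u] dist_to_circle_small[of "F s" "F u"] u(2) by simp
    also have "\<dots> \<le> (M + 1) * \<bar>s - t\<bar>"
      using u(1) \<open>M \<ge> 0\<close> by (intro mult_mono) (auto simp: closed_segment_eq_real_ivl split: if_splits)
    also have "\<dots> \<le> (M + 1) * (1 / (4 * (M + 1)))" using st \<open>M \<ge> 0\<close> by (intro mult_left_mono) auto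
    also have "\<dots> = 1 / 4" using \<open>M \<ge> 0\<close> by (simp add: field_simps)
    finally show False by simp
  qed
  then show "\<bar>F s - F t\<bar> \<le> M * \<bar>s - t\<bar>" using d[of s t] dist_to_circle_small[OF half] by simp
qed

lemma circle_expanding_lift:
  fixes T :: "circle \<Rightarrow> circle" and c :: circle
  assumes cover: "covering_space UNIV T UNIV"
    and M: "M-lipschitz_on UNIV T"
    and deriv: "\<And>V. open V \<Longrightarrow> c \<in> V \<Longrightarrow>
      \<exists>C>1. AE x in circle_lebesgue. x \<notin> V \<longrightarrow> (\<exists>D. has_circle_derivative T D x \<and> \<bar>D\<bar> \<ge> C)"
  obtains F where "strict_mono F \<or> strict_mono (\<lambda>s. - F s)" "continuous_on UNIV F"
    "\<And>s. to_circle (F s) = T (to_circle s)" "\<And>s t. \<bar>s - t\<bar> \<le> \<bar>F s - F t\<bar>"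
    "\<And>r. r > 0 \<Longrightarrow> \<exists>k>1. \<forall>s t. (\<forall>x\<in>{s..t}. r \<le> dist (to_circle x) c) \<longrightarrow> s \<le> t \<longrightarrow> k * \<bar>s - t\<bar> \<le> \<bar>F s - F t\<bar>"
proof -
  define Q where "Q r C x \<longleftrightarrow> (r \<le> dist x c \<longrightarrow> (\<exists>D. has_circle_derivative T D x \<and> \<bar>D\<bar> \<ge> C))" for r C x
  have null: "\<exists>C>1. negligible {s. \<not> Q r C (to_circle s)}" if "r > 0" for r
  proof -
    have "open (ball c r)" "c \<in> ball c r" using that by auto
    then obtain C where "C > 1" "AE x in circle_lebesgue. x \<notin> ball c r \<longrightarrow> (\<exists>D. has_circle_derivative T D x \<and> \<bar>D\<bar> \<ge> C)"
      using deriv by blast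
    then have "AE x in circle_lebesgue. Q r C x" by (simp add: Q_def not_less dist_commute)
    then show ?thesis using \<open>C > 1\<close> AE_circle_lebesgue_negligible by blast
  qed
  obtain c0 where c0: "to_circle c0 = c" by (metis Quotient_abs_rep Quotient_circle)
  \<comment> \<open>The lift is taken from \<open>has_circle_derivative\<close> at a single point,
    which exists because the points between \<open>c0 + 1 / 4\<close> and \<open>c0 + 1 / 2\<close>
    are not a null set.\<close>
  obtain F where F: "continuous_on UNIV F" "\<And>s. to_circle (F s) = T (to_circle s)"
  proof -
    obtain C where C: "negligible {s. \<not> Q (1 / 4) C (to_circle s)}" using null[of "1 / 4"] by auto
    have "\<not> negligible {c0 + 1 / 4<..<c0 + 1 / 2}"
      using negligible_interval(2)[of "c0 + 1 / 4" "c0 + 1 / 2"] by (simp add: box_real)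
    then obtain s where s: "s \<in> {c0 + 1 / 4<..<c0 + 1 / 2}" "Q (1 / 4) C (to_circle s)"
      using negligible_subset[OF C] by (metis (mono_tags, lifting) mem_Collect_eq subsetI)
    have "1 / 4 \<le> dist (to_circle s) c"
      unfolding c0[symmetric] using s(1) by (subst dist_to_circle_small) auto
    then obtain D where "has_circle_derivative T D (to_circle s)" using s(2) by (auto simp: Q_def)
    then show thesis unfolding has_circle_derivative_def using that by blast
  qed
  have mono: "strict_mono F \<or> strict_mono (\<lambda>s. - F s)"
    by (rule continuous_injective_strict_mono[OF F(1) circle_lift_inj[OF cover F]])
  have "M \<ge> 0" using M by (rule lipschitz_on_nonneg)
  define \<eta> where "\<eta> = 1 / (4 * (M + 1))"
  have "\<eta> > 0" using \<open>M \<ge> 0\<close> by (simp add: \<eta>_def)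
  have F_lip: "\<bar>F s - F t\<bar> \<le> M * \<bar>s - t\<bar>" if "\<bar>s - t\<bar> < \<eta>" for s t
    using circle_lift_lipschitz(1)[OF M F, of s t] that by (simp add: \<eta>_def)
  have expansion: "k * \<bar>s - t\<bar> \<le> \<bar>F s - F t\<bar>"
    if N: "negligible N" "\<And>x. x \<in> {s..t} \<Longrightarrow> x \<notin> N \<Longrightarrow> \<exists>D. k < \<bar>D\<bar> \<and> (F has_real_derivative D) (at x)" and "s \<le> t"
    for N s t k
    using mono
  proof
    assume "strict_mono F"
    then have "k * (t - s) \<le> F t - F s"
      using expansion_of_deriv_ae[OF \<open>s \<le> t\<close> F(1) _ \<open>\<eta> > 0\<close> F_lip N] by blast
    then show ?thesis using \<open>s \<le> t\<close> by (simp add: abs_minus_commute[of s])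
  next
    assume "strict_mono (\<lambda>s. - F s)"
    moreover have "\<exists>D. k < \<bar>D\<bar> \<and> ((\<lambda>s. - F s) has_real_derivative D) (at x)"
      if x: "x \<in> {s..t}" "x \<notin> N" for x
    proof -
      obtain D where "k < \<bar>D\<bar>" "(F has_real_derivative D) (at x)" using N(2)[OF x] by blast
      then show ?thesis by (intro exI[of _ "- D"]) (auto intro: DERIV_minus)
    qed
    moreover have "\<bar>- F s - - F t\<bar> \<le> M * \<bar>s - t\<bar>" if "\<bar>s - t\<bar> < \<eta>" for s t
      using F_lip[OF that] by simp
    ultimately have "k * (t - s) \<le> - F t - - F s"
      using F(1) N(1) \<open>\<eta> > 0\<close> by (intro expansion_of_deriv_ae[OF \<open>s \<le> t\<close>, of _ \<eta> M N]) (auto intro: continuous_on_minus)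
    then show ?thesis using \<open>s \<le> t\<close> by simp
  qed
  have "\<bar>s - t\<bar> \<le> \<bar>F s - F t\<bar>" if "s \<le> t" for s t
  proof -
    have "\<forall>n::nat. \<exists>C>1. negligible {s. \<not> Q (1 / Suc n) C (to_circle s)}" using null by simp
    then obtain C where C: "\<And>n::nat. C n > 1" "\<And>n. negligible {s. \<not> Q (1 / Suc n) (C n) (to_circle s)}"
      by metis
    \<comment> \<open>The exceptional sets for all radii \<open>1 / Suc n\<close> and the lifts of
      \<open>c\<close> itself: off this null set the derivative exceeds 1 in modulus, so intervals
      may cross \<open>c\<close>.\<close>
    define N where "N = (\<Union>n. {s. \<not> Q (1 / Suc n) (C n) (to_circle s)}) \<union> (\<lambda>m::int. c0 + m) ` UNIV"
    have "negligible ((\<lambda>m::int. c0 + m) ` UNIV)"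
      unfolding negligible_iff_null_sets by (intro null_sets_completionI countable_imp_null_set_lborel) simp
    then have "negligible N" unfolding N_def using C(2)
      by (intro negligible_Un negligible_Union_nat)
    moreover have "\<exists>D. 1 < \<bar>D\<bar> \<and> (F has_real_derivative D) (at x)" if "x \<notin> N" for x
    proof -
      have "to_circle x \<noteq> c"
      proof
        assume "to_circle x = c"
        then have "x - c0 \<in> \<int>" using c0 by (simp flip: to_circle_eq_iff)
        then obtain m where "x - c0 = of_int m" by (rule Ints_cases)
        then have "x = c0 + of_int m" by simp
        then show False using that by (auto simp: N_def)
      qed
      then obtain n where "1 / Suc n < dist (to_circle x) c"
        using nat_approx_posE[of "dist (to_circle x) c"] by auto
      moreover have "Q (1 / Suc n) (C n) (to_circle x)" using that by (auto simp: N_def)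
      ultimately obtain D where "has_circle_derivative T D (to_circle x)" "\<bar>D\<bar> \<ge> C n" by (auto simp: Q_def)
      then show ?thesis
        using has_circle_derivative_lift[OF _ F] C(1)[of n] by (meson less_le_trans)
    qed
    ultimately show ?thesis using expansion[of N s t 1] that by simp
  qed
  then have "\<bar>s - t\<bar> \<le> \<bar>F s - F t\<bar>" for s t by (metis abs_minus_commute linear)
  moreover have "\<exists>k>1. \<forall>s t. (\<forall>x\<in>{s..t}. r \<le> dist (to_circle x) c) \<longrightarrow> s \<le> t \<longrightarrow> k * \<bar>s - t\<bar> \<le> \<bar>F s - F t\<bar>"
    if r: "r > 0" for r
  proof -
    obtain C where C: "C > 1" "negligible {s. \<not> Q r C (to_circle s)}" using null[OF r] by blast
    \<comment> \<open>The midpoint of 1 and \<open>C\<close>, because \<open>expansion\<close> asks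
      for a strict bound on the derivative.\<close>
    have "(1 + C) / 2 * \<bar>s - t\<bar> \<le> \<bar>F s - F t\<bar>"
      if st: "\<And>x. x \<in> {s..t} \<Longrightarrow> r \<le> dist (to_circle x) c" "s \<le> t" for s t
    proof (rule expansion[OF C(2) _ st(2)])
      fix x assume x: "x \<in> {s..t}" "x \<notin> {s. \<not> Q r C (to_circle s)}"
      then obtain D where "has_circle_derivative T D (to_circle x)" "\<bar>D\<bar> \<ge> C" using st(1) by (auto simp: Q_def)
      then show "\<exists>D. (1 + C) / 2 < \<bar>D\<bar> \<and> (F has_real_derivative D) (at x)"
        using has_circle_derivative_lift[OF _ F] C(1) by (intro exI[of _ D]) auto
    qed
    then show ?thesis using C(1) by (intro exI[of _ "(1 + C) / 2"]) auto
  qed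
  ultimately show thesis using that[OF mono F] by blast
qed

section \<open>Contraction and expansion for covering maps of the circle\<close>

lemma circle_weakly_expanding:
  fixes T :: "circle \<Rightarrow> circle" and c :: circle
  assumes cover: "covering_space UNIV T UNIV" and "T c = c"
    and M: "M-lipschitz_on UNIV T"
    and deriv: "\<And>V. open V \<Longrightarrow> c \<in> V \<Longrightarrow>
      \<exists>C>1. AE x in circle_lebesgue. x \<notin> V \<longrightarrow> (\<exists>D. has_circle_derivative T D x \<and> \<bar>D\<bar> \<ge> C)"
  shows "weakly_expanding T c M"
proof -
  obtain F where mono: "strict_mono F \<or> strict_mono (\<lambda>s. - F s)" and F: "continuous_on UNIV F"
    "\<And>s. to_circle (F s) = T (to_circle s)" and weak: "\<And>s t. \<bar>s - t\<bar> \<le> \<bar>F s - F t\<bar>"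
    and strong: "\<And>r. r > 0 \<Longrightarrow> \<exists>k>1. \<forall>s t. (\<forall>x\<in>{s..t}. r \<le> dist (to_circle x) c) \<longrightarrow> s \<le> t \<longrightarrow> k * \<bar>s - t\<bar> \<le> \<bar>F s - F t\<bar>"
    using circle_expanding_lift[OF cover M deriv] by blast
  have "M \<ge> 0" using M by (rule lipschitz_on_nonneg)
  have additive: "\<bar>F s - F t\<bar> = \<bar>F s - F u\<bar> + \<bar>F u - F t\<bar>" if "u \<in> closed_segment s t" for s t u
  proof -
    have "(F s \<le> F u \<and> F u \<le> F t) \<or> (F t \<le> F u \<and> F u \<le> F s)"
      using mono strict_mono_less_eq[of F] strict_mono_less_eq[of "\<lambda>s. - F s"] that
      by (auto simp: closed_segment_eq_real_ivl split: if_splits)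
    then show ?thesis by linarith
  qed
  \<comment> \<open>Weak expansion makes \<open>F\<close> unbounded in both directions, and
    intermediate values do the rest.\<close>
  have surj: "\<exists>s. F s = v" for v
  proof -
    define m where "m = \<bar>v\<bar> + \<bar>F 0\<bar> + 1"
    have "m > 0" by (simp add: m_def)
    have far: "m \<le> \<bar>F m - F 0\<bar>" "m \<le> \<bar>F (- m) - F 0\<bar>"
      using weak[of m 0] weak[of "- m" 0] \<open>m > 0\<close> by auto
    have "0 \<in> closed_segment (- m) m" using \<open>m > 0\<close> by (simp add: closed_segment_eq_real_ivl)
    then have "\<bar>F (- m) - F m\<bar> = \<bar>F (- m) - F 0\<bar> + \<bar>F 0 - F m\<bar>" by (rule additive)
    then have "(F (- m) \<le> v \<and> v \<le> F m) \<or> (F m \<le> v \<and> v \<le> F (- m))"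
      using far by (auto simp: m_def abs_if split: if_splits)
    then show ?thesis
    proof
      assume "F (- m) \<le> v \<and> v \<le> F m"
      then show ?thesis
        using IVT'[of F "- m" v m] \<open>m > 0\<close> F(1) by (auto intro: continuous_on_subset)
    next
      assume "F m \<le> v \<and> v \<le> F (- m)"
      then show ?thesis
        using IVT2'[of F m v "- m"] \<open>m > 0\<close> F(1) by (auto intro: continuous_on_subset)
    qed
  qed
  \<comment> \<open>Only \<open>s\<close> is known to be far from \<open>c\<close>. The strong
    expansion is used on a first stretch of length \<open>e \<le> r / 2\<close> from
    \<open>s\<close>, the weak one on the rest; since \<open>\<bar>s - t\<bar> \<le> 1\<close>, the
    first stretch is at least the proportion \<open>m\<close> of the whole.\<close>
  have contraction: "\<exists>\<theta>. 0 < \<theta> \<and> \<theta> < 1 \<and>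
    (\<forall>s t. r \<le> dist (to_circle s) c \<longrightarrow> \<bar>s - t\<bar> \<le> 1 \<longrightarrow> \<bar>s - t\<bar> \<le> \<theta> * \<bar>F s - F t\<bar>)" if r: "r > 0" for r
  proof -
    obtain k where "k > 1" and k: "\<And>s t. (\<And>x. x \<in> {s..t} \<Longrightarrow> r / 2 \<le> dist (to_circle x) c) \<Longrightarrow> s \<le> t \<Longrightarrow>
        k * \<bar>s - t\<bar> \<le> \<bar>F s - F t\<bar>"
      using strong[OF half_gt_zero[OF r]] by blast
    define m where "m = min (r / 2) 1"
    have m: "0 < m" "m \<le> r / 2" "m \<le> 1" using r by (auto simp: m_def)
    define \<theta> where "\<theta> = 1 / (1 + (k - 1) * m)"
    have "(k - 1) * m > 0" using \<open>k > 1\<close> m by simp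
    then have \<theta>: "0 < \<theta>" "\<theta> < 1" by (auto simp: \<theta>_def)
    have "\<bar>s - t\<bar> \<le> \<theta> * \<bar>F s - F t\<bar>" if s: "r \<le> dist (to_circle s) c" and st: "\<bar>s - t\<bar> \<le> 1" for s t
    proof -
      define e where "e = min \<bar>s - t\<bar> m"
      have e: "0 \<le> e" "e \<le> \<bar>s - t\<bar>" "e \<le> m" using m by (auto simp: e_def)
      have "m * \<bar>s - t\<bar> \<le> e"
        using st m mult_left_le[of "\<bar>s - t\<bar>" m] mult_left_le_one_le[of "\<bar>s - t\<bar>" m] by (simp add: e_def mult.commute)
      have away: "r / 2 \<le> dist (to_circle x) c" if "\<bar>s - x\<bar> \<le> e" for x
        using s that e(3) m(2) dist_to_circle_le[of s x] dist_triangle[of "to_circle s" c "to_circle x"]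
        by (simp add: dist_real_def)
      define u where "u = (if s \<le> t then s + e else s - e)"
      have u: "u \<in> closed_segment s t" "\<bar>s - u\<bar> = e" "\<bar>u - t\<bar> = \<bar>s - t\<bar> - e"
        using e by (auto simp: u_def closed_segment_eq_real_ivl)
      have near: "k * e \<le> \<bar>F s - F u\<bar>"
      proof (cases "s \<le> t")
        case True
        then have "k * \<bar>s - u\<bar> \<le> \<bar>F s - F u\<bar>"
          using e(1) by (intro k away) (auto simp: u_def)
        then show ?thesis using u(2) by simp
      next
        case False
        then have "k * \<bar>u - s\<bar> \<le> \<bar>F u - F s\<bar>"
          using e(1) by (intro k away) (auto simp: u_def)
        then show ?thesis using u(2) by (simp add: abs_minus_commute)
      qed
      have "(1 + (k - 1) * m) * \<bar>s - t\<bar> = \<bar>s - t\<bar> + (k - 1) * (m * \<bar>s - t\<bar>)" by (simp add: algebra_simps)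
      also have "\<dots> \<le> \<bar>s - t\<bar> + (k - 1) * e"
        using \<open>m * \<bar>s - t\<bar> \<le> e\<close> \<open>k > 1\<close> by (intro add_left_mono mult_left_mono) auto
      also have "\<dots> = k * e + \<bar>u - t\<bar>" using u(3) by (simp add: algebra_simps)
      also have "\<dots> \<le> \<bar>F s - F u\<bar> + \<bar>F u - F t\<bar>" using near weak[of u t] by (rule add_mono)
      also have "\<dots> = \<bar>F s - F t\<bar>" by (rule additive[OF u(1), symmetric])
      finally show ?thesis using \<open>(k - 1) * m > 0\<close> by (simp add: \<theta>_def field_simps)
    qed
    with \<theta> show ?thesis by blast
  qed
  show ?thesis
  proof
    show "compact (UNIV :: circle set)" by (rule compact_circle)
    fix r :: real assume "r > 0"
    obtain \<theta> where \<theta>: "0 < \<theta>" "\<theta> < 1"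
      and contr: "\<And>s t. r \<le> dist (to_circle s) c \<Longrightarrow> \<bar>s - t\<bar> \<le> 1 \<Longrightarrow> \<bar>s - t\<bar> \<le> \<theta> * \<bar>F s - F t\<bar>"
      using contraction[OF \<open>r > 0\<close>] by blast
    have "\<exists>y'. T y' = x \<and> dist y y' \<le> dist (T y) x \<and> (r \<le> dist y c \<longrightarrow> dist y y' \<le> \<theta> * dist (T y) x)" for y x
    proof -
      obtain s where s: "to_circle s = y" by (metis Quotient_abs_rep Quotient_circle)
      \<comment> \<open>Lifting \<open>x\<close> next to \<open>F s\<close> makes the distance on
        the line equal the one on the circle.\<close>
      obtain v where v: "to_circle v = x" "\<bar>F s - v\<bar> = dist (T y) x" "\<bar>F s - v\<bar> \<le> 1 / 2"
        using circle_lift_near[of x "F s"] F(2)[of s] s by metis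
      obtain t where t: "F t = v" using surj by blast
      have d: "dist y (to_circle t) \<le> \<bar>s - t\<bar>"
        using dist_to_circle_le[of s t] s by (simp add: dist_real_def)
      have "\<bar>s - t\<bar> \<le> dist (T y) x" "\<bar>s - t\<bar> \<le> 1" using weak[of s t] t v by auto
      moreover have "\<bar>s - t\<bar> \<le> \<theta> * dist (T y) x" if "r \<le> dist y c"
        using contr[of s t] that s t v \<open>\<bar>s - t\<bar> \<le> 1\<close> by simp
      moreover have "T (to_circle t) = x" using F(2)[of t] t v(1) by simp
      ultimately show ?thesis using d by (intro exI[of _ "to_circle t"]) auto
    qed
    with \<theta> show "\<exists>\<theta>. 0 < \<theta> \<and> \<theta> < 1 \<and>
      (\<forall>y x. \<exists>y'. T y' = x \<and> dist y y' \<le> dist (T y) x \<and>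
        (r \<le> dist y c \<longrightarrow> dist y y' \<le> \<theta> * dist (T y) x))" by blast
    \<comment> \<open>Below this radius \<open>circle_lift_lipschitz\<close> keeps the lifted images
      within \<open>1 / 2\<close>, where their distance is that of the circle.\<close>
    have "dist y y' \<le> \<theta> * dist (T y) (T y')" if y: "r \<le> dist y c" "dist y y' < 1 / (4 * (M + 1))" for y y'
    proof -
      obtain s where s: "to_circle s = y" by (metis Quotient_abs_rep Quotient_circle)
      obtain t where t: "to_circle t = y'" "\<bar>s - t\<bar> = dist y y'" "\<bar>s - t\<bar> \<le> 1 / 2"
        using circle_lift_near[of y' s] s by metis
      have "\<bar>F s - F t\<bar> \<le> 1 / 2" using circle_lift_lipschitz(2)[OF M F, of s t] t(2) y(2) by simp
      then have "\<bar>F s - F t\<bar> = dist (T y) (T y')"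
        using dist_to_circle_small[of "F s" "F t"] F(2)[of s] F(2)[of t] s t(1) by simp
      then show ?thesis using contr[of s t] s t y(1) by simp
    qed
    moreover have "0 < 1 / (4 * (M + 1))" using \<open>M \<ge> 0\<close> by simp
    ultimately show "\<exists>\<theta> \<rho>. 0 < \<theta> \<and> \<theta> < 1 \<and> 0 < \<rho> \<and>
      (\<forall>y y'. r \<le> dist y c \<longrightarrow> dist y y' < \<rho> \<longrightarrow> dist y y' \<le> \<theta> * dist (T y) (T y'))"
      using \<theta> by blast
  qed (use assms in auto)
qed

theorem theorem4p1:
  fixes T :: "circle \<Rightarrow> circle" and c :: circle
  assumes "covering_space UNIV T UNIV"
    and "T c = c"
    and "\<exists>L. L-lipschitz_on UNIV T"
    and "\<And>V. open V \<Longrightarrow> c \<in> V \<Longrightarrow>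
      \<exists>C>1. AE x in circle_lebesgue. x \<notin> V \<longrightarrow> (\<exists>D. has_circle_derivative T D x \<and> \<bar>D\<bar> \<ge> C)"
  shows "lipschitz_TPO T"
proof -
  obtain L where "L-lipschitz_on UNIV T" using assms(3) by blast
  then interpret weakly_expanding T c L
    using assms(1,2,4) by (intro circle_weakly_expanding)
  show ?thesis by (rule lipschitz_TPO)
qed

end
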